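(* Let $\omega=\frac{-1+\sqrt{-3}}2$, and let $F^{(1)}_{E_1,E_2}$ be the elliptic curve over $\mathbf Q(s)$ $$Y^2=X^3-27\Bigl(s-506+\frac9s\Bigr),$$ the Inose fibration attached to the singular $K3$ surface $X_{[3,3,3]}$. With $S=\frac12\bigl(\frac s3+\frac3s\bigr)$, let $$P^{(1)}_\varphi=\left(\frac{S^3-93S^2+963S+4129}{64(S-1)},\ \frac{3s(s+3)(S^4-140S^3+4758S^2-13100S+258481)}{256(s-3)^3}\right)\in F^{(1)}_{E_1,E_2}(\mathbf Q(s)),$$ and let $[-\omega]P_\varphi^{(1)}=(\omega X,-Y)$ where $(X,Y)=P_\varphi^{(1)}$. Then the height matrix of $P_\varphi^{(1)}$, $[-\omega]P_\varphi^{(1)}$ is $\begin{pmatrix}6&3\\3&6\end{pmatrix}$, and these two sections form a basis of the Mordell-Weil group $F^{(1)}_{E_1,E_2}(\overline{\mathbf Q}(s))=F^{(1)}_{E_1,E_2}(\mathbf Q(\omega)(s))$.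
   Context: Here $E_1:y_1^2=x_1^3+6(x_1+1)^2$ and $E_2:y_2^2=x_2^3-2(3x_2+1)^2$, with $j(E_1)=0$, $j(E_2)=-1288000$; they are $3$-isogenous. For elliptic curves $E_1:y_1^2=x_1^3+a_2x_1^2+a_4x_1+a_6$ and $E_2:y_2^2=x_2^3+a_2'x_2^2+a_4'x_2+a_6'$, the elliptic $K3$ surface $F^{(1)}_{E_1,E_2}$ (whose Kodaira-Néron model is the Inose surface of $E_1,E_2$) is $$Y^2=X^3-\tfrac13AX+\tfrac1{64}\Bigl(\Delta_{E_1}s+B+\frac{\Delta_{E_2}}{s}\Bigr),$$ with $A=(a_2^2-3a_4)(a_2'^2-3a_4')$, $B=\frac{32}{27}(2a_2^3-9a_2a_4+27a_6)(2a_2'^3-9a_2'a_4'+27a_6')$, and $\Delta_{E_i}$ the discriminants of the given Weierstrass equations; the equation in the claim is this equation for $E_1:y_1^2=x_1^3+6(x_1+1)^2$ and $E_2:y_2^2=x_2^3-2(3x_2+1)^2$, up to rescaling. $X_{[3,3,3]}$ is the complex $K3$ surface of Picard number $20$ with transcendental lattice $\begin{pmatrix}6&3\\3&6\end{pmatrix}$. The height matrix is the Gram matrix for the canonical height pairing of the Mordell-Weil lattice (in Shioda's sense) of this elliptic $K3$ surface. *)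

theory Defs
  imports
    Complex_Main
    "HOL-Computational_Algebra.Computational_Algebra"
    "HOL-Computational_Algebra.Field_as_Ring"
    "HOL-Algebra.Group"
begin

text \<open>Every field in play is a subfield of \<open>\<complex>(s)\<close>, the fraction field of \<open>\<complex>[s]\<close>.\<close>

type_synonym ratfun = "complex poly fract"

definition is_subfield :: "complex set \<Rightarrow> bool" where
  "is_subfield K \<longleftrightarrow> 0 \<in> K \<and> 1 \<in> K \<and>
     (\<forall>x\<in>K. \<forall>y\<in>K. x + y \<in> K \<and> x * y \<in> K) \<and> (\<forall>x\<in>K. - x \<in> K \<and> inverse x \<in> K)"

definition Q_adjoin :: "complex \<Rightarrow> complex set" where
  "Q_adjoin w = \<Inter> {K. is_subfield K \<and> w \<in> K}"

definition Qbar :: "complex set" where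
  "Qbar = {z. algebraic z}"

definition const :: "complex \<Rightarrow> ratfun" where
  "const c = to_fract [:c:]"

definition var :: ratfun where
  "var = to_fract [:0, 1:]"

definition ratfuns_over :: "complex set \<Rightarrow> ratfun set" where
  "ratfuns_over K = {Fract p q | p q. q \<noteq> 0 \<and> (\<forall>i. coeff p i \<in> K) \<and> (\<forall>i. coeff q i \<in> K)}"

text \<open>Degree of a rational function as a self-map of the projective line;
  \<open>quot_of_fract\<close> yields numerator and denominator in lowest terms.\<close>

definition ratfun_degree :: "ratfun \<Rightarrow> nat" where
  "ratfun_degree f = max (degree (fst (quot_of_fract f))) (degree (snd (quot_of_fract f)))"

text \<open>\<open>WCurve a2 a4 a6\<close> stands for \<open>y^2 = x^3 + a2 x^2 + a4 x + a6\<close>.\<close>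

datatype 'a wcurve = WCurve (a2: 'a) (a4: 'a) (a6: 'a)

datatype 'a point = Infinity | Affine 'a 'a

fun on_curve :: "'a::field wcurve \<Rightarrow> 'a point \<Rightarrow> bool" where
  "on_curve E Infinity \<longleftrightarrow> True"
| "on_curve E (Affine x y) \<longleftrightarrow> y^2 = x^3 + a2 E * x^2 + a4 E * x + a6 E"

text \<open>Third point on the line of slope \<open>l\<close> through \<open>(x1, y1)\<close> and a point with
  abscissa \<open>x2\<close>, reflected in the x-axis.\<close>

definition ec_third :: "'a::field wcurve \<Rightarrow> 'a \<Rightarrow> 'a \<Rightarrow> 'a \<Rightarrow> 'a \<Rightarrow> 'a point" where
  "ec_third E l x1 y1 x2 = (let x3 = l^2 - a2 E - x1 - x2 in Affine x3 (l * (x1 - x3) - y1))"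

fun ec_add :: "'a::field wcurve \<Rightarrow> 'a point \<Rightarrow> 'a point \<Rightarrow> 'a point" where
  "ec_add E Infinity Q = Q"
| "ec_add E (Affine x1 y1) Infinity = Affine x1 y1"
| "ec_add E (Affine x1 y1) (Affine x2 y2) =
     (if x1 = x2 then
        if y1 = - y2 then Infinity
        else ec_third E ((3 * x1^2 + 2 * a2 E * x1 + a4 E) / (2 * y1)) x1 y1 x2
      else ec_third E ((y2 - y1) / (x2 - x1)) x1 y1 x2)"

definition ec_points :: "'a::field wcurve \<Rightarrow> 'a set \<Rightarrow> 'a point set" where
  "ec_points E L = {P. on_curve E P \<and> (\<forall>x y. P = Affine x y \<longrightarrow> x \<in> L \<and> y \<in> L)}"

definition ec_group :: "'a::field wcurve \<Rightarrow> 'a set \<Rightarrow> 'a point monoid" where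
  "ec_group E L = \<lparr>carrier = ec_points E L, mult = ec_add E, one = Infinity\<rparr>"

definition is_Z_basis_pair :: "('g, 'm) monoid_scheme \<Rightarrow> 'g \<Rightarrow> 'g \<Rightarrow> bool" where
  "is_Z_basis_pair G P Q \<longleftrightarrow> P \<in> carrier G \<and> Q \<in> carrier G \<and>
     (\<forall>R\<in>carrier G. \<exists>!c :: int \<times> int. R = (P [^]\<^bsub>G\<^esub> fst c) \<otimes>\<^bsub>G\<^esub> (Q [^]\<^bsub>G\<^esub> snd c))"

fun naive_height :: "ratfun point \<Rightarrow> nat" where
  "naive_height Infinity = 0"
| "naive_height (Affine x y) = ratfun_degree x"

text \<open>The limit exists by Tate's telescoping argument. With the factor \<open>1/2\<close>, and the
  pairing below defined without one, \<open>height_pairing E P P\<close> is twice \<open>canonical_height E P\<close>;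
  this is Shioda's normalization, in which \<open>\<langle>P,P\<rangle> = 2 \<chi> + 2 (P.O) - (local contributions)\<close>.\<close>

definition canonical_height :: "ratfun wcurve \<Rightarrow> ratfun point \<Rightarrow> real" where
  "canonical_height E P =
     lim (\<lambda>n. real (naive_height (((\<lambda>R. ec_add E R R) ^^ n) P)) / 4 ^ n) / 2"

definition height_pairing :: "ratfun wcurve \<Rightarrow> ratfun point \<Rightarrow> ratfun point \<Rightarrow> real" where
  "height_pairing E P Q =
     canonical_height E (ec_add E P Q) - canonical_height E P - canonical_height E Q"

definition height_matrix :: "ratfun wcurve \<Rightarrow> ratfun point list \<Rightarrow> real list list" where
  "height_matrix E Ps = map (\<lambda>P. map (\<lambda>Q. height_pairing E P Q) Ps) Ps"

definition ec_disc :: "'a::field wcurve \<Rightarrow> 'a" where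
  "ec_disc E = 16 * ((a2 E)^2 * (a4 E)^2 - 4 * (a4 E)^3 - 4 * (a2 E)^3 * a6 E
                     + 18 * a2 E * a4 E * a6 E - 27 * (a6 E)^2)"

definition inose_A :: "complex wcurve \<Rightarrow> complex wcurve \<Rightarrow> complex" where
  "inose_A E1 E2 = ((a2 E1)^2 - 3 * a4 E1) * ((a2 E2)^2 - 3 * a4 E2)"

definition inose_B :: "complex wcurve \<Rightarrow> complex wcurve \<Rightarrow> complex" where
  "inose_B E1 E2 = 32 / 27 * (2 * (a2 E1)^3 - 9 * a2 E1 * a4 E1 + 27 * a6 E1)
                           * (2 * (a2 E2)^3 - 9 * a2 E2 * a4 E2 + 27 * a6 E2)"

definition inose_F1 :: "complex wcurve \<Rightarrow> complex wcurve \<Rightarrow> ratfun wcurve" where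
  "inose_F1 E1 E2 = WCurve 0 (const (- inose_A E1 E2 / 3))
     (1 / 64 * (const (ec_disc E1) * var + const (inose_B E1 E2) + const (ec_disc E2) / var))"

text \<open>\<open>y^2 = x^3 + 6 (x + 1)^2\<close> and \<open>y^2 = x^3 - 2 (3 x + 1)^2\<close>, expanded\<close>

definition curve_E1 :: "complex wcurve" where
  "curve_E1 = WCurve 6 12 6"

definition curve_E2 :: "complex wcurve" where
  "curve_E2 = WCurve (- 18) (- 12) (- 2)"

end

theory Submission
  imports Defs "HOL-Analysis.Derivative"
begin

text \<open>Write \<open>f = -27 (s - 506 + 9/s) = g/s\<close> with \<open>g\<close> quadratic, so that the curve is \<open>Y^2 = X^3 + f\<close>.
The idea is to attach to every section one complex number that determines it, to show that these
numbers form a discrete \<open>\<int>[\<omega>]\<close>-submodule of \<open>\<complex>\<close>, hence a free one of rank one, and to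
recognise the given section as a generator by its height.

The number. On the cyclic cover \<open>w^6 = f\<close> a section becomes a map
\<open>(x, y) = (X/w^2, Y/w^3)\<close> to the fixed curve \<open>y^2 = x^3 + 1\<close>, and \<open>dx/y\<close> pulls back to a
holomorphic differential on which the covering group acts through a fixed character. These
differentials form a line, spanned by \<open>ds/(3 s w^5)\<close>; the coefficient \<open>c\<close> is characterised by
\<open>3 s f X' - s f' X = c Y\<close>. That \<open>c\<close> is constant and nonzero is proved by divisibility and degrees of polynomials
(lemma \<open>section_wronskian_constant\<close>), once \<open>(X, Y)\<close> has been brought into the form
\<open>(p/(s d)^2, B/(s d)^3)\<close> (\<open>point_imp_section_triple\<close>). It is additive because \<open>dx/y\<close> is an
invariant differential (\<open>pullback_coeff_ec_add\<close>); being nonzero away from the origin it is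
injective, which also yields associativity of the chord-tangent law. The automorphism
\<open>(X, Y) \<mapsto> (\<omega> X, -Y)\<close> multiplies it by \<open>-\<omega>\<close>.

Discreteness. Both zeros of \<open>f\<close> are real and positive, and \<open>f > 0\<close> between them. At either zero
\<open>w = 0\<close>, so the corresponding path on \<open>y^2 = x^3 + 1\<close> runs from the origin to the origin, and its
velocity in the local parameter \<open>x/y\<close> is about \<open>-c\<close> times a positive function. If \<open>c\<close> is small, the
path never leaves a neighbourhood of the origin in which the parameter moves steadily in the
direction of \<open>-c\<close>; it cannot return (\<open>pullback_coeff_discrete\<close>). In terms of periods: \<open>c\<close> times a
nonzero period is a period of the curve with \<open>j = 0\<close>. Division with remainder in \<open>\<int>[\<omega>]\<close> then gives a generator
(\<open>discrete_eisenstein_module_principal\<close>).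

Heights. The degree of \<open>X\<close> is the degree of \<open>p\<close>. It is multiplied by exactly 4 under doubling, so
it is twice the canonical height of the definitions; and it satisfies the parallelogram law, because
the symmetric functions of the abscissae of \<open>P + Q\<close> and \<open>P - Q\<close> have a common denominator and
primitive polynomials representing them have the degrees one expects (\<open>parallelogram\<close>). With the
invariance under the automorphism of order 6 this makes it multiplicative: \<open>a + b \<omega>\<close> multiplies it by the norm
\<open>a^2 - a b + b^2\<close> (\<open>naive_height_eisenstein_multiple\<close>). The given section has height 6, and no
nonzero section has height below 4; so the norm of its quotient by a generator is 1, and it is itself a generator
(\<open>pullback_coeff_lattice\<close>). The height matrix is that of the norm form scaled by 6, and all
sections, being integral combinations of two sections over \<open>\<rat>(\<omega>)\<close>, are defined over \<open>\<rat>(\<omega>)\<close>.\<close>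

section \<open>Rational functions in one variable\<close>

instance fract :: ("{idom,ring_char_0}") field_char_0
proof
  show "inj (of_nat :: nat \<Rightarrow> 'a fract)"
    by (rule injI) (simp add: of_nat_fract eq_fract)
qed

lemma var_nz: "var \<noteq> 0" by (simp add: var_def)

lemma to_fract_power: "to_fract (a ^ n) = to_fract a ^ n" by (induction n) simp_all

text \<open>Derivation of the rational function by the quotient rule, on the representation in lowest terms;
 \<open>fract_deriv_Fract\<close> shows that any other representation gives the same.\<close>

definition fract_deriv :: "ratfun \<Rightarrow> ratfun" where
  "fract_deriv x = (let (a, b) = quot_of_fract x in Fract (pderiv a * b - a * pderiv b) (b^2))"

lemma fract_deriv_Fract:
  assumes "b \<noteq> 0"
  shows "fract_deriv (Fract a b) = Fract (pderiv a * b - a * pderiv b) (b^2)"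
proof -
  obtain a' b' where q: "quot_of_fract (Fract a b) = (a', b')" by fastforce
  have b': "b' \<noteq> 0" using snd_quot_of_fract_nonzero[of "Fract a b"] q by simp
  have "Fract a b = Fract a' b'" using Fract_quot_of_fract[of "Fract a b"] q by simp
  hence e: "a * b' = a' * b" using assms b' by (simp add: eq_fract)
  have e': "pderiv a * b' + a * pderiv b' = pderiv a' * b + a' * pderiv b"
    using arg_cong[OF e, of pderiv] by (simp add: pderiv_mult algebra_simps)
  have "(pderiv a * b - a * pderiv b) * b'^2 = (pderiv a' * b' - a' * pderiv b') * b^2"
    using e e' by algebra
  thus ?thesis using q assms b' by (simp add: fract_deriv_def eq_fract)
qed

lemma fract_deriv_add: "fract_deriv (x + y) = fract_deriv x + fract_deriv y"
proof (cases x; cases y)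
  fix a b c d assume h: "x = Fract a b" "b \<noteq> 0" "y = Fract c d" "d \<noteq> 0"
  show ?thesis using h
    by (simp add: fract_deriv_Fract eq_fract pderiv_mult pderiv_add)
       (simp add: power2_eq_square algebra_simps)
qed

lemma fract_deriv_mult: "fract_deriv (x * y) = fract_deriv x * y + x * fract_deriv y"
proof (cases x; cases y)
  fix a b c d assume h: "x = Fract a b" "b \<noteq> 0" "y = Fract c d" "d \<noteq> 0"
  show ?thesis using h
    by (simp add: fract_deriv_Fract eq_fract pderiv_mult pderiv_add)
       (simp add: power2_eq_square algebra_simps)
qed

lemma fract_deriv_to_fract: "fract_deriv (to_fract a) = to_fract (pderiv a)"
  by (simp add: to_fract_def fract_deriv_Fract)

lemma fract_deriv_minus: "fract_deriv (- x) = - fract_deriv x"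
  using fract_deriv_add[of x "- x"] fract_deriv_to_fract[of 0]
  by (simp add: add_eq_0_iff)

lemma fract_deriv_diff: "fract_deriv (x - y) = fract_deriv x - fract_deriv y"
  using fract_deriv_add[of x "- y"] by (simp add: fract_deriv_minus)

lemma fract_deriv_power2: "fract_deriv (x^2) = 2 * x * fract_deriv x"
  by (simp add: power2_eq_square fract_deriv_mult)

lemma fract_deriv_power3: "fract_deriv (x^3) = 3 * x^2 * fract_deriv x"
  by (simp add: power2_eq_square power3_eq_cube fract_deriv_mult algebra_simps)

lemma ratfun_degree_coprime:
  fixes a b :: "complex poly"
  assumes "coprime a b" "b \<noteq> 0"
  shows "ratfun_degree (to_fract a / to_fract b) = max (degree a) (degree b)"
proof -
  obtain a' b' where q: "quot_of_fract (Fract a b) = (a', b')" by fastforce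
  have b': "b' \<noteq> 0" using snd_quot_of_fract_nonzero[of "Fract a b"] q by simp
  have c': "coprime a' b'" using coprime_quot_of_fract[of "Fract a b"] q by simp
  have "Fract a b = Fract a' b'" using Fract_quot_of_fract[of "Fract a b"] q by simp
  hence e: "a * b' = a' * b" using assms b' by (simp add: eq_fract)
  have "b dvd b'" using e assms(1) by (metis coprime_commute coprime_dvd_mult_right_iff dvd_triv_right)
  moreover have "b' dvd b" using e c' by (metis coprime_commute coprime_dvd_mult_right_iff dvd_triv_right)
  ultimately have db: "degree b = degree b'" using assms(2) b' by (simp add: dvd_imp_degree_le antisym)
  have da: "degree a = degree a'"
  proof (cases "a = 0")
    case True thus ?thesis using e assms(2) by auto
  next
    case False
    hence "a' \<noteq> 0" using e b' by auto
    thus ?thesis using arg_cong[OF e, of degree] False assms(2) b' db by (simp add: degree_mult_eq)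
  qed
  show ?thesis using q da db by (simp add: ratfun_degree_def Fract_conv_to_fract[symmetric])
qed

lemma const_add: "const (a + b) = const a + const b" by (simp add: const_def flip: to_fract_add)

lemma const_mult: "const (a * b) = const a * const b" by (simp add: const_def flip: to_fract_mult)

lemma const_uminus: "const (- a) = - const a" by (simp add: const_def flip: to_fract_uminus)

lemma const_eq_iff [simp]: "const a = const b \<longleftrightarrow> a = b" by (simp add: const_def)

lemma const_0 [simp]: "const 0 = 0" by (simp add: const_def)

lemma const_1 [simp]: "const 1 = 1" by (simp add: const_def one_pCons[symmetric])

lemma to_fract_numeral: "to_fract (numeral n :: 'a :: idom) = numeral n"
proof -
  have "to_fract (of_nat k :: 'a) = of_nat k" for k by (induction k) simp_all
  from this[of "numeral n"] show ?thesis by simp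
qed

lemma const_numeral [simp]: "const (numeral n) = numeral n"
  by (simp add: const_def flip: numeral_poly to_fract_numeral)

lemma fract_deriv_const [simp]: "fract_deriv (const a) = 0"
  by (simp add: const_def fract_deriv_to_fract pderiv_pCons)

lemma fract_deriv_numeral [simp]: "fract_deriv (numeral n) = 0"
  using fract_deriv_const[of "numeral n"] by (simp del: fract_deriv_const)

lemma to_fract_smult: "to_fract (smult c p) = const c * to_fract p"
  by (simp add: const_def flip: to_fract_mult)

lemma complex_poly_coprimeI:
  fixes a b :: "complex poly"
  assumes "\<And>z. poly a z = 0 \<Longrightarrow> poly b z \<noteq> 0" "a \<noteq> 0 \<or> b \<noteq> 0"
  shows "coprime a b"
proof (rule ccontr)
  assume "\<not> coprime a b"
  hence "\<not> is_unit (gcd a b)" by (simp only: is_unit_gcd not_False_eq_True)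
  moreover have "gcd a b \<noteq> 0" using assms(2) by simp
  ultimately have "degree (gcd a b) \<noteq> 0" by (metis is_unit_iff_degree)
  then obtain z where "poly (gcd a b) z = 0"
    using fundamental_theorem_of_algebra constant_degree by metis
  moreover have "poly a z = 0" "poly b z = 0" if "poly (gcd a b) z = 0"
    using that by (meson gcd_dvd1 gcd_dvd2 dvd_trans poly_eq_0_iff_dvd)+
  ultimately show False using assms(1) by blast
qed

lemma coprime_no_common_root: "coprime (a :: complex poly) b \<Longrightarrow> poly a z = 0 \<Longrightarrow> poly b z \<noteq> 0"
proof
  assume "coprime a b" "poly a z = 0" "poly b z = 0"
  hence "is_unit [:-z, 1:]" using coprime_common_divisor by (metis poly_eq_0_iff_dvd)
  thus False by (simp add: is_unit_iff_degree)
qed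

section \<open>Sections as triples of polynomials\<close>

text \<open>The numerator \<open>g\<close> of \<open>f = g/s\<close>. Its two simple roots are the places of the two
  irreducible singular fibres of type II; the other two singular fibres, of type \<open>II\<^sup>*\<close>, lie over \<open>0\<close> and \<open>\<infinity>\<close>.\<close>

definition disc_poly :: "complex poly" where "disc_poly = [:-243, 13662, -27:]"

definition s_poly :: "complex poly" where "s_poly = [:0, 1:]"

lemma poly_s [simp]: "poly s_poly z = z" by (simp add: s_poly_def)

lemma degree_s [simp]: "degree s_poly = 1" by (simp add: s_poly_def)

lemma pderiv_s [simp]: "pderiv s_poly = 1" by (simp add: s_poly_def pderiv_pCons)

lemma s_nz [simp]: "s_poly \<noteq> 0" by (simp add: s_poly_def)

text \<open>The data of a section \<open>(p/(s d)^2, B/(s d)^3)\<close>. Over \<open>\<complex>[s]\<close> the curve has the integral model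
  \<open>y^2 = x^3 + g s^5\<close> with \<open>x = s^2 X\<close> and \<open>y = s^3 Y\<close>, whence the power of \<open>s\<close>. The factor \<open>s\<close> next to \<open>d\<close>
  says that \<open>X\<close> always has a pole at \<open>0\<close>: a section meets the only simple component of the fibre
  of type \<open>II\<^sup>*\<close> there.\<close>

definition section_triple :: "complex poly \<Rightarrow> complex poly \<Rightarrow> complex poly \<Rightarrow> bool" where
  "section_triple p B d \<longleftrightarrow> d \<noteq> 0 \<and> coprime p (s_poly * d) \<and> B^2 = p^3 + disc_poly * s_poly^5 * d^6"

definition section_point :: "complex poly \<Rightarrow> complex poly \<Rightarrow> complex poly \<Rightarrow> ratfun point" where
  "section_point p B d = Affine (to_fract p / to_fract (s_poly * d)^2) (to_fract B / to_fract (s_poly * d)^3)"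

definition inose_curve :: "ratfun wcurve" where
  "inose_curve = WCurve 0 0 (to_fract disc_poly / var)"

text \<open>Unique factorization enters only through the fact that \<open>q^2 dvd b^2\<close> implies \<open>q dvd b\<close>.\<close>

lemma square_eq_cube_imp:
  fixes q b :: "complex poly"
  assumes "b^2 = q^3" "q \<noteq> 0"
  obtains d where "q = d^2" "b = d^3" "d \<noteq> 0"
proof -
  have "q^2 dvd b^2" using assms(1) by (simp add: le_imp_power_dvd)
  hence "q dvd b" by simp
  then obtain d where d: "b = q * d" by blast
  have "q^2 * d^2 = q^2 * q" using assms d by (simp add: power_mult_distrib power2_eq_square power3_eq_cube algebra_simps)
  hence q: "q = d^2" using assms(2) by simp
  have "b = d^3" using d q by (simp add: power2_eq_square power3_eq_cube)
  with q assms(2) show ?thesis using that by auto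
qed

text \<open>In lowest terms \<open>x = p/q\<close> and \<open>y = B/b\<close> the equation reads \<open>B^2 q^3 = b^2 (p^3 + H q^3)\<close>; coprimality
  makes \<open>b^2\<close> and \<open>q^3\<close> divide each other, so they agree after normalization.\<close>

lemma integral_weierstrass_denominator:
  fixes H :: "complex poly" and x y :: ratfun
  assumes "y^2 = x^3 + to_fract H"
  obtains p B d where "d \<noteq> 0" "coprime p d" "x = to_fract p / to_fract d ^ 2"
    "y = to_fract B / to_fract d ^ 3" "B^2 = p^3 + H * d^6"
proof -
  obtain p q where q: "quot_of_fract x = (p, q)" by fastforce
  obtain a b where b: "quot_of_fract y = (a, b)" by fastforce
  have nz: "q \<noteq> 0" "b \<noteq> 0"
    using snd_quot_of_fract_nonzero[of x] snd_quot_of_fract_nonzero[of y] q b by auto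
  have cop: "coprime p q" "coprime a b"
    using coprime_quot_of_fract[of x] coprime_quot_of_fract[of y] q b by auto
  have norm: "normalize q = q" "normalize b = b"
    using normalize_snd_quot_of_fract[of x] normalize_snd_quot_of_fract[of y] q b by auto
  have x: "x = to_fract p / to_fract q" using Fract_quot_of_fract[of x] q by (simp add: Fract_conv_to_fract)
  have y: "y = to_fract a / to_fract b" using Fract_quot_of_fract[of y] b by (simp add: Fract_conv_to_fract)
  have "to_fract a ^ 2 * to_fract q ^ 3 = to_fract b ^ 2 * (to_fract p ^ 3 + to_fract H * to_fract q ^ 3)"
    using assms nz unfolding x y by (simp add: divide_simps power2_eq_square power3_eq_cube)
  hence "to_fract (a^2 * q^3) = to_fract (b^2 * (p^3 + H * q^3))"
    by (simp add: power2_eq_square power3_eq_cube)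
  hence e: "a^2 * q^3 = b^2 * (p^3 + H * q^3)" by (simp only: to_fract_eq_iff)
  have "b^2 dvd a^2 * q^3" using e by simp
  hence d1: "b^2 dvd q^3" using cop by (metis coprime_commute coprime_dvd_mult_right_iff coprime_power_left_iff coprime_power_right_iff)
  have "coprime (q^3) (p^3 + H * q^3)"
  proof -
    have "gcd (q^3) (H * q^3 + p^3) = gcd (q^3) (p^3)" by (rule gcd_add_mult)
    also have "\<dots> = 1" using cop by (simp flip: coprime_iff_gcd_eq_1 add: coprime_commute)
    finally show ?thesis by (simp add: coprime_iff_gcd_eq_1 add.commute)
  qed
  moreover have "q^3 dvd b^2 * (p^3 + H * q^3)" using e by (metis dvd_triv_right)
  ultimately have d2: "q^3 dvd b^2" by (simp add: coprime_dvd_mult_left_iff)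
  have "normalize (q^3) = normalize (b^2)" by (rule associatedI[OF d2 d1])
  hence "b^2 = q^3" using norm by (simp add: normalize_power)
  then obtain d where d: "q = d^2" "b = d^3" "d \<noteq> 0" using square_eq_cube_imp nz by blast
  have "d^6 * a^2 = d^6 * (p^3 + H * d^6)"
    using e d by (simp add: power_mult[symmetric] mult.commute)
  hence "a^2 = p^3 + H * d^6" using d by simp
  moreover have "coprime p d" using cop d by simp
  moreover have "to_fract (d^2) = to_fract d ^ 2" "to_fract (d^3) = to_fract d ^ 3"
    by (simp_all add: power2_eq_square power3_eq_cube)
  ultimately show ?thesis using that[of d p a] x y d by simp
qed

lemma poly_disc_0: "poly disc_poly 0 = -243" by (simp add: disc_poly_def)

lemma s_dvd_iff: "s_poly dvd q \<longleftrightarrow> poly q 0 = 0"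
  using poly_eq_0_iff_dvd[of q 0] by (simp add: s_poly_def)

lemma s_factor: "poly q 0 = 0 \<Longrightarrow> \<exists>r. q = s_poly * r"
  using s_dvd_iff[of q] by (simp add: dvd_def)

lemma s_prime: "prime_elem s_poly"
  by (simp add: s_poly_def prime_elem_linear_field_poly)

text \<open>Tate's algorithm by hand: if \<open>s\<close> divides \<open>p\<close>, then comparing powers of \<open>s\<close> in the equation
  forces it to divide \<open>B\<close> and \<open>p\<close> again and again, until the left side is divisible by \<open>s^6\<close> while
  the coefficient of \<open>s^5\<close> on the right is \<open>g(0) d(0)^6\<close>, which is not zero.\<close>

lemma numerator_nonzero_at_0:
  assumes "B^2 = p^3 + disc_poly * s_poly^5 * d^6" "coprime p d"
  shows "poly p 0 \<noteq> 0"
proof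
  assume p0: "poly p 0 = 0"
  then obtain p1 where p1: "p = s_poly * p1" using s_factor by blast
  have d0: "poly d 0 \<noteq> 0"
  proof
    assume "poly d 0 = 0"
    hence "s_poly dvd d" "s_poly dvd p" using p0 by (simp_all only: s_dvd_iff)
    hence "is_unit s_poly" using assms(2) coprime_common_divisor by blast
    thus False using s_prime by (simp add: prime_elem_def)
  qed
  have sB: "poly B 0 = 0" using arg_cong[OF assms(1), of "\<lambda>q. poly q 0"] p0 by simp
  then obtain B1 where B1: "B = s_poly * B1" using s_factor by blast
  have "s_poly^2 * B1^2 = s_poly^2 * (s_poly * p1^3 + disc_poly * s_poly^3 * d^6)"
    using assms(1) unfolding p1 B1 by (simp add: power_mult_distrib eval_nat_numeral algebra_simps)
  hence e1: "B1^2 = s_poly * p1^3 + disc_poly * s_poly^3 * d^6" by (simp only: mult_cancel_left) simp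
  have "poly B1 0 = 0" using arg_cong[OF e1, of "\<lambda>q. poly q 0"] by simp
  then obtain B2 where B2: "B1 = s_poly * B2" using s_factor by blast
  have "s_poly * (s_poly * B2^2) = s_poly * (p1^3 + disc_poly * s_poly^2 * d^6)"
    using e1 unfolding B2 by (simp add: power_mult_distrib eval_nat_numeral algebra_simps)
  hence e2: "s_poly * B2^2 = p1^3 + disc_poly * s_poly^2 * d^6" by (simp only: mult_cancel_left) simp
  have "poly p1 0 = 0" using arg_cong[OF e2, of "\<lambda>q. poly q 0"] by simp
  then obtain p2 where p2: "p1 = s_poly * p2" using s_factor by blast
  have "s_poly * B2^2 = s_poly * (s_poly^2 * p2^3 + disc_poly * s_poly * d^6)"
    using e2 unfolding p2 by (simp add: power_mult_distrib eval_nat_numeral algebra_simps)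
  hence e3: "B2^2 = s_poly^2 * p2^3 + disc_poly * s_poly * d^6" by (simp only: mult_cancel_left) simp
  have "poly B2 0 = 0" using arg_cong[OF e3, of "\<lambda>q. poly q 0"] by simp
  then obtain B3 where B3: "B2 = s_poly * B3" using s_factor by blast
  have "s_poly * (s_poly * B3^2) = s_poly * (s_poly * p2^3 + disc_poly * d^6)"
    using e3 unfolding B3 by (simp add: power_mult_distrib eval_nat_numeral algebra_simps)
  hence e4: "s_poly * B3^2 = s_poly * p2^3 + disc_poly * d^6" by (simp only: mult_cancel_left) simp
  show False using arg_cong[OF e4, of "\<lambda>q. poly q 0"] d0 poly_disc_0 by simp
qed

lemma point_imp_section_triple:
  assumes "on_curve inose_curve (Affine X Y)"
  obtains p B d where "section_triple p B d" "Affine X Y = section_point p B d"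
proof -
  let ?s = "to_fract s_poly"
  have s: "?s \<noteq> 0" by simp
  have "Y^2 = X^3 + to_fract disc_poly / ?s" using assms by (simp add: inose_curve_def var_def s_poly_def)
  hence "?s * Y^2 = ?s * X^3 + to_fract disc_poly" using s by (simp add: field_simps)
  hence "(?s^3 * Y)^2 = (?s^2 * X)^3 + ?s^5 * to_fract disc_poly"
    by algebra
  hence "(?s^3 * Y)^2 = (?s^2 * X)^3 + to_fract (disc_poly * s_poly^5)"
    by (simp add: numeral_eq_Suc mult.commute)
  then obtain p B d where h: "d \<noteq> 0" "coprime p d" "?s^2 * X = to_fract p / to_fract d ^ 2"
    "?s^3 * Y = to_fract B / to_fract d ^ 3" "B^2 = p^3 + (disc_poly * s_poly^5) * d^6"
    by (rule integral_weierstrass_denominator)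
  have "poly p 0 \<noteq> 0" using numerator_nonzero_at_0[of B p d] h by (simp add: mult.assoc)
  hence "\<not> s_poly dvd p" by (simp only: s_dvd_iff not_False_eq_True)
  hence "coprime p s_poly" using s_prime by (metis coprime_commute prime_elem_imp_coprime)
  hence "section_triple p B d" using h by (simp add: section_triple_def)
  moreover have "Affine X Y = section_point p B d"
  proof -
    have "X = to_fract p / to_fract d ^ 2 / ?s^2" "Y = to_fract B / to_fract d ^ 3 / ?s^3"
      unfolding h(3,4)[symmetric] using s by simp_all
    thus ?thesis by (simp add: section_point_def power_mult_distrib mult.commute)
  qed
  ultimately show ?thesis using that by blast
qed

definition inose_f :: ratfun where "inose_f = to_fract disc_poly / var"

lemma inose_curve_iff: "on_curve inose_curve (Affine x y) \<longleftrightarrow> y^2 = x^3 + inose_f"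
  by (simp add: inose_curve_def inose_f_def)

lemma inose_curve_sel [simp]: "a2 inose_curve = 0" "a4 inose_curve = 0" "a6 inose_curve = inose_f"
  by (simp_all add: inose_curve_def inose_f_def)

lemma var_eq: "var = to_fract s_poly" by (simp add: var_def s_poly_def)

lemma inose_f_section: "inose_f * to_fract (s_poly * d)^2 = to_fract (disc_poly * s_poly * d^2)"
  by (simp add: inose_f_def var_eq to_fract_power power_mult_distrib power2_eq_square)

lemma section_on_curve:
  assumes "section_triple p B d"
  shows "on_curve inose_curve (section_point p B d)"
proof -
  define E where "E = to_fract (s_poly * d)"
  have E: "E \<noteq> 0" using assms by (simp add: E_def section_triple_def)
  have "B^2 = p^3 + disc_poly * s_poly^5 * d^6" using assms by (simp add: section_triple_def)
  hence "to_fract B ^ 2 = to_fract p ^ 3 + to_fract (disc_poly * s_poly * d^2) * E^4"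
    unfolding E_def to_fract_power[symmetric] to_fract_mult[symmetric] to_fract_add[symmetric] to_fract_eq_iff
    by (simp add: power_mult_distrib eval_nat_numeral mult_ac)
  also have "to_fract (disc_poly * s_poly * d^2) * E^4 = inose_f * E^6"
    unfolding inose_f_section[symmetric] E_def[symmetric] by (simp add: eval_nat_numeral)
  finally have e: "to_fract B ^ 2 = to_fract p ^ 3 + inose_f * E^6" .
  have "(to_fract B / E^3)^2 = to_fract B ^ 2 / E^6" "(to_fract p / E^2)^3 = to_fract p ^ 3 / E^6"
    by (simp_all add: power_divide flip: power_mult)
  hence "(to_fract B / E^3)^2 = (to_fract p / E^2)^3 + inose_f"
    unfolding e using E by (simp add: add_divide_distrib)
  thus ?thesis by (simp add: section_point_def inose_curve_iff E_def)
qed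

lemma disc_nz [simp]: "disc_poly \<noteq> 0" by (simp add: disc_poly_def)

lemma degree_disc [simp]: "degree disc_poly = 2" by (simp add: disc_poly_def)

text \<open>The fibre at infinity: \<open>p^3\<close> must dominate, because the degree \<open>7 + 6 deg d\<close> of the other term is odd,
  hence not that of a square, and not divisible by 3.\<close>

lemma section_triple_degrees:
  assumes "section_triple p B d"
  shows "degree p \<ge> 2 * degree d + 4" "2 * degree B = 3 * degree p" "degree p \<ge> 4" "p \<noteq> 0" "B \<noteq> 0"
proof -
  let ?h = "disc_poly * s_poly^5 * d^6"
  have d: "d \<noteq> 0" and e: "B^2 = p^3 + ?h" using assms by (auto simp: section_triple_def)
  have h: "degree ?h = 7 + 6 * degree d" using d by (simp add: degree_mult_eq degree_power_eq)
  have dB: "degree (B^2) = 2 * degree B" and dp: "degree (p^3) = 3 * degree p"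
    by (cases "B = 0"; simp add: degree_power_eq) (cases "p = 0"; simp add: degree_power_eq)
  have "degree (p^3) > degree ?h"
  proof (rule ccontr)
    assume "\<not> ?thesis"
    moreover have "degree (p^3) \<noteq> degree ?h" unfolding h dp by presburger
    ultimately have "degree (B^2) = degree ?h" unfolding e by (simp add: degree_add_eq_right)
    thus False unfolding h dB by presburger
  qed
  hence gt: "3 * degree p > 7 + 6 * degree d" and "degree (B^2) = degree (p^3)"
    unfolding e using h dp by (simp_all add: degree_add_eq_left)
  thus eq: "2 * degree B = 3 * degree p" using dB dp by simp
  have "even (degree p)" using eq by presburger
  thus "degree p \<ge> 2 * degree d + 4" using gt by presburger
  thus "degree p \<ge> 4" by simp
  thus "p \<noteq> 0" by auto
  show "B \<noteq> 0" using eq \<open>degree p \<ge> 4\<close> by auto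
qed

lemma disc_simple_root: "poly disc_poly z = 0 \<Longrightarrow> poly (pderiv disc_poly) z \<noteq> 0"
proof
  assume "poly disc_poly z = 0" and 1: "poly (pderiv disc_poly) z = 0"
  hence "z * (13662 - 27 * z) = 243" by (simp add: disc_poly_def algebra_simps)
  moreover have "54 * z = 13662" using 1 by (simp add: disc_poly_def pderiv_pCons algebra_simps)
  hence "z = 253" by simp
  ultimately show False by simp
qed

text \<open>A common root would be a root of \<open>g\<close>, and there \<open>B^2 - p^3\<close> vanishes to order at least 2 whereas
  \<open>g s^5 d^6\<close> vanishes to order 1. Geometrically, no section passes through the cusp of a fibre of type II.\<close>

lemma section_triple_pB_no_common_root:
  assumes "section_triple p B d" "poly p z = 0"
  shows "poly B z \<noteq> 0"
proof
  assume B: "poly B z = 0"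
  have d: "coprime p (s_poly * d)" and e: "B^2 = p^3 + disc_poly * s_poly^5 * d^6"
    using assms by (auto simp: section_triple_def)
  have "poly (s_poly * d) z \<noteq> 0" using coprime_no_common_root[OF d assms(2)] .
  hence nz: "z \<noteq> 0" "poly d z \<noteq> 0" by auto
  have "poly disc_poly z * z^5 * poly d z ^ 6 = 0"
    using arg_cong[OF e, of "\<lambda>q. poly q z"] assms(2) B by simp
  hence g: "poly disc_poly z = 0" using nz by simp
  have "pderiv (B^2) = pderiv (p^3 + disc_poly * s_poly^5 * d^6)" using e by simp
  hence "poly (pderiv (B^2)) z = poly (pderiv (p^3 + disc_poly * s_poly^5 * d^6)) z" by simp
  hence "poly (pderiv disc_poly) z * z^5 * poly d z ^ 6 = 0"
    using assms(2) B g by (auto simp: pderiv_mult pderiv_add pderiv_power)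
  thus False using disc_simple_root[OF g] nz by simp
qed

section \<open>The pullback of the invariant differential\<close>

text \<open>The numerator of \<open>3 s f X' - s f' X\<close> over \<open>(s d)^3\<close>; see \<open>nabla_section\<close>.\<close>

definition section_wronskian :: "complex poly \<Rightarrow> complex poly \<Rightarrow> complex poly" where
  "section_wronskian p d = 3 * disc_poly * s_poly * (pderiv p * d - 2 * p * pderiv d)
     - 5 * disc_poly * p * d - s_poly * pderiv disc_poly * p * d"

text \<open>Differentiating \<open>B^2 = p^3 + g s^5 d^6\<close> shows that \<open>B\<close> divides \<open>p^2\<close> times the Wronskian \<open>W\<close>, hence
  \<open>W\<close> itself; and \<open>deg W \<le> deg B\<close>. So the quotient is constant. It is not zero, since at a root of \<open>g\<close>
  where \<open>d\<close> vanishes to order \<open>m \<ge> 0\<close>, the lowest coefficient of \<open>W\<close> is a nonzero multiple of \<open>6 m + 1\<close>.\<close>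

lemma section_wronskian_constant:
  assumes "section_triple p B d"
  obtains c where "c \<noteq> 0" "section_wronskian p d = smult c B"
proof -
  let ?g = disc_poly and ?s = s_poly and ?W = "section_wronskian p d"
  let ?K = "6 * ?g * ?s * pderiv d + 5 * ?g * d + ?s * pderiv ?g * d"
  have d: "d \<noteq> 0" "coprime p (s_poly * d)" and e: "B^2 = p^3 + ?g * ?s^5 * d^6"
    using assms by (auto simp: section_triple_def)
  note deg = section_triple_degrees[OF assms]
  have "pderiv (B^2) = pderiv (p^3 + ?g * ?s^5 * d^6)" using e by simp
  hence e': "2 * B * pderiv B = 3 * p^2 * pderiv p + pderiv ?g * ?s^5 * d^6
      + 5 * ?g * ?s^4 * d^6 + 6 * ?g * ?s^5 * d^5 * pderiv d"
    by (simp add: pderiv_mult pderiv_add pderiv_power algebra_simps numeral_poly)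
  have "p^2 * ?W = B * (2 * ?g * ?s * d * pderiv B - B * ?K)"
    using e e' unfolding section_wronskian_def by algebra
  hence "B dvd p^2 * ?W" by simp
  moreover have "coprime B p"
    using complex_poly_coprimeI[of p B] section_triple_pB_no_common_root[OF assms] deg(4)
    by (auto simp: coprime_commute)
  ultimately have "B dvd ?W" by (simp add: coprime_dvd_mult_right_iff)
  then obtain c where c: "?W = B * c" by blast
  have "degree ?W \<le> degree p + degree d + 2"
  proof -
    have 1: "degree (pderiv p * d - 2 * p * pderiv d) \<le> degree p + degree d - 1"
    proof (rule degree_diff_le)
      show "degree (pderiv p * d) \<le> degree p + degree d - 1"
        using degree_mult_le[of "pderiv p" d] degree_pderiv[of p] deg(3) by simp
      show "degree (2 * p * pderiv d) \<le> degree p + degree d - 1"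
      proof (cases "degree d = 0")
        case True
        hence "pderiv d = 0" by (simp add: pderiv_eq_0_iff)
        thus ?thesis by simp
      next
        case False
        have "degree (2 * p * pderiv d) = degree (smult 2 (p * pderiv d))" by (simp add: numeral_poly)
        also have "\<dots> \<le> degree p + (degree d - 1)" using degree_mult_le[of p "pderiv d"] degree_pderiv[of d] by simp
        finally show ?thesis using False by simp
      qed
    qed
    have 2: "degree (3 * ?g * ?s * (pderiv p * d - 2 * p * pderiv d)) \<le> degree p + degree d + 2"
    proof -
      have "degree (3 * ?g * ?s) \<le> 3" by (simp add: disc_poly_def s_poly_def numeral_poly)
      thus ?thesis using 1 deg(3) degree_mult_le[of "3 * ?g * ?s" "pderiv p * d - 2 * p * pderiv d"] by simp
    qed
    have 3: "degree (5 * ?g * p * d) \<le> degree p + degree d + 2"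
    proof -
      have "degree (5 * ?g) \<le> 2" by (simp add: disc_poly_def numeral_poly)
      thus ?thesis using degree_mult_le[of "5 * ?g * p" d] degree_mult_le[of "5 * ?g" p] by simp
    qed
    have 4: "degree (?s * pderiv ?g * p * d) \<le> degree p + degree d + 2"
    proof -
      have "degree (?s * pderiv ?g) \<le> 2" by (simp add: disc_poly_def s_poly_def pderiv_pCons)
      thus ?thesis using degree_mult_le[of "?s * pderiv ?g * p" d] degree_mult_le[of "?s * pderiv ?g" p] by simp
    qed
    show ?thesis unfolding section_wronskian_def by (intro degree_diff_le 2 3 4)
  qed
  also have "\<dots> \<le> degree B" using deg by simp
  finally have "degree c = 0" if "c \<noteq> 0" using c that deg(5) by (simp add: degree_mult_eq)
  hence "degree c = 0" by (cases "c = 0") auto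
  then obtain c0 where c0: "c = [:c0:]" by (rule degree_eq_zeroE)
  hence W: "?W = smult c0 B" using c by (simp add: mult.commute)
  have "?W \<noteq> 0"
  proof
    assume W0: "?W = 0"
    obtain z where z: "poly ?g z = 0"
      using fundamental_theorem_of_algebra[of ?g] constant_degree[of ?g] by auto
    have z0: "z \<noteq> 0" using z poly_disc_0 by auto
    define l where "l = [:-z, 1:]"
    have l: "poly l z = 0" "pderiv l = 1" "l \<noteq> 0" by (simp_all add: l_def pderiv_pCons)
    have l_dvd: "poly q z = 0 \<longleftrightarrow> l dvd q" for q by (simp add: l_def poly_eq_0_iff_dvd)
    obtain r where r: "?g = l * r" using z unfolding l_dvd by blast
    have pg: "pderiv ?g = r + l * pderiv r" unfolding r pderiv_mult l by simp
    have r0: "poly r z \<noteq> 0" using disc_simple_root[OF z] unfolding pg by (simp add: l)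
    obtain q where q: "d = l ^ order z d * q" "\<not> l dvd q"
      using order_decomp[OF d(1)] unfolding l_def by blast
    \<comment> \<open>Near the root \<open>z\<close> of \<open>g\<close> write \<open>d = l^m q\<close> and \<open>g = l r\<close>; the power \<open>l^m\<close> divides the whole Wronskian.\<close>
    define m where "m = order z d"
    have q0: "poly q z \<noteq> 0" using q(2) l_dvd by blast
    have pd: "l * pderiv d = l ^ m * (of_nat m * q + l * pderiv q)"
    proof (cases m)
      case 0 thus ?thesis using q(1) unfolding m_def by simp
    next
      case (Suc k)
      have "pderiv d = pderiv (l ^ m * q)" using q(1) unfolding m_def by simp
      also have "\<dots> = of_nat m * l ^ k * q + l ^ m * pderiv q"
        unfolding Suc pderiv_mult pderiv_power_Suc by (simp add: l algebra_simps of_nat_poly smult_add_left)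
      finally show ?thesis unfolding Suc by (simp add: algebra_simps)
    qed
    have dm: "d = l ^ m * q" using q(1) unfolding m_def by simp
    have "?W = l ^ m * (3 * l * r * ?s * pderiv p * q - 6 * r * ?s * p * (of_nat m * q + l * pderiv q)
       - 5 * l * r * p * q - ?s * (r + l * pderiv r) * p * q)"
    proof -
      have "?W = 3 * r * ?s * (pderiv p * (l * d) - 2 * p * (l * pderiv d)) - 5 * r * l * p * d
        - ?s * (r + l * pderiv r) * p * d"
        unfolding section_wronskian_def pg unfolding r by algebra
      also have "\<dots> = 3 * r * ?s * (pderiv p * (l * (l ^ m * q)) - 2 * p * (l ^ m * (of_nat m * q + l * pderiv q)))
        - 5 * r * l * p * (l ^ m * q) - ?s * (r + l * pderiv r) * p * (l ^ m * q)"
        unfolding pd using dm by simp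
      finally show ?thesis by (simp add: algebra_simps)
    qed
    hence "3 * l * r * ?s * pderiv p * q - 6 * r * ?s * p * (of_nat m * q + l * pderiv q)
       - 5 * l * r * p * q - ?s * (r + l * pderiv r) * p * q = 0" (is "?V = 0") using W0 l(3) by simp
    hence "poly ?V z = 0" by (simp only: poly_0)
    moreover have "poly ?V z = - (poly r z * z * poly p z * poly q z * (6 * of_nat m + 1))"
      by (simp add: l algebra_simps)
    ultimately have "poly r z * z * poly p z * poly q z * (6 * of_nat m + 1) = 0" by simp
    hence "poly p z * (6 * of_nat m + 1) = 0" using r0 q0 z0 by auto
    moreover have "(6 * of_nat m + 1 :: complex) \<noteq> 0"
      using of_nat_neq_0[of "6*m", where 'a = complex] by (simp add: add.commute)
    ultimately have p0: "poly p z = 0" by simp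
    have "poly (p^3 + ?g * ?s^5 * d^6) z = 0" using p0 z by simp
    hence "poly (B^2) z = 0" using e by simp
    thus False using section_triple_pB_no_common_root[OF assms p0] by simp
  qed
  hence "c0 \<noteq> 0" using W by auto
  thus ?thesis using W that by blast
qed

text \<open>The derivation \<open>3 s f d/ds\<close>, corrected so that it annihilates \<open>w^2\<close>, where \<open>w^6 = f\<close>: \<open>nabla X\<close>
  is \<open>w^2\<close> times the image of \<open>X/w^2\<close> under \<open>3 s f d/ds\<close>.\<close>

definition nabla :: "ratfun \<Rightarrow> ratfun" where
  "nabla x = 3 * var * inose_f * fract_deriv x - var * fract_deriv inose_f * x"

text \<open>The ratio of the pullback of \<open>dx/y\<close> to the differential \<open>ds/(3 s w^5)\<close> on the cover \<open>w^6 = f\<close>.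
  The description is proper for points on the curve, by \<open>nabla_pullback_coeff\<close>.\<close>

definition pullback_coeff :: "ratfun point \<Rightarrow> complex" where
  "pullback_coeff P = (case P of Infinity \<Rightarrow> 0 | Affine X Y \<Rightarrow> (THE c. nabla X = const c * Y))"

lemma pullback_coeff_Infinity [simp]: "pullback_coeff Infinity = 0" by (simp add: pullback_coeff_def)

lemma pullback_coeff_eqI: "nabla x = const c * y \<Longrightarrow> y \<noteq> 0 \<Longrightarrow> pullback_coeff (Affine x y) = c"
  by (auto simp: pullback_coeff_def intro!: the_equality)

lemma nabla_section:
  assumes "d \<noteq> 0"
  shows "nabla (to_fract p / to_fract (s_poly * d)^2) = to_fract (section_wronskian p d) / to_fract (s_poly * d)^3"
proof -
  define E P G s where "E = to_fract (s_poly * d)" and "P = to_fract p" and "G = to_fract disc_poly" and "s = var"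
  define d' p' g' where "d' = to_fract (pderiv d)" and "p' = to_fract (pderiv p)" and "g' = to_fract (pderiv disc_poly)"
  define D where "D = to_fract d"
  have nz: "E \<noteq> 0" "s \<noteq> 0" using assms by (simp_all add: E_def s_def var_nz)
  have E: "E = s * D" by (simp add: E_def s_def D_def var_eq)
  have X: "(P / E^2) * E^2 = P" using nz by simp
  have dE: "fract_deriv E = D + s * d'"
    unfolding E_def fract_deriv_to_fract D_def d'_def s_def var_eq by (simp add: pderiv_mult flip: to_fract_mult to_fract_add)
  have "fract_deriv (P / E^2) * E^2 + (P / E^2) * (2 * E * fract_deriv E) = p'"
    using arg_cong[OF X, of fract_deriv] unfolding fract_deriv_mult fract_deriv_power2
    by (simp add: P_def p'_def fract_deriv_to_fract)
  hence "fract_deriv (P / E^2) * E^3 = p' * E - 2 * P * fract_deriv E"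
    using nz by (simp add: field_simps eval_nat_numeral)
  hence dX: "fract_deriv (P / E^2) * E^3 = p' * E - 2 * P * (D + s * d')" by (simp only: dE)
  have f: "s * inose_f = G" using nz by (simp add: inose_f_def G_def s_def)
  have "fract_deriv s = 1" by (simp add: s_def var_eq fract_deriv_to_fract)
  hence df: "inose_f + s * fract_deriv inose_f = g'"
    using arg_cong[OF f, of fract_deriv] by (simp add: fract_deriv_mult G_def g'_def fract_deriv_to_fract)
  have W: "to_fract (section_wronskian p d) = 3 * G * s * (p' * D - 2 * P * d') - 5 * G * P * D - s * g' * P * D"
    by (simp add: section_wronskian_def G_def s_def var_eq p'_def D_def P_def d'_def g'_def to_fract_numeral)
  have "nabla (P / E^2) * E^3 = 3 * G * (fract_deriv (P / E^2) * E^3) - (g' - inose_f) * P * E"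
  proof -
    obtain Q where Q: "Q = P / E^2" by blast
    have "(3 * s * inose_f * fract_deriv Q - s * fract_deriv inose_f * Q) * E^3
        = 3 * (s * inose_f) * (fract_deriv Q * E^3) - (s * fract_deriv inose_f) * (Q * E^2) * E"
      by (simp add: eval_nat_numeral algebra_simps)
    also have "\<dots> = 3 * G * (fract_deriv Q * E^3) - (g' - inose_f) * P * E"
    proof -
      have "s * fract_deriv inose_f = g' - inose_f" using df by (simp add: algebra_simps)
      thus ?thesis using X by (simp add: f Q)
    qed
    finally have "(3 * s * inose_f * fract_deriv Q - s * fract_deriv inose_f * Q) * E^3
        = 3 * G * (fract_deriv Q * E^3) - (g' - inose_f) * P * E" .
    thus ?thesis by (simp add: nabla_def s_def Q)
  qed
  also have "\<dots> = 3 * G * (p' * E - 2 * P * (D + s * d')) - (g' - inose_f) * P * E" by (simp only: dX)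
  also have "\<dots> = 3 * G * (p' * s * D - 2 * P * (D + s * d')) - (s * g' - s * inose_f) * P * D"
    by (simp add: E algebra_simps)
  also have "\<dots> = to_fract (section_wronskian p d)" unfolding W f by (simp add: algebra_simps)
  finally show ?thesis using nz unfolding E_def[symmetric] P_def[symmetric] by (simp add: field_simps)
qed

lemma nabla_pullback_coeff:
  assumes "on_curve inose_curve (Affine x y)"
  shows "nabla x = const (pullback_coeff (Affine x y)) * y" "pullback_coeff (Affine x y) \<noteq> 0" "y \<noteq> 0"
proof -
  obtain p B d where t: "section_triple p B d" "Affine x y = section_point p B d"
    using point_imp_section_triple[OF assms] .
  have d: "d \<noteq> 0" using t by (simp add: section_triple_def)
  obtain c where c: "c \<noteq> 0" "section_wronskian p d = smult c B" using section_wronskian_constant[OF t(1)] .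
  have xy: "x = to_fract p / to_fract (s_poly * d)^2" "y = to_fract B / to_fract (s_poly * d)^3"
    using t(2) by (simp_all add: section_point_def)
  show y: "y \<noteq> 0" using section_triple_degrees(5)[OF t(1)] d by (simp add: xy)
  hence 1: "nabla x = const c * y" unfolding xy nabla_section[OF d] c to_fract_smult by simp
  show "nabla x = const (pullback_coeff (Affine x y)) * y" "pullback_coeff (Affine x y) \<noteq> 0"
    using pullback_coeff_eqI[OF 1 y] 1 c by simp_all
qed

lemma pullback_coeff_eq_0_iff: "on_curve inose_curve P \<Longrightarrow> pullback_coeff P = 0 \<longleftrightarrow> P = Infinity"
  by (cases P) (use nabla_pullback_coeff(2) in auto)

lemma chord_on_curve:
  fixes x1 :: "'a :: field"
  assumes "y1^2 = x1^3 + f" "y2^2 = x2^3 + f" "l * (x2 - x1) = y2 - y1" "x1 \<noteq> x2" "x3 = l^2 - x1 - x2"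
  shows "(l * (x1 - x3) - y1)^2 = x3^3 + f"
proof -
  have "(x2 - x1) * (l * (y1 + y2)) = (x2 - x1) * (x1^2 + x1*x2 + x2^2)"
    using assms(1-3) by algebra
  hence k: "l * (y1 + y2) = x1^2 + x1*x2 + x2^2" using assms(4) by simp
  show ?thesis using assms(1,3,5) k by algebra
qed

lemma tangent_on_curve:
  fixes x1 :: "'a :: field"
  assumes "y1^2 = x1^3 + f" "l * (2 * y1) = 3 * x1^2" "x3 = l^2 - x1 - x1"
  shows "(l * (x1 - x3) - y1)^2 = x3^3 + f"
  using assms by algebra

lemma nabla_const_mult: "nabla (const w * x) = const w * nabla x"
  by (simp add: nabla_def fract_deriv_mult algebra_simps)

lemma deriv_of_coordinates:
  assumes "y^2 = x^3 + inose_f" "y \<noteq> 0" "nabla x = c * y"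
    "e = 3 * var * inose_f" "k = var * fract_deriv inose_f"
  shows "e * fract_deriv x = c * y + k * x"
    and "2 * (e * fract_deriv y) = 3 * c * x^2 + 3 * k * y"
proof -
  show 1: "e * fract_deriv x = c * y + k * x" using assms(3-5) by (simp add: nabla_def algebra_simps)
  have "2 * y * fract_deriv y = 3 * x^2 * fract_deriv x + fract_deriv inose_f"
    using arg_cong[OF assms(1), of fract_deriv] by (simp add: fract_deriv_power2 fract_deriv_power3 fract_deriv_add)
  moreover have "e * fract_deriv inose_f = 3 * k * inose_f" by (simp add: assms(4,5))
  ultimately have "y * (2 * (e * fract_deriv y)) = y * (3 * c * x^2 + 3 * k * y)"
    using 1 assms(1) by algebra
  thus "2 * (e * fract_deriv y) = 3 * c * x^2 + 3 * k * y" using assms(2) by simp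
qed

text \<open>Invariance of \<open>dx/y\<close> under the group law, in twisted form. With \<open>e d/ds\<close> and \<open>k\<close> as below, the
  coordinates satisfy \<open>e x' = c y + k x\<close> and \<open>2 e y' = 3 c x^2 + 3 k y\<close>. Substituting these into the
  derivative of \<open>x3 = l^2 - x1 - x2\<close> leaves a form linear in \<open>c1\<close>, \<open>c2\<close> and \<open>k\<close>, whose three coefficients are
  compared separately.\<close>

lemma nabla_chord:
  assumes "y1^2 = x1^3 + inose_f" "y2^2 = x2^3 + inose_f" "l * (x2 - x1) = y2 - y1" "x1 \<noteq> x2"
    "y1 \<noteq> 0" "y2 \<noteq> 0" "nabla x1 = c1 * y1" "nabla x2 = c2 * y2" "x3 = l^2 - x1 - x2"
  shows "nabla x3 = (c1 + c2) * (l * (x1 - x3) - y1)"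
proof -
  define e k where "e = 3 * var * inose_f" and "k = var * fract_deriv inose_f"
  define u1 u2 v1 v2 m where "u1 = e * fract_deriv x1" and "u2 = e * fract_deriv x2"
    and "v1 = e * fract_deriv y1" and "v2 = e * fract_deriv y2" and "m = e * fract_deriv l"
  have u: "u1 = c1 * y1 + k * x1" "u2 = c2 * y2 + k * x2"
    and v: "2 * v1 = 3 * c1 * x1^2 + 3 * k * y1" "2 * v2 = 3 * c2 * x2^2 + 3 * k * y2"
    using deriv_of_coordinates[OF assms(1,5,7) e_def k_def] deriv_of_coordinates[OF assms(2,6,8) e_def k_def]
    by (simp_all add: u1_def u2_def v1_def v2_def)
  have "fract_deriv l * (x2 - x1) + l * (fract_deriv x2 - fract_deriv x1) = fract_deriv y2 - fract_deriv y1"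
    using arg_cong[OF assms(3), of fract_deriv] by (simp add: fract_deriv_mult fract_deriv_diff)
  hence m: "m * (x2 - x1) + l * (u2 - u1) = v2 - v1"
    unfolding m_def u1_def u2_def v1_def v2_def by algebra
  have x3: "nabla x3 = 2 * l * m - u1 - u2 - k * x3"
    unfolding assms(9) nabla_def m_def u1_def u2_def
    by (simp add: fract_deriv_diff fract_deriv_add fract_deriv_mult fract_deriv_power2 e_def k_def algebra_simps)
  have "(x2 - x1) * (l * (y1 + y2)) = (x2 - x1) * (x1^2 + x1*x2 + x2^2)"
    using assms(1-3) by algebra
  hence kk: "l * (y1 + y2) = x1^2 + x1*x2 + x2^2" using assms(4) by simp
  define y3 where "y3 = l * (x1 - x3) - y1"
  have y2: "y2 = y1 + l * (x2 - x1)" using assms(3) by (simp add: algebra_simps)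
  have y3: "y3 = l * (2 * x1 + x2 - l^2) - y1" by (simp add: y3_def assms(9) algebra_simps)
  have q: "2 * l * y1 + l^2 * (x2 - x1) = x1^2 + x1*x2 + x2^2"
    using kk unfolding y2 by (simp add: algebra_simps power2_eq_square)
  have h1: "- 3 * l * x1^2 + 2 * l^2 * y1 - (x2 - x1) * y1 = (x2 - x1) * y3"
    using arg_cong[OF q, of "\<lambda>t. l * t"] unfolding y3
    by (simp add: algebra_simps power2_eq_square)
  have h2: "3 * l * x2^2 - 2 * l^2 * y2 - (x2 - x1) * y2 = (x2 - x1) * y3"
    using arg_cong[OF q, of "\<lambda>t. l * t"] unfolding y3 y2
    by (simp add: algebra_simps power2_eq_square)
  have h0: "3 * l * (y2 - y1) - 2 * l^2 * (x2 - x1) - (x2 - x1) * l^2 = 0"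
    unfolding y2 by (simp add: algebra_simps power2_eq_square)
  have "(x2 - x1) * nabla x3 = 2 * l * (m * (x2 - x1)) - (x2 - x1) * (u1 + u2 + k * x3)"
    unfolding x3 by (simp add: algebra_simps)
  also have "m * (x2 - x1) = v2 - v1 - l * (u2 - u1)" using m by (simp add: algebra_simps)
  also have "2 * l * (v2 - v1 - l * (u2 - u1)) = l * (2 * v2 - 2 * v1) - 2 * l^2 * (u2 - u1)"
    by (simp add: algebra_simps power2_eq_square)
  also have "l * (2 * v2 - 2 * v1) - 2 * l^2 * (u2 - u1) - (x2 - x1) * (u1 + u2 + k * x3)
      = c1 * (- 3 * l * x1^2 + 2 * l^2 * y1 - (x2 - x1) * y1)
      + c2 * (3 * l * x2^2 - 2 * l^2 * y2 - (x2 - x1) * y2)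
      + k * (3 * l * (y2 - y1) - 2 * l^2 * (x2 - x1) - (x2 - x1) * l^2)"
    unfolding u v assms(9) by (simp add: algebra_simps)
  also have "\<dots> = (x2 - x1) * ((c1 + c2) * y3)" unfolding h1 h2 h0 by (simp add: algebra_simps)
  finally have "(x2 - x1) * nabla x3 = (x2 - x1) * ((c1 + c2) * (l * (x1 - x3) - y1))"
    by (simp only: y3_def)
  thus ?thesis using assms(4) by simp
qed

lemma nabla_tangent:
  assumes "y1^2 = x1^3 + inose_f" "l * (2 * y1) = 3 * x1^2" "y1 \<noteq> 0" "nabla x1 = c1 * y1"
    "x3 = l^2 - x1 - x1"
  shows "nabla x3 = (c1 + c1) * (l * (x1 - x3) - y1)"
proof -
  define e k where "e = 3 * var * inose_f" and "k = var * fract_deriv inose_f"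
  define u1 v1 m where "u1 = e * fract_deriv x1" and "v1 = e * fract_deriv y1" and "m = e * fract_deriv l"
  have u: "u1 = c1 * y1 + k * x1" and v: "2 * v1 = 3 * c1 * x1^2 + 3 * k * y1"
    using deriv_of_coordinates[OF assms(1,3,4) e_def k_def] by (simp_all add: u1_def v1_def)
  have "l * (y1 + y1) = x1^2 + x1^2 + x1^2" using assms(2) by simp
  from arg_cong[OF this, of fract_deriv]
  have "fract_deriv l * (2 * y1) + l * (2 * fract_deriv y1) = 6 * x1 * fract_deriv x1"
    by (simp add: fract_deriv_mult fract_deriv_add fract_deriv_power2)
  hence m: "m * (2 * y1) + l * (2 * v1) = 6 * x1 * u1"
    unfolding m_def u1_def v1_def by algebra
  have x3: "nabla x3 = 2 * l * m - u1 - u1 - k * x3"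
    unfolding assms(5) nabla_def m_def u1_def
    by (simp add: fract_deriv_diff fract_deriv_add fract_deriv_mult fract_deriv_power2 e_def k_def algebra_simps)
  define y3 where "y3 = l * (x1 - x3) - y1"
  have y3: "y3 = l * (3 * x1 - l^2) - y1" by (simp add: y3_def assms(5) algebra_simps)
  have h1: "12 * l * x1 * y1 - 2 * l^2 * (3 * x1^2) - 4 * y1^2 = 2 * (2 * y1) * y3"
    unfolding y3 assms(2)[symmetric] by (simp add: algebra_simps power2_eq_square)
  have h0: "4 * l * (3 * x1^2) - 6 * l^2 * y1 - 4 * y1 * x1 - 2 * y1 * x3 = 0"
    unfolding assms(2)[symmetric] assms(5) by (simp add: algebra_simps power2_eq_square)
  have "(2 * y1) * nabla x3 = 2 * l * (m * (2 * y1)) - (2 * y1) * (2 * u1 + k * x3)"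
    unfolding x3 by (simp add: algebra_simps)
  also have "m * (2 * y1) = 6 * x1 * u1 - l * (2 * v1)" using m by (simp add: algebra_simps)
  also have "2 * l * (6 * x1 * u1 - l * (2 * v1)) - 2 * y1 * (2 * u1 + k * x3)
      = c1 * (12 * l * x1 * y1 - 2 * l^2 * (3 * x1^2) - 4 * y1^2)
      + k * (4 * l * (3 * x1^2) - 6 * l^2 * y1 - 4 * y1 * x1 - 2 * y1 * x3)"
    unfolding u v by (simp add: algebra_simps power2_eq_square)
  also have "\<dots> = (2 * y1) * ((c1 + c1) * y3)" unfolding h1 h0 by (simp add: algebra_simps)
  finally have "(2 * y1) * nabla x3 = (2 * y1) * ((c1 + c1) * (l * (x1 - x3) - y1))"
    by (simp only: y3_def)
  thus ?thesis using assms(3) by simp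
qed

lemma pullback_coeff_ec_add:
  assumes "on_curve inose_curve P" "on_curve inose_curve Q"
  shows "on_curve inose_curve (ec_add inose_curve P Q)"
    and "pullback_coeff (ec_add inose_curve P Q) = pullback_coeff P + pullback_coeff Q"
proof -
  have "on_curve inose_curve (ec_add inose_curve P Q) \<and> pullback_coeff (ec_add inose_curve P Q) = pullback_coeff P + pullback_coeff Q"
  proof (cases "P = Infinity \<or> Q = Infinity")
    case True
    thus ?thesis using assms by (cases P; cases Q) auto
  next
    case False
    then obtain x1 y1 x2 y2 where PQ: "P = Affine x1 y1" "Q = Affine x2 y2" by (metis point.exhaust)
    have c: "y1^2 = x1^3 + inose_f" "y2^2 = x2^3 + inose_f" using assms PQ by (simp_all add: inose_curve_iff)
    note n1 = nabla_pullback_coeff[OF assms(1)[unfolded PQ]] and n2 = nabla_pullback_coeff[OF assms(2)[unfolded PQ]]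
    show ?thesis
    proof (cases "x1 = x2")
      case x: True
      have "(y1 - y2) * (y1 + y2) = 0" using c x by algebra
      hence "y1 = y2 \<or> y1 = - y2" by (auto simp: add_eq_0_iff2)
      show ?thesis
      proof (cases "y1 = - y2")
        case True
        have "const (pullback_coeff Q) * y2 = const (- pullback_coeff P) * y2"
          using n1 n2 x True unfolding PQ const_uminus by simp
        hence "const (pullback_coeff Q) = const (- pullback_coeff P)" using n2(3) by simp
        thus ?thesis using PQ x True by simp
      next
        case False
        hence y: "y1 = y2" using \<open>y1 = y2 \<or> y1 = - y2\<close> by simp
        define l where "l = 3 * x1^2 / (2 * y1)"
        define x3 where "x3 = l^2 - x1 - x1"
        have l: "l * (2 * y1) = 3 * x1^2" using n1(3) by (simp add: l_def)
        have s: "ec_add inose_curve P Q = Affine x3 (l * (x1 - x3) - y1)"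
          using False x y by (simp add: PQ ec_third_def Let_def l_def x3_def)
        have on: "on_curve inose_curve (Affine x3 (l * (x1 - x3) - y1))"
          unfolding inose_curve_iff by (rule tangent_on_curve[OF c(1) l x3_def])
        have "nabla x3 = const (pullback_coeff P + pullback_coeff Q) * (l * (x1 - x3) - y1)"
          using nabla_tangent[OF c(1) l n1(3,1) x3_def] x y by (simp add: PQ const_add const_mult)
        thus ?thesis using pullback_coeff_eqI nabla_pullback_coeff(3)[OF on] on s by simp
      qed
    next
      case x: False
      define l where "l = (y2 - y1) / (x2 - x1)"
      define x3 where "x3 = l^2 - x1 - x2"
      have l: "l * (x2 - x1) = y2 - y1" using x by (simp add: l_def)
      have s: "ec_add inose_curve P Q = Affine x3 (l * (x1 - x3) - y1)"
        using x by (simp add: PQ ec_third_def Let_def l_def x3_def)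
      have on: "on_curve inose_curve (Affine x3 (l * (x1 - x3) - y1))"
        unfolding inose_curve_iff by (rule chord_on_curve[OF c l x x3_def])
      have "nabla x3 = const (pullback_coeff P + pullback_coeff Q) * (l * (x1 - x3) - y1)"
        using nabla_chord[OF c l x n1(3) n2(3) n1(1) n2(1) x3_def] by (simp add: PQ const_add)
      thus ?thesis using pullback_coeff_eqI nabla_pullback_coeff(3)[OF on] on s by simp
    qed
  qed
  thus "on_curve inose_curve (ec_add inose_curve P Q)"
    and "pullback_coeff (ec_add inose_curve P Q) = pullback_coeff P + pullback_coeff Q" by blast+
qed

text \<open>The action of \<open>-w\<close> by complex multiplication when \<open>w^3 = 1\<close>; in particular \<open>twist 1\<close> is negation.\<close>

definition twist :: "complex \<Rightarrow> ratfun point \<Rightarrow> ratfun point" where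
  "twist w P = (case P of Infinity \<Rightarrow> Infinity | Affine x y \<Rightarrow> Affine (const w * x) (- y))"

lemma twist_simps [simp]: "twist w Infinity = Infinity" "twist w (Affine x y) = Affine (const w * x) (- y)"
  by (simp_all add: twist_def)

lemma pullback_coeff_twist:
  assumes "w^3 = 1" "on_curve inose_curve P"
  shows "on_curve inose_curve (twist w P)" "pullback_coeff (twist w P) = - w * pullback_coeff P"
proof -
  have "const w ^ 3 = const (w^3)" by (simp add: power3_eq_cube const_mult)
  hence w3: "const w ^ 3 = 1" using assms by simp
  have "on_curve inose_curve (twist w P) \<and> pullback_coeff (twist w P) = - w * pullback_coeff P"
  proof (cases P)
    case (Affine x y)
    have "(- y)^2 = (const w * x)^3 + inose_f"
      using assms(2) w3 by (simp add: Affine inose_curve_iff power_mult_distrib)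
    moreover have "nabla (const w * x) = const (- w * pullback_coeff P) * (- y)"
      using nabla_pullback_coeff(1)[OF assms(2)[unfolded Affine]]
      by (simp add: nabla_const_mult Affine const_mult const_uminus)
    ultimately show ?thesis using pullback_coeff_eqI nabla_pullback_coeff(3)[OF assms(2)[unfolded Affine]]
      by (simp add: Affine inose_curve_iff)
  qed simp
  thus "on_curve inose_curve (twist w P)" "pullback_coeff (twist w P) = - w * pullback_coeff P" by blast+
qed

text \<open>The difference of two sections with the same coefficient has coefficient 0, so it is the origin.
  Associativity and the existence of inverses are deduced from this by comparing coefficients.\<close>

lemma pullback_coeff_inject:
  assumes "on_curve inose_curve P" "on_curve inose_curve Q" "pullback_coeff P = pullback_coeff Q"
  shows "P = Q"
proof -
  have t: "on_curve inose_curve (twist 1 Q)" "pullback_coeff (twist 1 Q) = - pullback_coeff Q"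
    using pullback_coeff_twist[of 1 Q] assms by simp_all
  have "pullback_coeff (ec_add inose_curve P (twist 1 Q)) = 0"
    using pullback_coeff_ec_add(2)[OF assms(1) t(1)] t assms by simp
  hence "ec_add inose_curve P (twist 1 Q) = Infinity"
    using pullback_coeff_eq_0_iff pullback_coeff_ec_add(1)[OF assms(1) t(1)] by blast
  thus ?thesis by (cases P; cases Q) (auto simp: ec_third_def Let_def split: if_splits)
qed

section \<open>The naive height is a quadratic form\<close>

lemma naive_height_section:
  assumes "section_triple p B d"
  shows "naive_height (section_point p B d) = degree p"
proof -
  have d: "d \<noteq> 0" "coprime p ((s_poly * d)^2)" using assms by (simp_all add: section_triple_def)
  have "degree ((s_poly * d)^2) = 2 * degree d + 2" using d by (simp add: degree_power_eq degree_mult_eq)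
  hence "degree ((s_poly * d)^2) \<le> degree p" using section_triple_degrees(1)[OF assms] by simp
  thus ?thesis using ratfun_degree_coprime[OF d(2)] d(1) by (simp add: section_point_def to_fract_power max_def)
qed

lemma point_cases:
  assumes "on_curve inose_curve P"
  obtains "P = Infinity" | p B d where "section_triple p B d" "P = section_point p B d"
proof (cases P)
  case (Affine x y)
  obtain p B d where "section_triple p B d" "Affine x y = section_point p B d"
    using point_imp_section_triple[OF assms[unfolded Affine]] .
  thus ?thesis using that(2) Affine by simp
qed (use that(1) in simp)

text \<open>Shioda's formula \<open>2 \<chi> + 2 (P.O)\<close> with \<open>\<chi> = 2\<close>: no fibre contributes a correction, since fibres of type II and \<open>II\<^sup>*\<close> have only one simple component.\<close>

lemma naive_height_ge_4: "on_curve inose_curve P \<Longrightarrow> P \<noteq> Infinity \<Longrightarrow> naive_height P \<ge> 4"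
  by (erule point_cases) (simp_all add: naive_height_section section_triple_degrees)

text \<open>No cancellation takes place in the duplication formula, because \<open>p\<close> has no root
  in common with \<open>B\<close> or \<open>s d\<close>; so the equality is exact and not merely up to a bounded error.\<close>

lemma naive_height_double:
  assumes P: "on_curve inose_curve P"
  shows "naive_height (ec_add inose_curve P P) = 4 * naive_height P"
  using P
proof (cases rule: point_cases)
  case (2 p B d)
  note t = 2(1)
  note deg = section_triple_degrees[OF t]
  have d: "d \<noteq> 0" and cop: "coprime p (s_poly * d)" and e: "B^2 = p^3 + disc_poly * s_poly^5 * d^6"
    using t by (auto simp: section_triple_def)
  define x y E f where "x = to_fract p / to_fract (s_poly * d)^2" and "y = to_fract B / to_fract (s_poly * d)^3"
    and "E = to_fract (s_poly * d)" and "f = inose_f"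
  have Pxy: "P = Affine x y" using 2 by (simp add: section_point_def x_def y_def)
  have E0: "E \<noteq> 0" using d by (simp add: E_def)
  have y0: "y \<noteq> 0" using d deg by (simp add: y_def)
  have c: "y^2 = x^3 + f" using P Pxy by (simp add: inose_curve_iff f_def)
  define x3 where "x3 = (3 * x^2 / (2 * y))^2 - x - x"
  have "naive_height (ec_add inose_curve P P) = ratfun_degree x3"
  proof -
    have "y \<noteq> - y" using y0 by (simp add: eq_neg_iff_add_eq_0 flip: mult_2)
    thus ?thesis by (simp add: Pxy ec_third_def Let_def x3_def)
  qed
  also have "x3 = (x^4 - 8 * f * x) / (4 * y^2)"
  proof -
    have "4 * y^2 * x3 = (x * (9 * x^3 - 8 * y^2))" 
      using y0 by (simp add: x3_def field_simps eval_nat_numeral)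
    also have "\<dots> = x^4 - 8 * f * x" unfolding c by (simp add: algebra_simps eval_nat_numeral)
    finally show ?thesis using y0 by (simp add: field_simps)
  qed
  also have "\<dots> = to_fract (p * (p^3 - 8 * disc_poly * s_poly^5 * d^6)) / to_fract (4 * B^2 * (s_poly * d)^2)"
  proof -
    have "f * E^6 = to_fract (disc_poly * s_poly * d^2) * E^4"
      unfolding f_def E_def by (simp only: inose_f_section[symmetric]) (simp add: eval_nat_numeral)
    also have "\<dots> = to_fract (disc_poly * s_poly^5 * d^6)"
      unfolding E_def by (simp add: to_fract_power power_mult_distrib eval_nat_numeral)
    finally have fE: "to_fract (p * (p^3 - 8 * disc_poly * s_poly^5 * d^6)) = to_fract p * (to_fract p ^ 3 - 8 * (f * E^6))"
      by (simp add: to_fract_power to_fract_numeral mult.assoc)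
    have xE: "to_fract p = x * E^2" and yE: "to_fract B = y * E^3" using E0 by (simp_all add: x_def y_def E_def)
    have "to_fract (4 * B^2 * (s_poly * d)^2) = 4 * to_fract B ^ 2 * E^2"
      by (simp add: to_fract_power to_fract_numeral E_def)
    also have "\<dots> = (4 * y^2) * E^8" unfolding yE by (simp add: power_mult_distrib eval_nat_numeral)
    finally have 1: "to_fract (4 * B^2 * (s_poly * d)^2) = (4 * y^2) * E^8" .
    have 2: "to_fract (p * (p^3 - 8 * disc_poly * s_poly^5 * d^6)) = (x^4 - 8 * f * x) * E^8"
      unfolding fE unfolding xE by (simp add: power_mult_distrib eval_nat_numeral algebra_simps)
    show ?thesis unfolding 1 2 using E0 by simp
  qed
  also have "ratfun_degree \<dots> = 4 * degree p"
  proof -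
    let ?h = "disc_poly * s_poly^5 * d^6" let ?V = "p * (p^3 - 8 * disc_poly * s_poly^5 * d^6)"
    let ?W = "4 * B^2 * (s_poly * d)^2"
    have W0: "?W \<noteq> 0" using deg d by simp
    have "coprime ?W ?V"
    proof (rule complex_poly_coprimeI)
      fix z assume z: "poly ?W z = 0"
      show "poly ?V z \<noteq> 0"
      proof (cases "poly B z = 0")
        case True
        have p: "poly p z \<noteq> 0" using section_triple_pB_no_common_root[OF t] True by blast
        have "poly (p^3 + ?h) z = 0" using True by (simp flip: e)
        hence "poly ?h z = - (poly p z ^ 3)" by (simp add: add_eq_0_iff)
        moreover have "poly ?V z = poly p z * (poly p z ^ 3 - 8 * poly ?h z)" by (simp add: mult.assoc)
        ultimately have "poly ?V z = 9 * poly p z ^ 4" by (simp only:) (simp add: eval_nat_numeral)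
        thus ?thesis using p by simp
      next
        case False
        hence "poly (s_poly * d) z = 0" using z by auto
        moreover from this have "poly p z \<noteq> 0" using cop coprime_no_common_root by blast
        ultimately show ?thesis by auto
      qed
    qed (use W0 in simp)
    hence "ratfun_degree (to_fract ?V / to_fract ?W) = max (degree ?V) (degree ?W)"
      using W0 by (intro ratfun_degree_coprime) (simp_all only: coprime_commute not_False_eq_True)
    moreover have "degree ?V = 4 * degree p"
    proof -
      have "degree (8 * disc_poly * s_poly^5 * d^6) = degree (smult 8 (disc_poly * s_poly^5 * d^6))"
        by (simp add: numeral_poly)
      also have "\<dots> = 7 + 6 * degree d" using d by (simp add: degree_mult_eq degree_power_eq)
      also have "\<dots> < degree (p^3)" using deg by (simp add: degree_power_eq)
      finally have "degree (p^3 - 8 * disc_poly * s_poly^5 * d^6) = degree (p^3)" 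
        using degree_add_eq_left[of "- (8 * disc_poly * s_poly^5 * d^6)" "p^3"] by simp
      moreover from this have "p^3 - 8 * disc_poly * s_poly^5 * d^6 \<noteq> 0" using deg by (auto simp: degree_power_eq)
      ultimately show ?thesis using deg by (simp add: degree_mult_eq degree_power_eq)
    qed
    moreover have "degree ?W \<le> 4 * degree p"
    proof -
      have "degree ?W = degree (smult 4 (B^2 * (s_poly * d)^2))" by (simp add: numeral_poly)
      also have "\<dots> = 2 * degree B + 2 * degree d + 2" using d deg by (simp add: degree_mult_eq degree_power_eq)
      finally show ?thesis using deg by simp
    qed
    ultimately show ?thesis by simp
  qed
  also have "degree p = naive_height P" using naive_height_section[OF t] 2 by simp
  finally show ?thesis .
qed simp

text \<open>If \<open>(W : U : V) = (w : u : v)\<close> and the second triple is primitive, then the first is a polynomial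
  multiple of it.\<close>

lemma dvd_of_proportional:
  fixes u v w :: "complex poly"
  assumes "v * W = V * w" "u * W = U * w" "coprime v (gcd w u)" "w \<noteq> 0"
  shows "v dvd V"
proof -
  have "w * (V * u) = (v * W) * u" unfolding assms(1) by (simp only: mult_ac)
  also have "\<dots> = v * (u * W)" by (simp only: mult_ac)
  also have "\<dots> = w * (U * v)" unfolding assms(2) by (simp only: mult_ac)
  finally have "w * (V * u) = w * (U * v)" .
  hence "V * u = U * v" using assms(4) by simp
  hence "v dvd V * u" by simp
  moreover have "v dvd V * w" unfolding assms(1)[symmetric] by simp
  ultimately have "v dvd gcd (V * w) (V * u)" by (rule gcd_greatest[rotated])
  hence "v dvd normalize (V * gcd w u)" by (simp only: gcd_mult_left)
  hence "v dvd V * gcd w u" by (simp only: dvd_normalize_iff)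
  thus ?thesis using assms(3) by (simp add: coprime_dvd_mult_left_iff)
qed

lemma chord_sum_product:
  fixes x1 :: "'a :: field"
  assumes "y1^2 = x1^3 + f" "y2^2 = x2^3 + f" "x1 \<noteq> x2"
    "x3 = ((y2 - y1) / (x2 - x1))^2 - x1 - x2" "x4 = ((- y2 - y1) / (x2 - x1))^2 - x1 - x2"
  shows "(x3 + x4) * (x1 - x2)^2 = 2 * (x1 * x2 * (x1 + x2) + 2 * f)"
    and "x3 * x4 * (x1 - x2)^2 = x1^2 * x2^2 - 4 * f * (x1 + x2)"
proof -
  define w where "w = (x1 - x2)^2"
  have w: "w \<noteq> 0" using assms(3) by (simp add: w_def)
  have x3: "x3 * w = (y2 - y1)^2 - (x1 + x2) * w" and x4: "x4 * w = (y2 + y1)^2 - (x1 + x2) * w"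
  proof -
    have "(a / (x2 - x1))^2 * w = a^2" for a
    proof -
      have "w = (x2 - x1)^2" by (simp add: w_def power2_commute)
      thus ?thesis using assms(3) by (simp add: power_divide)
    qed
    hence a: "((y2 - y1) / (x2 - x1))^2 * w = (y2 - y1)^2" "((- y2 - y1) / (x2 - x1))^2 * w = (- y2 - y1)^2" by blast+
    have "(- y2 - y1)^2 = (y2 + y1)^2" by (simp add: power2_eq_square algebra_simps)
    thus "x3 * w = (y2 - y1)^2 - (x1 + x2) * w" "x4 * w = (y2 + y1)^2 - (x1 + x2) * w"
      unfolding assms(4,5) using a by (simp_all add: left_diff_distrib distrib_right diff_diff_eq)
  qed
  have "(x3 + x4) * w = 2 * (y1^2 + y2^2) - 2 * (x1 + x2) * w"
    using x3 x4 by algebra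
  also have "\<dots> = 2 * (x1 * x2 * (x1 + x2) + 2 * f)"
    unfolding assms(1,2) w_def by (simp add: algebra_simps eval_nat_numeral)
  finally show "(x3 + x4) * (x1 - x2)^2 = 2 * (x1 * x2 * (x1 + x2) + 2 * f)" by (simp only: w_def)
  have "w * (x3 * x4 * w) = (x3 * w) * (x4 * w)" by (simp add: algebra_simps)
  also have "\<dots> = ((y2 - y1)^2 - (x1 + x2) * w) * ((y2 + y1)^2 - (x1 + x2) * w)" by (simp only: x3 x4)
  also have "\<dots> = (y2^2 - y1^2)^2 - 2 * (x1 + x2) * w * (y1^2 + y2^2) + (x1 + x2)^2 * w^2"
    by (simp add: algebra_simps eval_nat_numeral)
  also have "\<dots> = w * (x1^2 * x2^2 - 4 * f * (x1 + x2))"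
    unfolding assms(1,2) w_def by (simp add: algebra_simps eval_nat_numeral)
  finally show "x3 * x4 * (x1 - x2)^2 = x1^2 * x2^2 - 4 * f * (x1 + x2)" using w by (simp add: w_def)
qed

text \<open>The sum and the product of \<open>x3\<close> and \<open>x4\<close> are \<open>U/W\<close> and \<open>V/W\<close> for polynomials with
  \<open>deg V \<le> 2 deg p1 + 2 deg p2\<close>. On the other hand they are \<open>u/w\<close> and \<open>v/w\<close> with \<open>v = p3 p4\<close>, and the triple
  \<open>(w, u, v)\<close> is primitive as the product of the primitive linear forms with coefficients \<open>((s d3)^2, p3)\<close> and \<open>((s d4)^2, p4)\<close>, by
  Gauss's lemma. Hence \<open>p3 p4\<close> divides \<open>V\<close>.\<close>

lemma naive_height_chord_le:
  assumes P: "on_curve inose_curve (Affine x1 y1)" and Q: "on_curve inose_curve (Affine x2 y2)"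
    and R: "on_curve inose_curve (Affine x3 y3)" and S: "on_curve inose_curve (Affine x4 y4)"
    and ne: "x1 \<noteq> x2"
    and sum: "(x3 + x4) * (x1 - x2)^2 = 2 * (x1 * x2 * (x1 + x2) + 2 * inose_f)"
    and prod: "x3 * x4 * (x1 - x2)^2 = x1^2 * x2^2 - 4 * inose_f * (x1 + x2)"
  shows "naive_height (Affine x3 y3) + naive_height (Affine x4 y4)
    \<le> 2 * naive_height (Affine x1 y1) + 2 * naive_height (Affine x2 y2)"
proof -
  obtain p1 B1 d1 where t1: "section_triple p1 B1 d1" "Affine x1 y1 = section_point p1 B1 d1" using point_imp_section_triple[OF P] .
  obtain p2 B2 d2 where t2: "section_triple p2 B2 d2" "Affine x2 y2 = section_point p2 B2 d2" using point_imp_section_triple[OF Q] .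
  obtain p3 B3 d3 where t3: "section_triple p3 B3 d3" "Affine x3 y3 = section_point p3 B3 d3" using point_imp_section_triple[OF R] .
  obtain p4 B4 d4 where t4: "section_triple p4 B4 d4" "Affine x4 y4 = section_point p4 B4 d4" using point_imp_section_triple[OF S] .
  note g1 = section_triple_degrees[OF t1(1)] and g2 = section_triple_degrees[OF t2(1)]
    and g3 = section_triple_degrees[OF t3(1)] and g4 = section_triple_degrees[OF t4(1)]
  have dn: "d1 \<noteq> 0" "d2 \<noteq> 0" "d3 \<noteq> 0" "d4 \<noteq> 0" using t1 t2 t3 t4 by (auto simp: section_triple_def)
  define e1 e2 e3 e4 where "e1 = s_poly * d1" and "e2 = s_poly * d2" and "e3 = s_poly * d3" and "e4 = s_poly * d4"
  define E1 E2 E3 E4 where "E1 = to_fract e1" and "E2 = to_fract e2" and "E3 = to_fract e3" and "E4 = to_fract e4"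
  have E: "E1 \<noteq> 0" "E2 \<noteq> 0" "E3 \<noteq> 0" "E4 \<noteq> 0"
    using dn by (simp_all add: E1_def E2_def E3_def E4_def e1_def e2_def e3_def e4_def)
  have x: "to_fract p1 = x1 * E1^2" "to_fract p2 = x2 * E2^2" "to_fract p3 = x3 * E3^2" "to_fract p4 = x4 * E4^2"
    using t1(2) t2(2) t3(2) t4(2) E
    by (simp_all add: section_point_def E1_def E2_def E3_def E4_def e1_def e2_def e3_def e4_def)
  define k where "k = disc_poly * s_poly * d1^2"
  have k: "to_fract k = inose_f * E1^2" unfolding k_def E1_def e1_def by (rule inose_f_section[symmetric])
  define r W U V where "r = p1 * e2^2 + p2 * e1^2" and "W = (p1 * e2^2 - p2 * e1^2)^2"
    and "U = 2 * (p1 * p2 * (p1 * e2^2 + p2 * e1^2) + 2 * k * e1^2 * e2^4)"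
    and "V = p1^2 * p2^2 - 4 * k * e2^2 * (p1 * e2^2 + p2 * e1^2)"
  have tr: "to_fract (p1 * e2^2 + p2 * e1^2) = (x1 + x2) * (E1^2 * E2^2)"
    by (simp add: x to_fract_power E1_def[symmetric] E2_def[symmetric] algebra_simps)
  have tW: "to_fract W = (x1 - x2)^2 * (E1^4 * E2^4)"
    unfolding W_def by (simp add: x to_fract_power to_fract_numeral E1_def[symmetric] E2_def[symmetric] algebra_simps eval_nat_numeral)
  have "to_fract U = 2 * (to_fract p1 * to_fract p2 * to_fract (p1 * e2^2 + p2 * e1^2) + 2 * to_fract k * E1^2 * E2^4)"
    unfolding U_def by (simp add: to_fract_power to_fract_numeral E1_def E2_def)
  also have "\<dots> = (2 * (x1 * x2 * (x1 + x2) + 2 * inose_f)) * (E1^4 * E2^4)"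
    unfolding tr k x by (simp add: algebra_simps eval_nat_numeral)
  finally have tU: "to_fract U = (2 * (x1 * x2 * (x1 + x2) + 2 * inose_f)) * (E1^4 * E2^4)" .
  have "to_fract V = to_fract p1^2 * to_fract p2^2 - 4 * to_fract k * E2^2 * to_fract (p1 * e2^2 + p2 * e1^2)"
    unfolding V_def by (simp add: to_fract_power to_fract_numeral E1_def E2_def)
  also have "\<dots> = (x1^2 * x2^2 - 4 * inose_f * (x1 + x2)) * (E1^4 * E2^4)"
    unfolding tr k x by (simp add: algebra_simps eval_nat_numeral)
  finally have tV: "to_fract V = (x1^2 * x2^2 - 4 * inose_f * (x1 + x2)) * (E1^4 * E2^4)" .
  have tw: "to_fract (e3^2 * e4^2) = E3^2 * E4^2" by (simp add: to_fract_power E3_def E4_def)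
  have tv: "to_fract (p3 * p4) = (x3 * x4) * (E3^2 * E4^2)" by (simp add: x)
  have tu: "to_fract (p3 * e4^2 + p4 * e3^2) = (x3 + x4) * (E3^2 * E4^2)"
    by (simp add: x to_fract_power E3_def[symmetric] E4_def[symmetric] algebra_simps)
  have "to_fract ((p3 * p4) * W) = to_fract (V * (e3^2 * e4^2))"
    unfolding to_fract_mult[of _ W] to_fract_mult[of V] tv tW tV tw prod[symmetric] by (simp only: mult_ac)
  hence vW: "(p3 * p4) * W = V * (e3^2 * e4^2)" by (simp only: to_fract_eq_iff)
  have "to_fract ((p3 * e4^2 + p4 * e3^2) * W) = to_fract (U * (e3^2 * e4^2))"
    unfolding to_fract_mult[of _ W] to_fract_mult[of U] tu tW tU tw sum[symmetric] by (simp only: mult_ac)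
  hence uW: "(p3 * e4^2 + p4 * e3^2) * W = U * (e3^2 * e4^2)" by (simp only: to_fract_eq_iff)
  have "to_fract W \<noteq> 0" unfolding tW using ne E by simp
  hence W0: "W \<noteq> 0" by auto
  have w0: "e3^2 * e4^2 \<noteq> 0" using dn by (simp add: e3_def e4_def)
  have c3: "coprime p3 e3" and c4: "coprime p4 e4" using t3 t4 by (simp_all add: section_triple_def e3_def e4_def)
  \<comment> \<open>Primitivity: at a root of \<open>p3\<close>, say, \<open>s d3\<close> does not vanish; so if \<open>s d4\<close> vanishes there, the middle form is \<open>p4 (s d3)^2 \<noteq> 0\<close>.\<close>
  have "coprime (p3 * p4) (gcd (e3^2 * e4^2) (p3 * e4^2 + p4 * e3^2))"
  proof (rule complex_poly_coprimeI)
    fix z assume z: "poly (p3 * p4) z = 0"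
    show "poly (gcd (e3^2 * e4^2) (p3 * e4^2 + p4 * e3^2)) z \<noteq> 0"
    proof
      assume g: "poly (gcd (e3^2 * e4^2) (p3 * e4^2 + p4 * e3^2)) z = 0"
      have "poly (e3^2 * e4^2) z = 0" "poly (p3 * e4^2 + p4 * e3^2) z = 0"
        using g by (meson gcd_dvd1 gcd_dvd2 dvd_trans poly_eq_0_iff_dvd)+
      hence "poly e3 z = 0 \<or> poly e4 z = 0" "poly p3 z * poly e4 z ^ 2 + poly p4 z * poly e3 z ^ 2 = 0" by auto
      moreover have "\<not> (poly p3 z = 0 \<and> poly e3 z = 0)" "\<not> (poly p4 z = 0 \<and> poly e4 z = 0)"
        using coprime_no_common_root c3 c4 by blast+
      ultimately show False using z by auto
    qed
  qed (use g3 g4 in simp)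
  hence dvd: "p3 * p4 dvd V" by (rule dvd_of_proportional[OF vW uW _ w0])
  have "V \<noteq> 0" using vW W0 g3 g4 by auto
  hence "degree (p3 * p4) \<le> degree V" using dvd dvd_imp_degree_le by blast
  also have "degree V \<le> 2 * degree p1 + 2 * degree p2"
  proof -
    have de: "degree e1 = degree d1 + 1" "degree e2 = degree d2 + 1" using dn by (simp_all add: e1_def e2_def degree_mult_eq)
    have a: "degree (p1^2 * p2^2) = 2 * degree p1 + 2 * degree p2"
      using g1 g2 by (simp add: degree_mult_eq degree_power_eq)
    have e0: "e1 \<noteq> 0" "e2 \<noteq> 0" using dn by (simp_all add: e1_def e2_def)
    have k': "degree k = 3 + 2 * degree d1" using dn by (simp add: k_def degree_mult_eq degree_power_eq)
    have "degree (4 * k * e2^2) = degree (smult 4 (k * e2^2))" by (simp add: numeral_poly)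
    also have "\<dots> = 3 + 2 * degree d1 + 2 * (degree d2 + 1)"
      using dn e0 k' by (simp add: degree_mult_eq degree_power_eq de k_def)
    finally have b: "degree (4 * k * e2^2) = 3 + 2 * degree d1 + 2 * (degree d2 + 1)" .
    have "degree (p1 * e2^2) \<le> degree p1 + degree p2" "degree (p2 * e1^2) \<le> degree p1 + degree p2"
      using g1 g2 e0 by (simp_all add: degree_mult_eq degree_power_eq de)
    hence c: "degree (p1 * e2^2 + p2 * e1^2) \<le> degree p1 + degree p2" by (rule degree_add_le)
    have "degree (4 * k * e2^2 * (p1 * e2^2 + p2 * e1^2)) \<le> degree (4 * k * e2^2) + degree (p1 * e2^2 + p2 * e1^2)"
      by (rule degree_mult_le)
    also have "\<dots> \<le> 2 * degree p1 + 2 * degree p2" unfolding b using c g1(1) g2(1) by simp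
    finally show ?thesis unfolding V_def using a by (intro degree_diff_le) simp_all
  qed
  finally have "degree p3 + degree p4 \<le> 2 * degree p1 + 2 * degree p2" using g3 g4 by (simp add: degree_mult_eq)
  thus ?thesis using naive_height_section t1 t2 t3 t4 by metis
qed

lemma naive_height_twist1: "naive_height (twist 1 P) = naive_height P" by (cases P) simp_all

lemma parallelogram_le:
  assumes P: "on_curve inose_curve P" and Q: "on_curve inose_curve Q"
  shows "naive_height (ec_add inose_curve P Q) + naive_height (ec_add inose_curve P (twist 1 Q))
    \<le> 2 * naive_height P + 2 * naive_height Q"
proof (cases "P = Infinity \<or> Q = Infinity")
  case True
  thus ?thesis by (cases P; cases Q) (auto simp: naive_height_twist1)
next
  case False
  then obtain x1 y1 x2 y2 where PQ: "P = Affine x1 y1" "Q = Affine x2 y2" by (metis point.exhaust)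
  have c: "y1^2 = x1^3 + inose_f" "y2^2 = x2^3 + inose_f" using P Q PQ by (simp_all add: inose_curve_iff)
  have Q': "on_curve inose_curve (twist 1 Q)" using pullback_coeff_twist(1)[OF _ Q] by simp
  show ?thesis
  proof (cases "x1 = x2")
    case x: True
    have "(y1 - y2) * (y1 + y2) = 0" using c x by algebra
    hence "y1 = y2 \<or> y1 = - y2" by (auto simp: add_eq_0_iff2)
    thus ?thesis
    proof
      assume "y1 = y2"
      thus ?thesis using naive_height_double[OF P] x PQ by simp
    next
      assume "y1 = - y2"
      thus ?thesis using naive_height_double[OF P] x PQ by simp
    qed
  next
    case False
    define x3 x4 where "x3 = ((y2 - y1) / (x2 - x1))^2 - x1 - x2" and "x4 = ((- y2 - y1) / (x2 - x1))^2 - x1 - x2"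
    obtain y3 where R: "ec_add inose_curve P Q = Affine x3 y3" using False by (simp add: PQ ec_third_def Let_def x3_def)
    obtain y4 where S: "ec_add inose_curve P (twist 1 Q) = Affine x4 y4" using False by (simp add: PQ ec_third_def Let_def x4_def)
    show ?thesis unfolding R S unfolding PQ
      by (rule naive_height_chord_le[OF P[unfolded PQ] Q[unfolded PQ]
          pullback_coeff_ec_add(1)[OF P Q, unfolded R] pullback_coeff_ec_add(1)[OF P Q', unfolded S] False
          chord_sum_product[OF c False x3_def x4_def]])
  qed
qed

lemma naive_height_twist:
  assumes "w^3 = 1" "on_curve inose_curve P"
  shows "naive_height (twist w P) = naive_height P"
  using assms(2)
proof (cases rule: point_cases)
  case (2 p B d)
  have w: "w \<noteq> 0" using assms(1) by auto
  have "coprime (smult w p) (s_poly * d)"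
  proof (rule complex_poly_coprimeI)
    fix z assume "poly (smult w p) z = 0"
    hence "poly p z = 0" using w by simp
    moreover have "coprime p (s_poly * d)" using 2(1) unfolding section_triple_def by blast
    ultimately show "poly (s_poly * d) z \<noteq> 0" by (rule coprime_no_common_root[rotated])
  qed (use section_triple_degrees(4)[OF 2(1)] w in simp)
  hence "section_triple (smult w p) (- B) d" using 2(1) assms(1)
    by (simp add: section_triple_def power3_eq_cube mult.assoc)
  moreover have "twist w P = section_point (smult w p) (- B) d"
    unfolding 2(2) by (simp add: section_point_def const_def flip: to_fract_mult)
  ultimately show ?thesis using naive_height_section 2 w by simp
qed simp

text \<open>One inequality suffices: applied to \<open>P + Q\<close> and \<open>P - Q\<close>, whose sum and difference are \<open>2 P\<close> and \<open>2 Q\<close>,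
  it gives the opposite one, as doubling multiplies the height by 4.\<close>

lemma parallelogram:
  assumes P: "on_curve inose_curve P" and Q: "on_curve inose_curve Q"
  shows "naive_height (ec_add inose_curve P Q) + naive_height (ec_add inose_curve P (twist 1 Q))
    = 2 * naive_height P + 2 * naive_height Q"
proof -
  let ?R = "ec_add inose_curve P Q" and ?S = "ec_add inose_curve P (twist 1 Q)"
  have Q': "on_curve inose_curve (twist 1 Q)" "pullback_coeff (twist 1 Q) = - pullback_coeff Q" using pullback_coeff_twist[OF _ Q, of 1] by simp_all
  have R: "on_curve inose_curve ?R" "pullback_coeff ?R = pullback_coeff P + pullback_coeff Q" using pullback_coeff_ec_add[OF P Q] .
  have S: "on_curve inose_curve ?S" "pullback_coeff ?S = pullback_coeff P - pullback_coeff Q" using pullback_coeff_ec_add[OF P Q'(1)] Q' by simp_all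
  have S': "on_curve inose_curve (twist 1 ?S)" "pullback_coeff (twist 1 ?S) = - pullback_coeff ?S" using pullback_coeff_twist[OF _ S(1), of 1] by simp_all
  have "ec_add inose_curve ?R ?S = ec_add inose_curve P P"
    by (rule pullback_coeff_inject) (use pullback_coeff_ec_add[OF R(1) S(1)] pullback_coeff_ec_add[OF P P] R S in simp_all)
  moreover have "ec_add inose_curve ?R (twist 1 ?S) = ec_add inose_curve Q Q"
    by (rule pullback_coeff_inject) (use pullback_coeff_ec_add[OF R(1) S'(1)] pullback_coeff_ec_add[OF Q Q] R S S' in simp_all)
  ultimately have "4 * naive_height P + 4 * naive_height Q \<le> 2 * naive_height ?R + 2 * naive_height ?S"
    using parallelogram_le[OF R(1) S(1)] naive_height_double[OF P] naive_height_double[OF Q] by simp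
  thus ?thesis using parallelogram_le[OF P Q] by simp
qed

lemma second_difference_zero:
  fixes h :: "int \<Rightarrow> int"
  assumes "\<And>a. h (a + 1) + h (a - 1) = 2 * h a" "h 0 = 0" "h 1 = 0"
  shows "h a = 0"
proof -
  have "h a = 0 \<and> h (a + 1) = 0"
  proof (induction a rule: int_induct[of _ 0])
    case base thus ?case using assms by simp
  next
    case (step1 i) thus ?case using assms(1)[of "i + 1"] by simp
  next
    case (step2 i) thus ?case using assms(1)[of i] by simp
  qed
  thus ?thesis ..
qed

text \<open>The difference of both sides satisfies the parallelogram law and vanishes at the four corners of the
  unit square; the law with \<open>(1, 0)\<close> and \<open>(0, 1)\<close> then makes it an affine function of each variable.\<close>

lemma parallelogram_imp_quadratic:
  fixes q :: "int \<Rightarrow> int \<Rightarrow> int"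
  assumes "\<And>a b a' b'. q (a + a') (b + b') + q (a - a') (b - b') = 2 * q a b + 2 * q a' b'"
  shows "q a b = a^2 * q 1 0 + a * b * (q 1 1 - q 1 0 - q 0 1) + b^2 * q 0 1"
proof -
  define e where "e a b = q a b - (a^2 * q 1 0 + a * b * (q 1 1 - q 1 0 - q 0 1) + b^2 * q 0 1)" for a b
  have par: "e (a + a') (b + b') + e (a - a') (b - b') = 2 * e a b + 2 * e a' b'" for a b a' b'
    using assms[of a a' b b'] unfolding e_def by (simp add: algebra_simps power2_eq_square)
  have "q 0 0 = 0" using assms[of 0 0 0 0] by simp
  hence i: "e 0 0 = 0" "e 1 0 = 0" "e 0 1 = 0" "e 1 1 = 0" by (simp_all add: e_def)
  have v: "e 0 b = 0" "e 1 b = 0" for b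
    by (rule second_difference_zero; use par[of _ 0 _ 1] i in simp)+
  have "e a b = 0"
    by (rule second_difference_zero[of "\<lambda>a. e a b"]; use par[of _ 1 b 0] i v in simp)
  thus ?thesis by (simp add: e_def)
qed

lemma canonical_height_eq:
  assumes "on_curve inose_curve P"
  shows "canonical_height inose_curve P = real (naive_height P) / 2"
proof -
  let ?f = "\<lambda>R. ec_add inose_curve R R"
  have "on_curve inose_curve ((?f ^^ n) P) \<and> naive_height ((?f ^^ n) P) = 4 ^ n * naive_height P" for n
    by (induction n) (use assms pullback_coeff_ec_add(1) naive_height_double in auto)
  thus ?thesis by (simp add: canonical_height_def)
qed

section \<open>Pullback coefficients are bounded away from zero\<close>

text \<open>The two zeros of \<open>f\<close>.\<close>

definition root_lo :: real where "root_lo = 253 - 80 * sqrt 10"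

definition root_hi :: real where "root_hi = 253 + 80 * sqrt 10"

lemma root_lo_hi: "0 < root_lo" "root_lo + 2 < root_hi" "root_lo + root_hi = 506" "root_lo * root_hi = 9"
proof -
  have "sqrt 10 < 253 / 80" by (rule real_less_lsqrt) (simp_all add: power2_eq_square)
  thus "0 < root_lo" by (simp add: root_lo_def)
  have "1 \<le> sqrt 10" by simp
  thus "root_lo + 2 < root_hi" unfolding root_lo_def root_hi_def by linarith
  show "root_lo + root_hi = 506" by (simp add: root_lo_def root_hi_def)
  have "sqrt 10 * sqrt 10 = 10" by simp
  thus "root_lo * root_hi = 9" unfolding root_lo_def root_hi_def by (simp add: algebra_simps)
qed

definition disc_real :: "real \<Rightarrow> real" where "disc_real x = 27 * (x - root_lo) * (root_hi - x)"

lemma poly_disc_real: "poly disc_poly (of_real x) = of_real (disc_real x)"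
proof -
  have "disc_real x = 27 * ((root_lo + root_hi) * x - root_lo * root_hi - x * x)" by (simp add: disc_real_def algebra_simps)
  hence r: "disc_real x = 27 * (506 * x - 9 - x * x)" by (simp only: root_lo_hi)
  show ?thesis unfolding r by (simp add: disc_poly_def algebra_simps)
qed

text \<open>The coordinate \<open>w\<close> of the cover \<open>w^6 = f\<close>, chosen nonnegative between the two zeros.\<close>

definition f_root6 :: "real \<Rightarrow> real" where "f_root6 x = root 6 (disc_real x / x)"

lemma disc_real_pos: "root_lo < x \<Longrightarrow> x < root_hi \<Longrightarrow> disc_real x > 0" by (simp add: disc_real_def)

lemma f_root6_pos: "root_lo < x \<Longrightarrow> x < root_hi \<Longrightarrow> f_root6 x > 0"
  using root_lo_hi(1) disc_real_pos[of x] by (simp add: f_root6_def)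

lemma f_root6_pow6:
  assumes "root_lo \<le> x" "x \<le> root_hi"
  shows "f_root6 x ^ 6 = disc_real x / x"
proof -
  have "disc_real x / x \<ge> 0" using assms root_lo_hi(1) by (simp add: disc_real_def)
  thus ?thesis by (simp add: f_root6_def)
qed

lemma f_root6_ends [simp]: "f_root6 root_lo = 0" "f_root6 root_hi = 0" by (simp_all add: f_root6_def disc_real_def)

lemma disc_real_deriv: "(disc_real has_real_derivative Re (poly (pderiv disc_poly) (of_real x))) (at x)"
proof -
  have "disc_real = (\<lambda>x. 27 * ((root_lo + root_hi) * x - root_lo * root_hi - x * x))" by (auto simp: disc_real_def algebra_simps)
  hence r: "disc_real = (\<lambda>x. 27 * (506 * x - 9 - x * x))" by (simp add: root_lo_hi)
  show ?thesis unfolding r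
    by (auto intro!: derivative_eq_intros simp: disc_poly_def pderiv_pCons)
qed

lemma pderiv_disc_real: "poly (pderiv disc_poly) (of_real x) = of_real (Re (poly (pderiv disc_poly) (of_real x)))"
  by (simp add: disc_poly_def pderiv_pCons)

lemma f_root6_deriv:
  assumes "root_lo < x" "x < root_hi"
  obtains D where "(f_root6 has_real_derivative D) (at x)"
    "6 * f_root6 x ^ 5 * D * x^2 = Re (poly (pderiv disc_poly) (of_real x)) * x - disc_real x"
proof -
  let ?g = "Re (poly (pderiv disc_poly) (of_real x))"
  have x: "x > 0" using assms root_lo_hi(1) by simp
  have pos: "disc_real x / x > 0" using disc_real_pos[OF assms] x by simp
  have 1: "((\<lambda>x. disc_real x / x) has_real_derivative (?g * x - disc_real x * 1) / (x * x)) (at x)"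
    by (rule DERIV_divide[OF disc_real_deriv DERIV_ident]) (use x in simp)
  have "(f_root6 has_real_derivative inverse (real 6 * root 6 (disc_real x / x) ^ (6 - Suc 0)) * ((?g * x - disc_real x * 1) / (x * x))) (at x)"
    unfolding f_root6_def[abs_def] by (rule DERIV_chain2[OF DERIV_real_root 1]) (use pos in simp_all)
  moreover have "6 * f_root6 x ^ 5 * (inverse (real 6 * root 6 (disc_real x / x) ^ (6 - Suc 0)) * ((?g * x - disc_real x * 1) / (x * x))) * x^2 = ?g * x - disc_real x"
    using x f_root6_pos[OF assms] by (simp add: f_root6_def[symmetric] power2_eq_square)
  ultimately show ?thesis using that by blast
qed

text \<open>The numerator of the equation for the derivative of \<open>X/Y = N/B\<close>, where \<open>N = p s d\<close>.\<close>

lemma period_identity: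
  assumes "section_triple p B d" "section_wronskian p d = smult c B"
  shows "6 * disc_poly * (pderiv (p * s_poly * d) * B - (p * s_poly * d) * pderiv B)
      + (s_poly * pderiv disc_poly - disc_poly) * p * d * B
    = smult (- c) (B^2 - 3 * disc_poly * s_poly^5 * d^6)"
proof -
  let ?g = disc_poly and ?s = s_poly and ?h = "disc_poly * s_poly^5 * d^6" and ?N = "p * s_poly * d"
  have e: "B^2 = p^3 + ?h" using assms by (simp add: section_triple_def)
  have B0: "B \<noteq> 0" using section_triple_degrees(5)[OF assms(1)] .
  have "pderiv (B^2) = pderiv (p^3 + ?h)" using e by simp
  hence e': "2 * B * pderiv B = 3 * p^2 * pderiv p + pderiv ?g * ?s^5 * d^6
      + 5 * ?g * ?s^4 * d^6 + 6 * ?g * ?s^5 * d^5 * pderiv d"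
    by (simp add: pderiv_mult pderiv_add pderiv_power algebra_simps numeral_poly)
  have N': "pderiv ?N = pderiv p * ?s * d + p * d + p * ?s * pderiv d"
    by (simp add: pderiv_mult algebra_simps)
  have "B * (6 * ?g * (pderiv ?N * B - ?N * pderiv B) + (?s * pderiv ?g - ?g) * p * d * B)
      = 6 * ?g * pderiv ?N * B^2 - 3 * ?g * ?N * (2 * B * pderiv B) + (?s * pderiv ?g - ?g) * p * d * B^2"
    by (simp add: algebra_simps power2_eq_square)
  also have "\<dots> = - section_wronskian p d * (p^3 + ?h - 3 * ?h)"
    unfolding e e' N' section_wronskian_def by (simp add: algebra_simps eval_nat_numeral)
  also have "\<dots> = B * smult (- c) (B^2 - 3 * ?h)" unfolding assms(2) e by simp
  finally have "6 * ?g * (pderiv ?N * B - ?N * pderiv B) + (?s * pderiv ?g - ?g) * p * d * B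
      = smult (- c) (B^2 - 3 * ?h)" using B0 mult_left_cancel by blast
  thus ?thesis by (simp only: mult.assoc)
qed

text \<open>On \<open>y^2 = x^3 + 1\<close> put \<open>t = x/y\<close> and \<open>v = 1/y\<close>. If \<open>dx/y = c d\<tau>\<close> along a path, then
  \<open>dt/d\<tau> = -(c/2) (1 - 3 v^2)\<close>; here \<open>d\<tau> = ds/(3 s w^5)\<close>, \<open>t = w X/Y\<close> and \<open>v = w^3/Y\<close>.\<close>

lemma section_uniformizer_deriv:
  assumes t: "section_triple p B d" "section_wronskian p d = smult c B" and x: "root_lo < x" "x < root_hi"
    and B: "poly B (of_real x) \<noteq> 0"
  shows "((\<lambda>x. of_real (f_root6 x) * (poly (p * s_poly * d) (of_real x) / poly B (of_real x))) has_vector_derivative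
    of_real (1 / (6 * x * f_root6 x ^ 5)) * (- c * (1 - 3 * (of_real (f_root6 x)^3 * (of_real x * poly d (of_real x))^3 / poly B (of_real x))^2))) (at x)"
    (is "(?t has_vector_derivative ?R) _")
proof -
  let ?N = "p * s_poly * d"
  let ?z = "complex_of_real x"
  define N N' b b' G G' f P D where "N = poly ?N ?z" and "N' = poly (pderiv ?N) ?z" and "b = poly B ?z"
    and "b' = poly (pderiv B) ?z" and "G = poly disc_poly ?z" and "G' = poly (pderiv disc_poly) ?z" and "f = complex_of_real (f_root6 x)"
    and "P = poly p ?z" and "D = poly d ?z"
  obtain E where E: "(f_root6 has_real_derivative E) (at x)"
    "6 * f_root6 x ^ 5 * E * x^2 = Re (poly (pderiv disc_poly) (of_real x)) * x - disc_real x"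
    using f_root6_deriv[OF x] .
  have "complex_of_real (6 * f_root6 x ^ 5 * E * x^2) = of_real (Re (poly (pderiv disc_poly) (of_real x)) * x - disc_real x)"
    using E(2) by simp
  hence fE: "6 * f ^ 5 * of_real E * ?z^2 = G' * ?z - G"
    unfolding G_def G'_def f_def poly_disc_real pderiv_disc_real[symmetric] of_real_mult of_real_diff of_real_power by simp
  have z0: "?z \<noteq> 0" and f0: "f \<noteq> 0" using x root_lo_hi(1) f_root6_pos[OF x] by (simp_all add: f_def)
  have "complex_of_real (f_root6 x ^ 6) = of_real (disc_real x / x)" using f_root6_pow6[of x] x by simp
  hence f6: "f ^ 6 * ?z = G" using z0 by (simp add: f_def G_def poly_disc_real)
  have NP: "N = P * ?z * D" by (simp add: N_def P_def D_def)
  have "((\<lambda>z. poly ?N z / poly B z) has_field_derivative (N' * b - N * b') / (b * b)) (at ?z)"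
    unfolding N'_def N_def b_def b'_def by (rule DERIV_divide[OF poly_DERIV poly_DERIV B])
  hence 1: "((\<lambda>x. poly ?N (of_real x) / poly B (of_real x)) has_vector_derivative (N' * b - N * b') / (b * b)) (at x)"
    by (rule has_vector_derivative_real_field)
  have der: "(?t has_vector_derivative of_real (f_root6 x) * ((N' * b - N * b') / (b * b)) + of_real E * (N / b)) (at x)"
    unfolding N_def b_def by (rule has_vector_derivative_mult[OF has_vector_derivative_of_real[OF E(1)] 1[unfolded N_def b_def]])
  have id: "6 * G * (N' * b - N * b') + (?z * G' - G) * P * D * b = - c * (b^2 - 3 * G * ?z^5 * D^6)"
    using arg_cong[OF period_identity[OF t], of "\<lambda>q. poly q ?z"]
    by (simp add: G_def G'_def N_def N'_def b_def b'_def P_def D_def)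
  have b0: "b \<noteq> 0" using B by (simp add: b_def)
  define v where "v = f^3 * (?z * D)^3 / b"
  have vb: "v * b = f^3 * (?z * D)^3" using b0 by (simp add: v_def)
  have vb2: "v^2 * b^2 = G * ?z^5 * D^6"
  proof -
    have "v^2 * b^2 = (v * b)^2" by (simp add: power_mult_distrib)
    also have "\<dots> = (f ^ 6 * ?z) * ?z^5 * D^6" unfolding vb by (simp add: power_mult_distrib eval_nat_numeral)
    finally show ?thesis by (simp only: f6)
  qed
  have "(f * ((N' * b - N * b') / (b * b)) + of_real E * (N / b)) * (6 * ?z * f^5 * b^2)
      = 6 * (f^6 * ?z) * (N' * b - N * b') + (6 * f^5 * of_real E * ?z^2) * P * D * b"
    using b0 by (simp add: NP field_simps eval_nat_numeral)
  also have "\<dots> = - c * (b^2 - 3 * G * ?z^5 * D^6)"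
    unfolding f6 fE using id by (simp add: algebra_simps)
  also have "\<dots> = - c * (b^2 - 3 * (v^2 * b^2))" unfolding vb2 by (simp only: mult.assoc)
  also have "\<dots> = - c * (1 - 3 * v^2) * b^2" by (simp add: algebra_simps)
  also have "\<dots> = ((1 / (6 * ?z * f^5)) * (- c * (1 - 3 * v^2))) * (6 * ?z * f^5 * b^2)"
    using z0 f0 by simp
  finally have eq: "(f * ((N' * b - N * b') / (b * b)) + of_real E * (N / b)) * (6 * ?z * f^5 * b^2)
      = ((1 / (6 * ?z * f^5)) * (- c * (1 - 3 * v^2))) * (6 * ?z * f^5 * b^2)" .
  have "6 * ?z * f^5 * b^2 \<noteq> 0" using z0 f0 b0 by simp
  from eq[unfolded mult_right_cancel[OF this]]
  have "f * ((N' * b - N * b') / (b * b)) + of_real E * (N / b) = (1 / (6 * ?z * f^5)) * (- c * (1 - 3 * v^2))" .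
  also have "\<dots> = ?R" by (simp add: v_def f_def D_def b_def)
  finally show ?thesis using der by (simp only: f_def)
qed

text \<open>The density \<open>1/(6 s w^5)\<close> is singular at both ends, but only like \<open>r^(-5/6)\<close> in the distance \<open>r\<close>, so
  that it has a bounded integral. This function has a larger derivative and is continuous on the closed interval.\<close>

definition period_majorant :: "real \<Rightarrow> real" where
  "period_majorant x = (1 / (root_lo * root 6 (27 / root_hi) ^ 5)) * (root 6 (x - root_lo) - root 6 (root_hi - x))"

lemma period_majorant_deriv:
  assumes "root_lo < x" "x < root_hi"
  obtains D where "(period_majorant has_real_derivative D) (at x)" "1 / (6 * x * f_root6 x ^ 5) \<le> D"
proof -
  define a b m where "a = root 6 (x - root_lo)" and "b = root 6 (root_hi - x)" and "m = root 6 (27 / root_hi)"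
  have root_hi: "root_hi > 0" using root_lo_hi by linarith
  have pos: "a > 0" "b > 0" "m > 0" "x > 0" "root_lo > 0" using assms root_lo_hi(1) root_hi by (simp_all add: a_def b_def m_def)
  have d1: "((\<lambda>x. root 6 (x - root_lo)) has_real_derivative inverse (6 * a^5)) (at x)"
  proof -
    have "((\<lambda>x. root 6 (x - root_lo)) has_real_derivative inverse (real 6 * root 6 (x - root_lo) ^ (6 - Suc 0)) * 1) (at x)"
      by (rule DERIV_chain2[where f = "root 6" and g = "\<lambda>x. x - root_lo"])
         (use assms in \<open>auto intro!: DERIV_real_root derivative_eq_intros\<close>)
    thus ?thesis by (simp add: a_def)
  qed
  have d2: "((\<lambda>x. root 6 (root_hi - x)) has_real_derivative - inverse (6 * b^5)) (at x)"
  proof -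
    have "((\<lambda>x. root 6 (root_hi - x)) has_real_derivative inverse (real 6 * root 6 (root_hi - x) ^ (6 - Suc 0)) * -1) (at x)"
      by (rule DERIV_chain2[where f = "root 6" and g = "\<lambda>x. root_hi - x"])
         (use assms in \<open>auto intro!: DERIV_real_root derivative_eq_intros\<close>)
    thus ?thesis by (simp add: b_def)
  qed
  have "(period_majorant has_real_derivative (1 / (root_lo * m ^ 5)) * (inverse (6 * a^5) - - inverse (6 * b^5))) (at x)"
    unfolding period_majorant_def[abs_def] m_def by (intro DERIV_cmult DERIV_diff d1 d2)
  moreover have "1 / (6 * x * f_root6 x ^ 5) \<le> (1 / (root_lo * m ^ 5)) * (inverse (6 * a^5) - - inverse (6 * b^5))"
  proof -
    have "27 / root_hi * (x - root_lo) * (root_hi - x) \<le> disc_real x / x"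
    proof -
      \<comment> \<open>Bounding \<open>w\<close> from below by a multiple of \<open>(x - root_lo)^(1/6) (root_hi - x)^(1/6)\<close>.\<close>
      have "27 / root_hi \<le> 27 / x" using assms pos by (intro divide_left_mono) auto
      hence "27 / root_hi * ((x - root_lo) * (root_hi - x)) \<le> 27 / x * ((x - root_lo) * (root_hi - x))"
        using assms by (intro mult_right_mono) auto
      thus ?thesis unfolding disc_real_def by (simp only: mult.assoc times_divide_eq_left)
    qed
    hence "root 6 (27 / root_hi * (x - root_lo) * (root_hi - x)) \<le> f_root6 x" by (simp add: f_root6_def)
    hence le: "m * a * b \<le> f_root6 x" unfolding m_def a_def b_def by (simp only: real_root_mult)
    \<comment> \<open>The interval is longer than 2, so one of its ends is at distance at least 1 from \<open>x\<close>.\<close>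
    have "1 \<le> a \<or> 1 \<le> b" unfolding a_def b_def using root_lo_hi(2) by (simp add: real_root_ge_1_iff) linarith
    hence ab: "1 \<le> a^5 + b^5"
    proof
      assume "1 \<le> a"
      hence "1 \<le> a^5" by simp
      thus ?thesis using pos by (smt (verit) zero_less_power)
    next
      assume "1 \<le> b"
      hence "1 \<le> b^5" by simp
      thus ?thesis using pos by (smt (verit) zero_less_power)
    qed
    have "6 * root_lo * (m * a * b)^5 \<le> 6 * x * f_root6 x ^ 5"
      using le pos assms by (intro mult_mono power_mono) auto
    hence "1 / (6 * x * f_root6 x ^ 5) \<le> 1 / (6 * root_lo * (m * a * b)^5)"
      using pos by (intro divide_left_mono mult_pos_pos) (auto simp: f_root6_pos[OF assms])
    also have "\<dots> \<le> (a^5 + b^5) / (6 * root_lo * (m * a * b)^5)"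
      using ab pos by (intro divide_right_mono) auto
    also have "\<dots> = (1 / (root_lo * m ^ 5)) * (inverse (6 * a^5) - - inverse (6 * b^5))"
      using pos by (simp add: field_simps)
    finally show ?thesis .
  qed
  ultimately show ?thesis using that by blast
qed

lemma period_majorant_continuous: "continuous_on S period_majorant"
  unfolding period_majorant_def[abs_def] by (intro continuous_intros)

lemma f_root6_continuous: "continuous_on {root_lo..root_hi} f_root6"
  unfolding f_root6_def[abs_def] disc_real_def using root_lo_hi(1) by (intro continuous_intros) auto

lemma period_majorant_mono: 
  assumes "root_lo \<le> x" "x \<le> root_hi"
  shows "period_majorant x - period_majorant root_lo \<le> period_majorant root_hi - period_majorant root_lo"
proof -
  have "root_hi > 0" using root_lo_hi by linarith
  hence "1 / (root_lo * root 6 (27 / root_hi) ^ 5) \<ge> 0" using root_lo_hi(1) by simp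
  moreover have "root 6 (x - root_lo) - root 6 (root_hi - x) \<le> root 6 (root_hi - root_lo) - root 6 (root_hi - root_hi)"
    using assms by (simp add: real_root_le_mono add_mono) (smt (verit) real_root_ge_zero real_root_le_mono zero_less_numeral)
  ultimately have "period_majorant x \<le> period_majorant root_hi" unfolding period_majorant_def by (rule mult_left_mono[rotated])
  thus ?thesis by simp
qed

lemma period_majorant_pos: "period_majorant root_hi - period_majorant root_lo > 0"
proof -
  have "root_hi > 0" using root_lo_hi by linarith
  thus ?thesis using root_lo_hi(1,2) by (simp add: period_majorant_def)
qed

text \<open>With \<open>t\<close> and \<open>v\<close> as in \<open>section_uniformizer_deriv\<close> the curve is \<open>v = t^3 + v^3\<close>. The condition
  \<open>|v| \<le> 1/2\<close> is written as \<open>H \<ge> 0\<close>, without a denominator, as \<open>Y\<close> may have zeros. As long as it holds, \<open>|t|\<close> is bounded by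
  a multiple of \<open>|c|\<close>; for small \<open>c\<close> this and the cubic exclude \<open>|v| = 1/2\<close>, so by continuity the condition holds up to
  the second zero of \<open>f\<close>. But then the real part of \<open>t/c\<close> decreases strictly, while \<open>t\<close> vanishes at both
  ends.\<close>

lemma pullback_coeff_discrete:
  assumes t: "section_triple p B d" "section_wronskian p d = smult c B"
  shows "cmod c \<ge> 1 / (4 * (period_majorant root_hi - period_majorant root_lo))"
proof (rule ccontr)
  assume neg: "\<not> ?thesis"
  define K where "K = period_majorant root_hi - period_majorant root_lo"
  have K: "K > 0" using period_majorant_pos by (simp add: K_def)
  have small: "2 * cmod c * K < 1 / 2" using neg K unfolding K_def[symmetric] by (simp add: field_simps)
  have e: "B^2 = p^3 + disc_poly * s_poly^5 * d^6" using t by (simp add: section_triple_def)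
  define b w T V where "b = (\<lambda>x. poly B (complex_of_real x))"
    and "w = (\<lambda>x. complex_of_real (f_root6 x))"
    and "T = (\<lambda>x. complex_of_real (f_root6 x) * (poly (p * s_poly * d) (of_real x) / poly B (of_real x)))"
    and "V = (\<lambda>x. of_real (f_root6 x)^3 * (of_real x * poly d (of_real x))^3 / poly B (complex_of_real x))"
  define H where "H = (\<lambda>x. cmod (b x) - 2 * cmod (of_real (f_root6 x)^3 * (of_real x * poly d (of_real x))^3))"
  have conw: "continuous_on {root_lo..root_hi} (\<lambda>x. complex_of_real (f_root6 x))"
    by (intro continuous_intros f_root6_continuous)
  have conb: "continuous_on S b" for S unfolding b_def by (intro continuous_intros)
  have conH: "continuous_on {root_lo..root_hi} H"
    unfolding H_def by (intro continuous_intros conb conw)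
  have w6: "w x ^ 6 * of_real x = poly disc_poly (of_real x)" if "root_lo \<le> x" "x \<le> root_hi" for x
  proof -
    have "complex_of_real (f_root6 x ^ 6 * x) = of_real (disc_real x)" using f_root6_pow6[OF that] that root_lo_hi(1) by simp
    thus ?thesis by (simp add: w_def poly_disc_real)
  qed
  have b_nz: "b x \<noteq> 0" if x: "root_lo \<le> x" "x \<le> root_hi" and Hx: "H x \<ge> 0" for x
  proof
    assume b0: "b x = 0"
    hence "of_real (f_root6 x)^3 * (complex_of_real x * poly d (of_real x))^3 = 0" using Hx by (simp add: H_def)
    hence "w x = 0 \<or> x = 0 \<or> poly d (of_real x) = 0" by (auto simp: w_def)
    hence "poly (disc_poly * s_poly^5 * d^6) (of_real x) = 0" using w6[OF x] by auto
    moreover have "poly (p^3 + disc_poly * s_poly^5 * d^6) (of_real x) = 0"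
      unfolding e[symmetric] using b0 by (simp add: b_def)
    ultimately have "poly p (of_real x) ^ 3 = 0" by (simp only: poly_add poly_power add_0_right)
    hence "poly p (of_real x) = 0" by simp
    thus False using section_triple_pB_no_common_root[OF t(1)] b0 by (simp add: b_def)
  qed
  have V_le: "cmod (V x) \<le> 1 / 2" if "root_lo \<le> x" "x \<le> root_hi" "H x \<ge> 0" for x
  proof -
    have "cmod (b x) > 0" using b_nz[OF that] by simp
    thus ?thesis using that(3) by (simp add: H_def V_def b_def norm_divide divide_simps)
  qed
  have cubic: "V x = T x ^ 3 + V x ^ 3" if x: "root_lo \<le> x" "x \<le> root_hi" "H x \<ge> 0" for x
  proof -
    define P D z where "P = poly p (complex_of_real x)" and "D = poly d (complex_of_real x)" and "z = complex_of_real x"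
    have b0: "b x \<noteq> 0" by (rule b_nz[OF x])
    have TV: "T x = w x * (P * z * D / b x)" "V x = w x^3 * (z * D)^3 / b x"
      by (simp_all add: T_def V_def w_def P_def z_def D_def b_def)
    have "b x ^ 2 = P^3 + (w x ^ 6 * z) * z^5 * D^6"
      using arg_cong[OF e, of "\<lambda>q. poly q z"] w6[OF x(1,2)] by (simp add: b_def P_def D_def z_def)
    hence "w x^3 * (z * D)^3 * b x ^ 2 = (w x * (P * z * D))^3 + (w x^3 * (z * D)^3)^3"
      by (simp only:) (simp add: eval_nat_numeral algebra_simps)
    moreover have "V x * b x ^ 3 = w x^3 * (z * D)^3 * b x ^ 2"
      using b0 by (simp add: TV power2_eq_square power3_eq_cube)
    moreover have "T x = w x * (P * z * D) / b x" by (simp add: TV)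
    hence "(T x ^ 3 + V x ^ 3) * b x ^ 3 = (w x * (P * z * D))^3 + (w x^3 * (z * D)^3)^3"
      using b0 unfolding TV(2) by (simp only: power_divide distrib_right) simp
    ultimately have "V x * b x ^ 3 = (T x ^ 3 + V x ^ 3) * b x ^ 3" by simp
    thus ?thesis using b0 by simp
  qed
  have T_cont: "continuous_on {root_lo..u} T" if "u \<le> root_hi" "\<And>x. root_lo \<le> x \<Longrightarrow> x \<le> u \<Longrightarrow> H x \<ge> 0" for u
  proof -
    have "continuous_on {root_lo..u} f_root6" by (rule continuous_on_subset[OF f_root6_continuous]) (use that in auto)
    moreover have "\<forall>x\<in>{root_lo..u}. poly B (complex_of_real x) \<noteq> 0"
      using b_nz that unfolding b_def by force
    ultimately show ?thesis unfolding T_def by (intro continuous_intros)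
  qed
  have T_deriv: "(T has_vector_derivative of_real (1 / (6 * x * f_root6 x ^ 5)) * (- c * (1 - 3 * V x ^ 2))) (at x)"
    if "root_lo < x" "x < root_hi" "H x \<ge> 0" for x
    unfolding T_def V_def using b_nz[of x] that
    by (intro section_uniformizer_deriv[OF t]) (auto simp: b_def)
  have T_le: "cmod (T u) \<le> 2 * cmod c * K" if u: "root_lo < u" "u \<le> root_hi" "\<And>x. root_lo \<le> x \<Longrightarrow> x \<le> u \<Longrightarrow> H x \<ge> 0" for u
  proof -
    obtain D where D: "\<And>x. root_lo < x \<Longrightarrow> x < root_hi \<Longrightarrow> (period_majorant has_real_derivative D x) (at x)"
      "\<And>x. root_lo < x \<Longrightarrow> x < root_hi \<Longrightarrow> 1 / (6 * x * f_root6 x ^ 5) \<le> D x"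
    proof -
      have "\<forall>x. \<exists>D. root_lo < x \<and> x < root_hi \<longrightarrow> (period_majorant has_real_derivative D) (at x) \<and> 1 / (6 * x * f_root6 x ^ 5) \<le> D"
        using period_majorant_deriv by metis
      thus ?thesis using that by metis
    qed
    have "cmod (T u - T root_lo) \<le> 2 * cmod c * period_majorant u - 2 * cmod c * period_majorant root_lo"
    proof (rule differentiable_bound_general[where \<phi>' = "\<lambda>x. 2 * cmod c * D x"])
      show "continuous_on {root_lo..u} T" using T_cont u by blast
      show "continuous_on {root_lo..u} (\<lambda>x. 2 * cmod c * period_majorant x)" by (intro continuous_intros period_majorant_continuous)
      fix x assume x: "root_lo < x" "x < u"
      show "(T has_vector_derivative of_real (1 / (6 * x * f_root6 x ^ 5)) * (- c * (1 - 3 * V x ^ 2))) (at x)"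
        using T_deriv x u by simp
      show "((\<lambda>x. 2 * cmod c * period_majorant x) has_vector_derivative 2 * cmod c * D x) (at x)"
        using DERIV_cmult[OF D(1)[of x], of "2 * cmod c"] x u(2) by (simp add: has_real_derivative_iff_has_vector_derivative)
      have "cmod (1 - 3 * V x ^ 2) \<le> cmod 1 + cmod (3 * V x ^ 2)" by (rule norm_triangle_ineq4)
      also have "\<dots> = 1 + 3 * cmod (V x) ^ 2" by (simp add: norm_mult norm_power)
      also have "\<dots> \<le> 1 + 3 * (1/2)^2" using V_le[of x] x u by (intro add_left_mono mult_left_mono power_mono) auto
      finally have 1: "cmod (1 - 3 * V x ^ 2) \<le> 2" by (simp add: power2_eq_square)
      have ph: "1 / (6 * x * f_root6 x ^ 5) \<ge> 0" using f_root6_pos[of x] x u root_lo_hi(1) by simp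
      have "cmod (of_real (1 / (6 * x * f_root6 x ^ 5)) * (- c * (1 - 3 * V x ^ 2)))
          = 1 / (6 * x * f_root6 x ^ 5) * (cmod c * cmod (1 - 3 * V x ^ 2))"
        unfolding norm_mult norm_of_real norm_minus_cancel using ph by simp
      also have "\<dots> \<le> D x * (cmod c * 2)"
      proof (intro mult_mono)
        show le: "1 / (6 * x * f_root6 x ^ 5) \<le> D x" using D(2)[of x] x u by simp
        show "0 \<le> D x" using ph le by (rule order_trans)
      qed (use 1 in auto)
      finally show "cmod (of_real (1 / (6 * x * f_root6 x ^ 5)) * (- c * (1 - 3 * V x ^ 2))) \<le> 2 * cmod c * D x"
        by (simp add: mult_ac)
    qed (use u in simp)
    also have "\<dots> = 2 * cmod c * (period_majorant u - period_majorant root_lo)" by (simp add: algebra_simps)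
    also have "\<dots> \<le> 2 * cmod c * K" unfolding K_def using period_majorant_mono[of u] u by (intro mult_left_mono) auto
    finally show ?thesis by (simp add: T_def)
  qed
  have H_ends: "H x > 0" if "x = root_lo \<or> x = root_hi" for x
  proof -
    have 0: "disc_real x = 0" "f_root6 x = 0" using that by (auto simp: disc_real_def)
    have "b x \<noteq> 0"
    proof
      assume b0: "b x = 0"
      have "poly p (of_real x) = 0"
        using arg_cong[OF e, of "\<lambda>q. poly q (of_real x)"] b0 0 by (simp add: b_def poly_disc_real)
      thus False using section_triple_pB_no_common_root[OF t(1)] b0 by (simp add: b_def)
    qed
    thus ?thesis using 0 by (simp add: H_def)
  qed
  have H_pos: "H x > 0" if x: "root_lo \<le> x" "x \<le> root_hi" for x
  proof (rule ccontr)
    assume neg: "\<not> H x > 0"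
    define Z where "Z = {u \<in> {root_lo..root_hi}. H u = 0}"
    have cmp: "compact Z"
    proof -
      have "closed Z" unfolding Z_def
        using continuous_closed_preimage_constant[OF conH, of 0] by simp
      hence "compact ({root_lo..root_hi} \<inter> Z)" by (intro compact_Int_closed compact_Icc)
      moreover have "{root_lo..root_hi} \<inter> Z = Z" by (auto simp: Z_def)
      ultimately show ?thesis by simp
    qed
    \<comment> \<open>Since \<open>H\<close> is positive at the left end, any point where it is not positive has a zero at it or to its left.\<close>
    have ivt: "\<exists>u\<in>Z. u \<le> y" if y: "root_lo \<le> y" "y \<le> root_hi" "H y \<le> 0" for y
    proof -
      have "\<exists>u\<ge>root_lo. u \<le> y \<and> H u = 0"
        using y H_ends[of root_lo] by (intro IVT2') (auto intro: continuous_on_subset[OF conH])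
      thus ?thesis using y by (auto simp: Z_def)
    qed
    have "Z \<noteq> {}" using ivt[of x] x neg by fastforce
    then obtain u where u: "u \<in> Z" "\<And>v. v \<in> Z \<Longrightarrow> u \<le> v" using compact_attains_inf[OF cmp] by blast
    have ub: "root_lo \<le> u" "u \<le> root_hi" "H u = 0" using u by (auto simp: Z_def)
    have "root_lo < u" using ub H_ends[of root_lo] by (cases "u = root_lo") auto
    have nn: "H y \<ge> 0" if "root_lo \<le> y" "y \<le> u" for y
    proof (rule ccontr)
      assume "\<not> H y \<ge> 0"
      then obtain v where "v \<in> Z" "v \<le> y" using ivt[of y] \<open>root_lo \<le> y\<close> \<open>y \<le> u\<close> ub by force
      hence "y = u" using u(2)[of v] that by simp
      thus False using \<open>\<not> H y \<ge> 0\<close> ub by simp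
    qed
    have "cmod (T u) \<le> 1 / 2" using T_le[OF \<open>root_lo < u\<close> ub(2) nn] small by simp
    hence T3: "cmod (T u) ^ 3 \<le> (1/2)^3" by (intro power_mono) auto
    have Vu: "cmod (V u) = 1 / 2"
    proof -
      have "cmod (b u) > 0" using b_nz[OF ub(1,2)] ub by simp
      have m: "cmod (b u) * cmod (V u) = cmod (of_real (f_root6 u)^3 * (of_real u * poly d (of_real u))^3)"
        using b_nz[OF ub(1,2)] ub(3) by (simp add: V_def b_def norm_divide)
      have "cmod (b u) * (1 - 2 * cmod (V u)) = cmod (b u) - 2 * (cmod (b u) * cmod (V u))"
        by (simp add: algebra_simps)
      also have "\<dots> = 0" unfolding m using ub(3) by (simp only: H_def)
      finally show ?thesis using \<open>cmod (b u) > 0\<close> by simp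
    qed
    have "cmod (V u) \<le> cmod (T u) ^ 3 + cmod (V u) ^ 3"
      using arg_cong[OF cubic[OF ub(1,2)], of cmod] norm_triangle_ineq[of "T u ^ 3" "V u ^ 3"] ub(3) by (simp add: norm_power)
    thus False using T3 unfolding Vu by (simp add: power3_eq_cube)
  qed
  have "c \<noteq> 0"
  proof
    assume "c = 0"
    obtain c' where "c' \<noteq> 0" "section_wronskian p d = smult c' B" using section_wronskian_constant[OF t(1)] .
    thus False using t(2) \<open>c = 0\<close> section_triple_degrees(5)[OF t(1)] by simp
  qed
  have "Re (T root_lo / c) > Re (T root_hi / c)"
  proof (rule DERIV_neg_imp_decreasing_open[where f = "\<lambda>x. Re (T x / c)" and a = root_lo and b = root_hi])
    show "root_lo < root_hi" using root_lo_hi(2) by simp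
    have "continuous_on {root_lo..root_hi} T" using T_cont[of root_hi] H_pos by force
    thus "continuous_on {root_lo..root_hi} (\<lambda>x. Re (T x / c))" using \<open>c \<noteq> 0\<close> by (intro continuous_intros) auto
    fix x assume x: "root_lo < x" "x < root_hi"
    have ph: "1 / (6 * x * f_root6 x ^ 5) > 0" using f_root6_pos[of x] x root_lo_hi(1) by simp
    define k where "k = 1 / (6 * x * f_root6 x ^ 5)"
    have "(T has_vector_derivative of_real k * (- c * (1 - 3 * V x ^ 2))) (at x)"
      using T_deriv[OF x] H_pos[of x] x unfolding k_def by simp
    hence "((\<lambda>x. T x / c) has_vector_derivative of_real k * (- c * (1 - 3 * V x ^ 2)) / c) (at x)"
      by (rule has_vector_derivative_divide)
    hence "((\<lambda>x. Re (T x / c)) has_real_derivative Re (of_real k * (- c * (1 - 3 * V x ^ 2)) / c)) (at x)"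
      by (rule has_field_derivative_Re)
    moreover have "of_real k * (- c * (1 - 3 * V x ^ 2)) / c = - (of_real k * (1 - 3 * V x ^ 2))"
      using \<open>c \<noteq> 0\<close> by simp
    moreover have "Re (- (of_real k * (1 - 3 * V x ^ 2))) < 0"
    proof -
      have "\<bar>Re (3 * V x ^ 2)\<bar> \<le> cmod (3 * V x ^ 2)" by (rule abs_Re_le_cmod)
      also have "\<dots> = 3 * cmod (V x) ^ 2" by (simp add: norm_mult norm_power)
      also have "\<dots> \<le> 3 * (1/2)^2" using V_le[of x] x H_pos[of x] by (intro mult_left_mono power_mono) auto
      also have "3 * (1/2)^2 < (1 :: real)" by (simp add: power2_eq_square)
      finally have "Re (3 * V x ^ 2) < 1" by (rule abs_less_iff[THEN iffD1, THEN conjunct1])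
      hence "Re (1 - 3 * V x ^ 2) > 0" by simp
      moreover have "Re (- (of_real k * (1 - 3 * V x ^ 2))) = - (k * Re (1 - 3 * V x ^ 2))" by simp
      ultimately show ?thesis using ph unfolding k_def[symmetric] by (simp add: mult_pos_pos)
    qed
    ultimately show "\<exists>y. ((\<lambda>x. Re (T x / c)) has_real_derivative y) (at x) \<and> y < 0" by auto
  qed
  thus False by (simp add: T_def)
qed

section \<open>Discrete modules over the Eisenstein integers\<close>

lemma cube_root_of_unity_facts:
  assumes "\<omega> = (- 1 + csqrt (- 3)) / 2"
  shows "\<omega>^2 = - 1 - \<omega>" "\<omega>^3 = 1" "Re \<omega> = - 1 / 2" "Im \<omega> = sqrt 3 / 2"
proof -
  have "2 * ((- 1 + c) / 2) + 1 = c" for c :: complex by (simp add: field_simps)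
  hence w: "2 * \<omega> + 1 = csqrt (- 3)" unfolding assms .
  have "(2 * \<omega> + 1)^2 = - 3" unfolding w by (rule power2_csqrt)
  hence "4 * (\<omega>^2 + \<omega> + 1) = 0" by (simp add: power2_eq_square algebra_simps)
  hence "\<omega>^2 + \<omega> + 1 = 0" unfolding mult_eq_0_iff by simp
  thus 1: "\<omega>^2 = - 1 - \<omega>" by (simp add: algebra_simps eq_neg_iff_add_eq_0)
  have "\<omega>^3 = \<omega> * \<omega>^2" by (simp add: eval_nat_numeral)
  also have "\<dots> = - \<omega> - \<omega>^2" unfolding 1 by (simp add: algebra_simps flip: power2_eq_square) (simp add: 1)
  also have "\<dots> = 1" unfolding 1 by simp
  finally show "\<omega>^3 = 1" .
  have "csqrt (- 3) = \<i> * sqrt 3" by simp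
  thus "Re \<omega> = - 1 / 2" "Im \<omega> = sqrt 3 / 2" unfolding assms by simp_all
qed

lemma eisenstein_rounding:
  assumes "Re \<omega> = - 1 / 2" "Im \<omega> = sqrt 3 / 2"
  obtains a b :: int where "cmod (u - (of_int a + of_int b * \<omega>)) ^ 2 \<le> 3 / 4"
proof -
  define y where "y = Im u / (sqrt 3 / 2)"
  define x where "x = Re u + y / 2"
  define a b where "a = round x" and "b = round y"
  define e f where "e = x - of_int a" and "f = y - of_int b"
  have ef: "\<bar>e\<bar> \<le> 1 / 2" "\<bar>f\<bar> \<le> 1 / 2"
    using of_int_round_abs_le[of x] of_int_round_abs_le[of y] by (simp_all add: e_def f_def a_def b_def abs_minus_commute)
  have "Re (u - (of_int a + of_int b * \<omega>)) = e - f / 2"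
    by (simp add: assms e_def f_def x_def)
  moreover have "Im (u - (of_int a + of_int b * \<omega>)) = f * (sqrt 3 / 2)"
    by (simp add: assms f_def y_def field_simps)
  ultimately have "cmod (u - (of_int a + of_int b * \<omega>)) ^ 2 = (e - f / 2)^2 + (f * (sqrt 3 / 2))^2"
    by (simp only: cmod_power2)
  also have "\<dots> = e^2 - e * f + f^2" by (simp add: power2_eq_square algebra_simps)
  also have "\<dots> \<le> \<bar>e\<bar>^2 + \<bar>e\<bar> * \<bar>f\<bar> + \<bar>f\<bar>^2"
  proof -
    have "- (e * f) \<le> \<bar>e\<bar> * \<bar>f\<bar>" by (metis abs_ge_minus_self abs_mult)
    thus ?thesis by simp
  qed
  also have "\<dots> \<le> (1/2)^2 + (1/2) * (1/2) + (1/2)^2"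
    using ef by (intro add_mono power_mono mult_mono) auto
  finally show ?thesis using that by (simp add: power2_eq_square)
qed

text \<open>Euclid's algorithm: any \<open>g\<close> of nearly minimal modulus generates. Rounding leaves a remainder of modulus
  at most \<open>sqrt 3 / 2\<close> times that of \<open>g\<close>, and \<open>11/10 * sqrt 3 / 2 < 1\<close>.\<close>

lemma discrete_eisenstein_module_principal:
  fixes L :: "complex set"
  assumes w: "Re \<omega> = - 1 / 2" "Im \<omega> = sqrt 3 / 2"
    and closed: "\<And>x y. x \<in> L \<Longrightarrow> y \<in> L \<Longrightarrow> x - y \<in> L" "\<And>x. x \<in> L \<Longrightarrow> \<omega> * x \<in> L"
    and disc: "\<epsilon> > 0" "\<And>x. x \<in> L \<Longrightarrow> x \<noteq> 0 \<Longrightarrow> \<epsilon> \<le> cmod x"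
    and ne: "z0 \<in> L" "z0 \<noteq> 0"
  obtains g where "g \<in> L" "g \<noteq> 0" "\<And>z. z \<in> L \<Longrightarrow> \<exists>a b :: int. z = (of_int a + of_int b * \<omega>) * g"
proof -
  define N where "N = cmod ` (L - {0})"
  define m where "m = Inf N"
  have bb: "bdd_below N" using disc by (auto simp: N_def intro!: bdd_belowI)
  have Nne: "N \<noteq> {}" using ne by (auto simp: N_def)
  have m: "m > 0" using cInf_greatest[OF Nne, of \<epsilon>] disc by (force simp: N_def m_def)
  have "\<exists>n\<in>N. n < 11 / 10 * m" using cInf_lessD[OF Nne, of "11 / 10 * m"] m unfolding m_def by auto
  then obtain g where g: "g \<in> L" "g \<noteq> 0" "cmod g < 11 / 10 * m" by (auto simp: N_def)
  have low: "m \<le> cmod x" if "x \<in> L" "x \<noteq> 0" for x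
    unfolding m_def by (rule cInf_lower[OF _ bb]) (use that in \<open>auto simp: N_def\<close>)
  have zero: "0 \<in> L" using closed(1)[OF ne(1) ne(1)] by simp
  have neg: "- x \<in> L" if "x \<in> L" for x using closed(1)[OF zero that] by simp
  have add: "x + y \<in> L" if "x \<in> L" "y \<in> L" for x y using closed(1)[OF that(1) neg[OF that(2)]] by simp
  have nat_mult: "of_nat n * x \<in> L" if "x \<in> L" for n x
    by (induction n) (use zero add that in \<open>auto simp: distrib_right\<close>)
  have int_mult: "of_int k * x \<in> L" if "x \<in> L" for k x
  proof -
    obtain n where "k = int n \<or> k = - int n" by (metis int_cases2)
    thus ?thesis using nat_mult[OF that, of n] neg by auto
  qed
  have "\<exists>a b :: int. z = (of_int a + of_int b * \<omega>) * g" if z: "z \<in> L" for z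
  proof -
    obtain a b :: int where ab: "cmod (z / g - (of_int a + of_int b * \<omega>)) ^ 2 \<le> 3 / 4"
      using eisenstein_rounding[OF w] .
    let ?r = "z - (of_int a + of_int b * \<omega>) * g"
    have "?r = (z - of_int a * g) - of_int b * (\<omega> * g)" by (simp add: algebra_simps)
    hence rL: "?r \<in> L" by (simp only: closed int_mult g(1) z)
    have "?r = (z / g - (of_int a + of_int b * \<omega>)) * g" using g(2) by (simp add: field_simps)
    hence "cmod ?r ^ 2 = cmod (z / g - (of_int a + of_int b * \<omega>)) ^ 2 * cmod g ^ 2"
      by (simp only: norm_mult power_mult_distrib)
    also have "\<dots> \<le> 3 / 4 * (11 / 10 * m)^2" using ab g(3) m by (intro mult_mono power_mono) auto
    also have "\<dots> < m^2" using m by (simp add: power2_eq_square)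
    finally have "cmod ?r < m" using m by (simp add: power2_less_imp_less)
    hence "?r = 0" using low[OF rL] by fastforce
    thus ?thesis by auto
  qed
  thus ?thesis using that g by blast
qed

section \<open>The Mordell-Weil group is cyclic over the Eisenstein integers\<close>

lemma integer_multiple_exists:
  assumes P: "on_curve inose_curve P"
  shows "\<exists>R. on_curve inose_curve R \<and> pullback_coeff R = of_int k * pullback_coeff P"
proof (induction k rule: int_induct[of _ 0])
  case base show ?case by (rule exI[of _ Infinity]) simp
next
  case (step1 i)
  then obtain R where R: "on_curve inose_curve R" "pullback_coeff R = of_int i * pullback_coeff P" by blast
  show ?case using pullback_coeff_ec_add[OF R(1) P] R(2) by (metis distrib_right mult_1 of_int_1 of_int_add)
next
  case (step2 i)
  then obtain R where R: "on_curve inose_curve R" "pullback_coeff R = of_int i * pullback_coeff P" by blast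
  have "pullback_coeff (ec_add inose_curve R (twist 1 P)) = of_int (i - 1) * pullback_coeff P" 
    using pullback_coeff_ec_add(2)[OF R(1) pullback_coeff_twist(1)[OF _ P]] pullback_coeff_twist(2)[OF _ P, of 1] R(2)
    by (simp add: algebra_simps)
  thus ?case using pullback_coeff_ec_add(1)[OF R(1) pullback_coeff_twist(1)[OF _ P]] by force
qed

lemma eisenstein_multiple_exists:
  assumes w: "\<omega>^3 = 1" and P: "on_curve inose_curve P"
  shows "\<exists>R. on_curve inose_curve R \<and> pullback_coeff R = (of_int a + of_int b * \<omega>) * pullback_coeff P"
proof -
  obtain R where R: "on_curve inose_curve R" "pullback_coeff R = of_int a * pullback_coeff P" using integer_multiple_exists[OF P] by blast
  obtain T where T: "on_curve inose_curve T" "pullback_coeff T = of_int (- b) * pullback_coeff (twist \<omega> P)"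
    using integer_multiple_exists[OF pullback_coeff_twist(1)[OF w P]] by blast
  show ?thesis using pullback_coeff_ec_add[OF R(1) T(1)] R T pullback_coeff_twist(2)[OF w P]
    by (intro exI[of _ "ec_add inose_curve R T"]) (simp add: algebra_simps)
qed

text \<open>The binary form \<open>(a, b) \<mapsto> h((a + b \<omega>) P)\<close> is quadratic by the parallelogram law, and takes the value
  \<open>h(P)\<close> at \<open>(1, 0)\<close>, \<open>(0, 1)\<close> and \<open>(1, 1)\<close>, because \<open>\<omega>\<close> and \<open>1 + \<omega> = -\<omega>^2\<close> act by automorphisms.\<close>

lemma naive_height_eisenstein_multiple:
  assumes w: "\<omega>^3 = 1" "\<omega>^2 = - 1 - \<omega>"
    and P: "on_curve inose_curve P" and R: "on_curve inose_curve R"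
    and s: "pullback_coeff R = (of_int a + of_int b * \<omega>) * pullback_coeff P"
  shows "int (naive_height R) = (a^2 - a * b + b^2) * int (naive_height P)"
proof -
  obtain M where M: "\<And>a b. on_curve inose_curve (M a b)"
    "\<And>a b. pullback_coeff (M a b) = (of_int a + of_int b * \<omega>) * pullback_coeff P"
    using eisenstein_multiple_exists[OF w(1) P] by metis
  have Meq: "T = M a b" if "on_curve inose_curve T" "pullback_coeff T = (of_int a + of_int b * \<omega>) * pullback_coeff P" for T a b
    using pullback_coeff_inject[OF that(1) M(1)] that M(2) by metis
  define q where "q a b = int (naive_height (M a b))" for a b
  have par: "q (a + a') (b + b') + q (a - a') (b - b') = 2 * q a b + 2 * q a' b'" for a b a' b'
  proof -
    have t: "on_curve inose_curve (twist 1 (M a' b'))" "pullback_coeff (twist 1 (M a' b')) = - pullback_coeff (M a' b')"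
      using pullback_coeff_twist[OF _ M(1), of 1] by simp_all
    have "ec_add inose_curve (M a b) (M a' b') = M (a + a') (b + b')"
      by (rule Meq) (use pullback_coeff_ec_add[OF M(1) M(1)] M(2) in \<open>simp_all add: algebra_simps\<close>)
    moreover have "ec_add inose_curve (M a b) (twist 1 (M a' b')) = M (a - a') (b - b')"
      by (rule Meq) (use pullback_coeff_ec_add[OF M(1) t(1)] t(2) M(2) in \<open>simp_all add: algebra_simps\<close>)
    ultimately show ?thesis using parallelogram[OF M(1) M(1), of a b a' b'] unfolding q_def by simp
  qed
  have w2: "(\<omega>^2)^3 = 1" proof -
    have "(\<omega>^2)^3 = (\<omega>^3)^2" by (simp flip: power_mult)
    thus ?thesis using w(1) by simp
  qed
  have "P = M 1 0" by (rule Meq[OF P]) simp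
  hence 1: "q 1 0 = int (naive_height P)" by (simp add: q_def)
  have t: "on_curve inose_curve (twist 1 (twist \<omega> P))" "pullback_coeff (twist 1 (twist \<omega> P)) = \<omega> * pullback_coeff P"
    using pullback_coeff_twist[OF _ pullback_coeff_twist(1)[OF w(1) P], of 1] pullback_coeff_twist(2)[OF w(1) P] by simp_all
  have "twist 1 (twist \<omega> P) = M 0 1" by (rule Meq[OF t(1)]) (simp add: t)
  hence 2: "q 0 1 = int (naive_height P)"
    unfolding q_def using naive_height_twist[OF w(1) P] naive_height_twist1 by metis
  have "twist (\<omega>^2) P = M 1 1" by (rule Meq[OF pullback_coeff_twist(1)[OF w2 P]]) (subst pullback_coeff_twist(2)[OF w2 P], simp add: w(2))
  hence 3: "q 1 1 = int (naive_height P)" unfolding q_def using naive_height_twist[OF w2 P] by metis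
  have "R = M a b" by (rule Meq[OF R s])
  hence "int (naive_height R) = q a b" by (simp add: q_def)
  also have "\<dots> = (a^2 - a * b + b^2) * int (naive_height P)"
    using parallelogram_imp_quadratic[of q a b, OF par] 1 2 3 by (simp add: algebra_simps)
  finally show ?thesis .
qed

text \<open>If \<open>G\<close> generates and \<open>P = (a + b \<omega>) G\<close>, then 6 is the norm of \<open>a + b \<omega>\<close> times \<open>h(G) \<ge> 4\<close>. The norm
  is therefore 1, and \<open>a + b \<omega>\<close> is a unit with inverse \<open>(a - b) - b \<omega>\<close>.\<close>

lemma pullback_coeff_lattice:
  assumes w: "\<omega> = (- 1 + csqrt (- 3)) / 2" and P: "on_curve inose_curve P" "naive_height P = 6"
    and R: "on_curve inose_curve R"
  obtains a b :: int where "pullback_coeff R = (of_int a + of_int b * \<omega>) * pullback_coeff P"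
proof -
  note ws = cube_root_of_unity_facts[OF w]
  define L where "L = pullback_coeff ` {Q. on_curve inose_curve Q}"
  have Pn: "P \<noteq> Infinity" using P(2) by auto
  have "\<exists>g. g \<in> L \<and> g \<noteq> 0 \<and> (\<forall>z\<in>L. \<exists>a b :: int. z = (of_int a + of_int b * \<omega>) * g)"
  proof (rule discrete_eisenstein_module_principal[OF ws(3,4)])
    fix x y assume "x \<in> L" "y \<in> L"
    then obtain Q T where Q: "on_curve inose_curve Q" "x = pullback_coeff Q" and T: "on_curve inose_curve T" "y = pullback_coeff T"
      by (auto simp: L_def)
    have t: "on_curve inose_curve (twist 1 T)" "pullback_coeff (twist 1 T) = - y" using pullback_coeff_twist[OF _ T(1), of 1] T by simp_all
    have "pullback_coeff (ec_add inose_curve Q (twist 1 T)) = x - y" using pullback_coeff_ec_add(2)[OF Q(1) t(1)] Q t by simp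
    thus "x - y \<in> L" using pullback_coeff_ec_add(1)[OF Q(1) t(1)] unfolding L_def by force
  next
    fix x assume "x \<in> L"
    then obtain Q where Q: "on_curve inose_curve Q" "x = pullback_coeff Q" by (auto simp: L_def)
    obtain T where "on_curve inose_curve T" "pullback_coeff T = (of_int 0 + of_int 1 * \<omega>) * pullback_coeff Q"
      using eisenstein_multiple_exists[OF ws(2) Q(1)] by blast
    thus "\<omega> * x \<in> L" using Q unfolding L_def by force
  next
    show "1 / (4 * (period_majorant root_hi - period_majorant root_lo)) > 0" using period_majorant_pos by simp
  next
    fix x assume "x \<in> L" "x \<noteq> 0"
    then obtain Q where Q: "on_curve inose_curve Q" "x = pullback_coeff Q" by (auto simp: L_def)
    have "Q \<noteq> Infinity" using \<open>x \<noteq> 0\<close> Q by auto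
    then obtain p B d where t: "section_triple p B d" "Q = section_point p B d" using point_cases[OF Q(1)] by metis
    obtain c where c: "section_wronskian p d = smult c B" using section_wronskian_constant[OF t(1)] by metis
    have d: "d \<noteq> 0" using t by (simp add: section_triple_def)
    hence "pullback_coeff Q = c" unfolding t(2) section_point_def
      by (intro pullback_coeff_eqI) (use nabla_section[OF d, of p] to_fract_smult[of c B] c d section_triple_degrees(5)[OF t(1)] in simp_all)
    thus "1 / (4 * (period_majorant root_hi - period_majorant root_lo)) \<le> cmod x" using pullback_coeff_discrete[OF t(1) c] Q by simp
  next
    show "pullback_coeff P \<in> L" using P by (auto simp: L_def)
    show "pullback_coeff P \<noteq> 0" using pullback_coeff_eq_0_iff P Pn by blast
  qed blast
  then obtain g where g: "g \<in> L" "g \<noteq> 0" "\<And>z. z \<in> L \<Longrightarrow> \<exists>a b :: int. z = (of_int a + of_int b * \<omega>) * g" by blast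
  obtain G where G: "on_curve inose_curve G" "pullback_coeff G = g" using g(1) by (auto simp: L_def)
  have G4: "naive_height G \<ge> 4" using naive_height_ge_4 G g(2) by fastforce
  obtain a b :: int where ab: "pullback_coeff P = (of_int a + of_int b * \<omega>) * g" using g(3)[of "pullback_coeff P"] P by (auto simp: L_def)
  have "6 = (a^2 - a * b + b^2) * int (naive_height G)"
    using naive_height_eisenstein_multiple[OF ws(2,1) G(1) P(1)] ab G P(2) by simp
  moreover have "n = 1" if "6 = n * h" "h \<ge> 4" for n h :: int
  proof -
    have "n > 0" using that by (metis zero_less_mult_pos2 zero_less_numeral order_less_le_trans)
    moreover have "n < 2"
    proof (rule ccontr)
      assume "\<not> n < 2"
      hence "2 * 4 \<le> n * h" using that by (intro mult_mono) auto
      thus False using that by simp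
    qed
    ultimately show ?thesis by simp
  qed
  ultimately have n1: "a^2 - a * b + b^2 = 1" using G4 by simp
  have "(of_int (a - b) - of_int b * \<omega>) * (of_int a + of_int b * \<omega>) = of_int (a^2 - a * b + b^2)"
  proof -
    have "(of_int (a - b) - of_int b * \<omega>) * (of_int a + of_int b * \<omega>)
      = of_int a * of_int a - of_int a * of_int b - of_int b * of_int b * \<omega> - of_int b * of_int b * \<omega>^2"
      by (simp add: algebra_simps power2_eq_square)
    thus ?thesis unfolding ws(1) by (simp add: algebra_simps power2_eq_square)
  qed
  hence inv: "(of_int (a - b) - of_int b * \<omega>) * pullback_coeff P = g" unfolding ab n1 by (metis mult.assoc mult_1 of_int_1)
  obtain a' b' :: int where ab': "pullback_coeff R = (of_int a' + of_int b' * \<omega>) * g" using g(3)[of "pullback_coeff R"] R by (auto simp: L_def)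
  have "(of_int a' + of_int b' * \<omega>) * (of_int (a - b) - of_int b * \<omega>)
    = of_int a' * of_int (a - b) + (of_int b' * of_int (a - b) - of_int a' * of_int b) * \<omega> - of_int b' * of_int b * \<omega>^2"
    by (simp add: algebra_simps power2_eq_square)
  also have "\<dots> = of_int (a' * (a - b) + b' * b) + of_int (b' * (a - b) - a' * b + b' * b) * \<omega>"
    unfolding ws(1) by (simp add: algebra_simps)
  finally have "pullback_coeff R = (of_int (a' * (a - b) + b' * b) + of_int (b' * (a - b) - a' * b + b' * b) * \<omega>) * pullback_coeff P"
    unfolding ab' inv[symmetric] by (simp only: mult.assoc[symmetric])
  thus ?thesis using that by blast
qed

section \<open>Fields of definition and the group structure\<close>

definition subfield_set :: "ratfun set \<Rightarrow> bool" where
  "subfield_set L \<longleftrightarrow> 0 \<in> L \<and> 1 \<in> L \<and>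
     (\<forall>x\<in>L. \<forall>y\<in>L. x + y \<in> L \<and> x * y \<in> L) \<and> (\<forall>x\<in>L. - x \<in> L \<and> inverse x \<in> L)"

lemma subfield_setD:
  assumes "subfield_set L"
  shows "0 \<in> L" "1 \<in> L" "\<And>x y. x \<in> L \<Longrightarrow> y \<in> L \<Longrightarrow> x + y \<in> L" "\<And>x y. x \<in> L \<Longrightarrow> y \<in> L \<Longrightarrow> x * y \<in> L"
    "\<And>x. x \<in> L \<Longrightarrow> - x \<in> L" "\<And>x y. x \<in> L \<Longrightarrow> y \<in> L \<Longrightarrow> x - y \<in> L" "\<And>x y. x \<in> L \<Longrightarrow> y \<in> L \<Longrightarrow> x / y \<in> L"
    "\<And>x n. x \<in> L \<Longrightarrow> x ^ n \<in> L" "numeral k \<in> L"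
proof -
  note d = assms[unfolded subfield_set_def]
  show "0 \<in> L" "1 \<in> L" "\<And>x y. x \<in> L \<Longrightarrow> y \<in> L \<Longrightarrow> x + y \<in> L" "\<And>x y. x \<in> L \<Longrightarrow> y \<in> L \<Longrightarrow> x * y \<in> L"
    "\<And>x. x \<in> L \<Longrightarrow> - x \<in> L" using d by blast+
  show "\<And>x y. x \<in> L \<Longrightarrow> y \<in> L \<Longrightarrow> x - y \<in> L" using d by (metis add_uminus_conv_diff)
  show "\<And>x y. x \<in> L \<Longrightarrow> y \<in> L \<Longrightarrow> x / y \<in> L" using d by (metis divide_inverse)
  show "x ^ n \<in> L" if "x \<in> L" for x n by (induction n) (use d that in auto)
  have "of_nat n \<in> L" for n by (induction n) (use d in auto)
  from this[of "numeral k"] show "numeral k \<in> L" by simp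
qed

lemma is_subfield_coeff_mult:
  assumes K: "is_subfield K" and "\<forall>i. coeff p i \<in> K" "\<forall>i. coeff q i \<in> K"
  shows "\<forall>i. coeff (p * q) i \<in> K"
proof
  fix i
  have s: "sum f A \<in> K" if "\<And>x. f x \<in> K" for f :: "nat \<Rightarrow> complex" and A
    by (induction A rule: infinite_finite_induct) (use K that in \<open>auto simp: is_subfield_def\<close>)
  show "coeff (p * q) i \<in> K" unfolding coeff_mult by (rule s) (use assms in \<open>auto simp: is_subfield_def\<close>)
qed

lemma ratfuns_overI:
  "b \<noteq> 0 \<Longrightarrow> \<forall>i. coeff a i \<in> K \<Longrightarrow> \<forall>i. coeff b i \<in> K \<Longrightarrow> Fract a b \<in> ratfuns_over K"
  unfolding ratfuns_over_def by blast

lemma ratfuns_over_subfield: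
  assumes K: "is_subfield K"
  shows "subfield_set (ratfuns_over K)"
proof -
  have k: "0 \<in> K" "1 \<in> K" "\<And>x y. x \<in> K \<Longrightarrow> y \<in> K \<Longrightarrow> x + y \<in> K" "\<And>x. x \<in> K \<Longrightarrow> - x \<in> K"
    using K by (auto simp: is_subfield_def)
  note m = is_subfield_coeff_mult[OF K]
  have one: "\<forall>i. coeff (1 :: complex poly) i \<in> K" using k by (simp add: coeff_1)
  have zero: "0 \<in> ratfuns_over K" unfolding Zero_fract_def by (rule ratfuns_overI) (use one k(1) in simp_all)
  show ?thesis unfolding subfield_set_def
  proof (intro conjI ballI)
    show "0 \<in> ratfuns_over K" by (rule zero)
    show "1 \<in> ratfuns_over K" unfolding One_fract_def by (rule ratfuns_overI) (use one in simp_all)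
  next
    fix x y assume "x \<in> ratfuns_over K" "y \<in> ratfuns_over K"
    then obtain a b c d where h: "x = Fract a b" "b \<noteq> 0" "\<forall>i. coeff a i \<in> K" "\<forall>i. coeff b i \<in> K"
      "y = Fract c d" "d \<noteq> 0" "\<forall>i. coeff c i \<in> K" "\<forall>i. coeff d i \<in> K" unfolding ratfuns_over_def by blast
    have "x + y = Fract (a * d + c * b) (b * d)" using h by simp
    moreover have "\<forall>i. coeff (a * d + c * b) i \<in> K" using m[OF h(3,8)] m[OF h(7,4)] k(3) by simp
    ultimately show "x + y \<in> ratfuns_over K" using ratfuns_overI[OF _ _ m[OF h(4,8)]] h(2,6) by simp
    have "x * y = Fract (a * c) (b * d)" using h by simp
    thus "x * y \<in> ratfuns_over K" using ratfuns_overI[OF _ m[OF h(3,7)] m[OF h(4,8)]] h(2,6) by simp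
  next
    fix x assume "x \<in> ratfuns_over K"
    then obtain a b where h: "x = Fract a b" "b \<noteq> 0" "\<forall>i. coeff a i \<in> K" "\<forall>i. coeff b i \<in> K" unfolding ratfuns_over_def by blast
    have "- x = Fract (- a) b" using h by simp
    thus "- x \<in> ratfuns_over K" using ratfuns_overI[of b "- a" K] h k(4) by simp
    show "inverse x \<in> ratfuns_over K"
    proof (cases "a = 0")
      case True
      have "x = 0" unfolding h(1) True by (simp only: fract_collapse)
      thus ?thesis using zero by simp
    next
      case False
      have "inverse x = Fract b a" using h by simp
      thus ?thesis using ratfuns_overI[OF False h(4,3)] by simp
    qed
  qed
qed

lemma const_in_ratfuns_over: "is_subfield K \<Longrightarrow> c \<in> K \<Longrightarrow> const c \<in> ratfuns_over K"
proof -
  assume K: "is_subfield K" "c \<in> K"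
  have "const c = Fract [:c:] 1" by (simp add: const_def to_fract_def)
  moreover have "\<forall>i. coeff [:c:] i \<in> K" "\<forall>i. coeff (1 :: complex poly) i \<in> K"
    using K by (auto simp: is_subfield_def coeff_pCons coeff_1 split: nat.splits)
  ultimately show ?thesis using ratfuns_overI by (metis zero_neq_one)
qed

lemma var_in_ratfuns_over: "is_subfield K \<Longrightarrow> var \<in> ratfuns_over K"
proof -
  assume K: "is_subfield K"
  have "var = Fract [:0, 1:] 1" by (simp add: var_def to_fract_def)
  moreover have "\<forall>i. coeff [:0, 1 :: complex:] i \<in> K" "\<forall>i. coeff (1 :: complex poly) i \<in> K"
    using K by (auto simp: is_subfield_def coeff_pCons coeff_1 split: nat.splits)
  ultimately show ?thesis using ratfuns_overI by (metis zero_neq_one)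
qed

lemma ec_points_iff: "P \<in> ec_points E L \<longleftrightarrow> on_curve E P \<and> (\<forall>x y. P = Affine x y \<longrightarrow> x \<in> L \<and> y \<in> L)"
  by (simp add: ec_points_def)

lemma ec_points_add:
  assumes L: "subfield_set L" and P: "P \<in> ec_points inose_curve L" and Q: "Q \<in> ec_points inose_curve L"
  shows "ec_add inose_curve P Q \<in> ec_points inose_curve L"
proof -
  note c = subfield_setD[OF L]
  have "on_curve inose_curve (ec_add inose_curve P Q)" using pullback_coeff_ec_add(1) P Q by (simp add: ec_points_iff)
  moreover have "\<forall>x y. ec_add inose_curve P Q = Affine x y \<longrightarrow> x \<in> L \<and> y \<in> L"
    using P Q by (cases P; cases Q) (auto simp: ec_points_iff ec_third_def Let_def intro!: c split: if_splits)
  ultimately show ?thesis by (simp add: ec_points_iff)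
qed

lemma ec_points_twist:
  assumes L: "subfield_set L" and P: "P \<in> ec_points inose_curve L" and w: "w^3 = 1" "const w \<in> L"
  shows "twist w P \<in> ec_points inose_curve L"
  using pullback_coeff_twist(1)[OF w(1), of P] P w(2) subfield_setD[OF L] by (cases P) (auto simp: ec_points_iff simp del: on_curve.simps)

lemma ec_group_group:
  assumes L: "subfield_set L"
  shows "group (ec_group inose_curve L)"
proof (rule groupI)
  let ?G = "ec_group inose_curve L"
  have car: "carrier ?G = ec_points inose_curve L" "mult ?G = ec_add inose_curve" "one ?G = Infinity"
    by (simp_all add: ec_group_def)
  have on: "on_curve inose_curve x" if "x \<in> carrier ?G" for x using that by (simp add: car ec_points_iff)
  show "one ?G \<in> carrier ?G" by (simp add: car ec_points_iff)
  fix x y z assume x: "x \<in> carrier ?G"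
  show "one ?G \<otimes>\<^bsub>?G\<^esub> x = x" by (simp add: car)
  have t: "twist 1 x \<in> carrier ?G" using ec_points_twist[OF L, of x 1] x subfield_setD(2)[OF L] by (simp add: car)
  have "ec_add inose_curve (twist 1 x) x = Infinity"
    by (rule pullback_coeff_inject) (use pullback_coeff_ec_add[OF on[OF t] on[OF x]] pullback_coeff_twist(2)[OF _ on[OF x], of 1] in simp_all)
  thus "\<exists>y\<in>carrier ?G. y \<otimes>\<^bsub>?G\<^esub> x = one ?G" using t by (auto simp: car)
  assume y: "y \<in> carrier ?G"
  show "x \<otimes>\<^bsub>?G\<^esub> y \<in> carrier ?G" using ec_points_add[OF L] x y by (simp add: car)
  assume z: "z \<in> carrier ?G"
  show "x \<otimes>\<^bsub>?G\<^esub> y \<otimes>\<^bsub>?G\<^esub> z = x \<otimes>\<^bsub>?G\<^esub> (y \<otimes>\<^bsub>?G\<^esub> z)" unfolding car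
    by (rule pullback_coeff_inject) (use pullback_coeff_ec_add on x y z in simp_all)
qed

lemma pullback_coeff_int_pow:
  assumes L: "subfield_set L" and x: "x \<in> carrier (ec_group inose_curve L)"
  shows "x [^]\<^bsub>ec_group inose_curve L\<^esub> (k :: int) \<in> carrier (ec_group inose_curve L)"
    "pullback_coeff (x [^]\<^bsub>ec_group inose_curve L\<^esub> k) = of_int k * pullback_coeff x"
proof -
  let ?G = "ec_group inose_curve L"
  interpret group ?G by (rule ec_group_group[OF L])
  have car: "mult ?G = ec_add inose_curve" "one ?G = Infinity" by (simp_all add: ec_group_def)
  have on: "on_curve inose_curve x" if "x \<in> carrier ?G" for x using that by (simp add: ec_group_def ec_points_iff)
  show "x [^]\<^bsub>?G\<^esub> k \<in> carrier ?G" using x by simp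
  have mult: "pullback_coeff (a \<otimes>\<^bsub>?G\<^esub> b) = pullback_coeff a + pullback_coeff b" if "a \<in> carrier ?G" "b \<in> carrier ?G" for a b
    using pullback_coeff_ec_add(2) on that by (simp add: car)
  have n: "pullback_coeff (x [^]\<^bsub>?G\<^esub> (n :: nat)) = of_nat n * pullback_coeff x" for n
  proof (induction n)
    case 0 show ?case by (simp add: car)
  next
    case (Suc n)
    have "pullback_coeff (x [^]\<^bsub>?G\<^esub> Suc n) = pullback_coeff (x [^]\<^bsub>?G\<^esub> n) + pullback_coeff x"
      unfolding nat_pow_Suc by (rule mult) (use x in simp_all)
    thus ?case using Suc by (simp add: algebra_simps)
  qed
  have inv: "pullback_coeff (inv\<^bsub>?G\<^esub> a) = - pullback_coeff a" if a: "a \<in> carrier ?G" for a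
    using mult[OF inv_closed[OF a] a] a l_inv[OF a] by (simp add: car eq_neg_iff_add_eq_0)
  obtain n where "k = int n \<or> k = - int n" by (metis int_cases2)
  thus "pullback_coeff (x [^]\<^bsub>?G\<^esub> k) = of_int k * pullback_coeff x"
    using n[of n] inv x by (auto simp: int_pow_int int_pow_neg)
qed

lemma rats_subfield: "is_subfield \<rat>" by (auto simp: is_subfield_def)

lemma Q_adjoin_subfield: "is_subfield (Q_adjoin w)"
  unfolding Q_adjoin_def is_subfield_def by blast

text \<open>The numbers \<open>a + b \<omega>\<close> with rational \<open>a\<close>, \<open>b\<close> form a field, and each is a root of
  \<open>x^2 - (2 a - b) x + (a^2 - a b + b^2)\<close>.\<close>

lemma Q_adjoin_eisenstein_algebraic:
  assumes w: "\<omega>^2 = - 1 - \<omega>" "Im \<omega> \<noteq> 0"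
  shows "Q_adjoin \<omega> \<subseteq> Qbar"
proof -
  define K where "K = {of_rat a + of_rat b * \<omega> | a b. True}"
  have KI: "of_rat a + of_rat b * \<omega> \<in> K" for a b unfolding K_def by blast
  have "is_subfield K" unfolding is_subfield_def
  proof (intro conjI ballI)
    show "0 \<in> K" "1 \<in> K" using KI[of 0 0] KI[of 1 0] by simp_all
  next
    fix x y assume "x \<in> K" "y \<in> K"
    then obtain a b c d where h: "x = of_rat a + of_rat b * \<omega>" "y = of_rat c + of_rat d * \<omega>" unfolding K_def by blast
    have "x + y = of_rat (a + c) + of_rat (b + d) * \<omega>" by (simp add: h of_rat_add algebra_simps)
    thus "x + y \<in> K" using KI by metis
    have "x * y = of_rat a * of_rat c + (of_rat a * of_rat d + of_rat b * of_rat c) * \<omega> + of_rat b * of_rat d * \<omega>^2"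
      by (simp add: h algebra_simps power2_eq_square)
    hence "x * y = of_rat (a * c - b * d) + of_rat (a * d + b * c - b * d) * \<omega>"
      unfolding w by (simp add: of_rat_add of_rat_mult of_rat_diff algebra_simps)
    thus "x * y \<in> K" using KI by metis
  next
    fix x assume "x \<in> K"
    then obtain a b where h: "x = of_rat a + of_rat b * \<omega>" unfolding K_def by blast
    have "- x = of_rat (- a) + of_rat (- b) * \<omega>" by (simp add: h of_rat_minus)
    thus "- x \<in> K" using KI by metis
    show "inverse x \<in> K"
    proof (cases "x = 0")
      case True thus ?thesis using KI[of 0 0] by simp
    next
      case False
      define n where "n = a^2 - a * b + b^2"
      have "x * (of_rat (a - b) - of_rat b * \<omega>) = of_rat a * of_rat a - of_rat a * of_rat b - of_rat b * of_rat b * \<omega> - of_rat b * of_rat b * \<omega>^2"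
        by (simp add: h of_rat_diff algebra_simps power2_eq_square)
      hence n: "x * (of_rat (a - b) - of_rat b * \<omega>) = of_rat n"
        unfolding w n_def by (simp add: of_rat_add of_rat_mult of_rat_diff of_rat_power algebra_simps power2_eq_square)
      have n0: "n \<noteq> 0"
      proof
        assume "n = 0"
        hence "(2 * a - b)^2 + 3 * b^2 = 0" unfolding n_def by (simp add: power2_eq_square algebra_simps)
        hence "b = 0" by (smt (verit) zero_le_power2 power2_eq_square mult_eq_0_iff sum_power2_eq_zero_iff add_nonneg_eq_0_iff mult_nonneg_nonneg zero_le_numeral power_zero_numeral zero_neq_numeral)
        hence "a = 0" using \<open>n = 0\<close> by (simp add: n_def)
        thus False using \<open>b = 0\<close> False h by simp
      qed
      have "of_rat (a - b) - of_rat b * \<omega> = of_rat n * inverse x" using n False by (simp add: field_simps)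
      hence "inverse x = (of_rat (a - b) - of_rat b * \<omega>) / of_rat n" using n0 by (simp add: field_simps)
      hence "inverse x = of_rat ((a - b) / n) + of_rat (- b / n) * \<omega>"
        unfolding of_rat_divide of_rat_minus by (simp add: diff_divide_distrib)
      thus ?thesis using KI by metis
    qed
  qed
  moreover have "\<omega> \<in> K" using KI[of 0 1] by simp
  ultimately have "Q_adjoin \<omega> \<subseteq> K" unfolding Q_adjoin_def by blast
  moreover have "K \<subseteq> Qbar"
  proof
    fix x assume "x \<in> K"
    then obtain a b where h: "x = of_rat a + of_rat b * \<omega>" unfolding K_def by blast
    let ?p = "[:of_rat (a^2 - a * b + b^2), of_rat (b - 2 * a), 1 :: complex:]"
    have "poly ?p x = of_rat b ^ 2 * (\<omega>^2 + 1 + \<omega>)"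
      unfolding h by (simp add: of_rat_add of_rat_mult of_rat_diff of_rat_power algebra_simps power2_eq_square)
    hence "poly ?p x = 0" by (simp add: w)
    moreover have "coeff ?p i \<in> \<rat>" for i by (auto simp: coeff_pCons split: nat.splits)
    ultimately show "x \<in> Qbar" unfolding Qbar_def by (auto intro: algebraicI'[of ?p])
  qed
  ultimately show ?thesis by blast
qed

section \<open>The explicit section\<close>

text \<open>The triple of the section \<open>P\<close>. With \<open>u = s^2 + 9 = 6 s S\<close>, its first two members are the numerators of \<open>X\<close> and \<open>Y\<close>, homogenised in
  \<open>u\<close> and \<open>s\<close>, the second times \<open>s + 3\<close>; the common denominator \<open>s d\<close> is \<open>48 s (s - 3)\<close>.\<close>

definition generator_p :: "complex poly" where "generator_p = [:729, -45198, 312255, 881820, 34695, -558, 1:]"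

definition generator_B :: "complex poly" where "generator_B = [:19683, -1830519, 41019372, -63134316, 988554618, 329518206, -2338308, 168804, -837, 1:]"

definition generator_d :: "complex poly" where "generator_d = [:-144, 48:]"

lemma generator_triple: "section_triple generator_p generator_B generator_d"
proof -
  have "coprime generator_p (s_poly * generator_d)"
  proof -
    have "coprime (s_poly * generator_d) generator_p"
    proof (rule complex_poly_coprimeI)
      fix z assume "poly (s_poly * generator_d) z = 0"
      hence "z = 0 \<or> 48 * z = 144" by (simp add: generator_d_def)
      hence "z = 0 \<or> z = 3" by auto
      thus "poly generator_p z \<noteq> 0" by (auto simp: generator_p_def)
    qed (simp add: generator_p_def)
    thus ?thesis by (simp only: coprime_commute)
  qed
  moreover have "generator_B^2 = generator_p^3 + disc_poly * s_poly^5 * generator_d^6"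
    by (simp add: generator_B_def generator_p_def generator_d_def disc_poly_def s_poly_def eval_nat_numeral)
  ultimately show ?thesis by (simp add: section_triple_def generator_d_def)
qed

lemma generator_coordinates:
  fixes s S X Y :: ratfun
  assumes "s = var" "S = 1 / 2 * (s / 3 + 3 / s)"
    and "X = (S^3 - 93 * S^2 + 963 * S + 4129) / (64 * (S - 1))"
    and "Y = 3 * s * (s + 3) * (S^4 - 140 * S^3 + 4758 * S^2 - 13100 * S + 258481) / (256 * (s - 3)^3)"
  shows "Affine X Y = section_point generator_p generator_B generator_d"
proof -
  have s: "s = to_fract s_poly" "s \<noteq> 0" using assms(1) by (simp_all add: var_eq)
  have "s - 3 = to_fract [:-3, 1:]"
  proof -
    have "s - 3 = to_fract (s_poly - 3)" by (simp add: s(1) to_fract_numeral)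
    thus ?thesis by (simp add: s_poly_def numeral_poly)
  qed
  hence s3: "s - 3 \<noteq> 0" by simp
  have u: "6 * s * S = s^2 + 9" using s(2) by (simp add: assms(2) field_simps power2_eq_square)
  have S1: "6 * s * (S - 1) = (s - 3)^2" using u by (simp add: algebra_simps power2_eq_square)
  have p: "to_fract generator_p = 216 * s^3 * (S^3 - 93 * S^2 + 963 * S + 4129)"
  proof -
    have "to_fract generator_p = to_fract ((s_poly^2 + 9)^3 - 558 * s_poly * (s_poly^2 + 9)^2 + 34668 * s_poly^2 * (s_poly^2 + 9) + 891864 * s_poly^3)"
      by (simp only: to_fract_eq_iff) (simp add: generator_p_def s_poly_def eval_nat_numeral numeral_poly)
    also have "\<dots> = (s^2 + 9)^3 - 558 * s * (s^2 + 9)^2 + 34668 * s^2 * (s^2 + 9) + 891864 * s^3"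
      by (simp add: to_fract_power to_fract_numeral s(1))
    also have "\<dots> = 216 * s^3 * (S^3 - 93 * S^2 + 963 * S + 4129)"
      unfolding u[symmetric] by (simp add: algebra_simps eval_nat_numeral)
    finally show ?thesis .
  qed
  have B: "to_fract generator_B = (s + 3) * (1296 * s^4 * (S^4 - 140 * S^3 + 4758 * S^2 - 13100 * S + 258481))"
  proof -
    have "to_fract generator_B = to_fract ((s_poly + 3) * ((s_poly^2 + 9)^4 - 840 * s_poly * (s_poly^2 + 9)^3
        + 171288 * s_poly^2 * (s_poly^2 + 9)^2 - 2829600 * s_poly^3 * (s_poly^2 + 9) + 334991376 * s_poly^4))"
      by (simp only: to_fract_eq_iff) (simp add: generator_B_def s_poly_def eval_nat_numeral numeral_poly)
    also have "\<dots> = (s + 3) * ((s^2 + 9)^4 - 840 * s * (s^2 + 9)^3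
        + 171288 * s^2 * (s^2 + 9)^2 - 2829600 * s^3 * (s^2 + 9) + 334991376 * s^4)"
      by (simp add: to_fract_power to_fract_numeral s(1))
    also have "(s^2 + 9)^4 - 840 * s * (s^2 + 9)^3
        + 171288 * s^2 * (s^2 + 9)^2 - 2829600 * s^3 * (s^2 + 9) + 334991376 * s^4
      = 1296 * s^4 * (S^4 - 140 * S^3 + 4758 * S^2 - 13100 * S + 258481)"
      unfolding u[symmetric] by (simp add: algebra_simps eval_nat_numeral)
    finally show ?thesis .
  qed
  have E: "to_fract (s_poly * generator_d) = 48 * s * (s - 3)"
  proof -
    have "s_poly * generator_d = 48 * s_poly * (s_poly - 3)"
      by (simp add: generator_d_def s_poly_def numeral_poly)
    hence "to_fract (s_poly * generator_d) = to_fract (48 * s_poly * (s_poly - 3))" by (simp only:)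
    also have "\<dots> = 48 * s * (s - 3)" by (simp add: to_fract_numeral s(1))
    finally show ?thesis .
  qed
  have "S - 1 \<noteq> 0" using S1 s3 s(2) by auto
  have "X = to_fract generator_p / (48 * s * (s - 3))^2"
  proof -
    define M where "M = S^3 - 93 * S^2 + 963 * S + 4129"
    have "(48 * s * (s - 3))^2 = 2304 * s^2 * (s - 3)^2" by (simp add: power_mult_distrib)
    also have "\<dots> = 216 * s^3 * (64 * (S - 1))" unfolding S1[symmetric] by (simp add: eval_nat_numeral)
    finally have "to_fract generator_p / (48 * s * (s - 3))^2 = (216 * s^3 * M) / (216 * s^3 * (64 * (S - 1)))"
      unfolding p M_def by (simp only:)
    also have "\<dots> = M / (64 * (S - 1))" using s(2) by (intro mult_divide_mult_cancel_left) simp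
    finally show ?thesis unfolding assms(3) M_def by (simp only:)
  qed
  moreover have "Y = to_fract generator_B / (48 * s * (s - 3))^3"
  proof -
    define M where "M = S^4 - 140 * S^3 + 4758 * S^2 - 13100 * S + 258481"
    have "to_fract generator_B / (48 * s * (s - 3))^3 = (432 * s^3) * (3 * s * (s + 3) * M) / ((432 * s^3) * (256 * (s - 3)^3))"
    proof -
      have "(48 * s * r)^3 = (432 * s^3) * (256 * r^3)" for r by (simp add: power_mult_distrib)
      moreover have "(s + 3) * (1296 * s^4 * M) = (432 * s^3) * (3 * s * (s + 3) * M)"
        by (simp add: algebra_simps eval_nat_numeral)
      ultimately show ?thesis unfolding B M_def[symmetric] by (simp only:)
    qed
    also have "\<dots> = 3 * s * (s + 3) * M / (256 * (s - 3)^3)" using s(2) by (intro mult_divide_mult_cancel_left) simp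
    finally show ?thesis unfolding assms(4) M_def by (simp only:)
  qed
  ultimately show ?thesis unfolding section_point_def E by simp
qed

lemma inose_curve_eq:
  assumes "s = var"
  shows "WCurve 0 0 (- 27 * (s - 506 + 9 / s)) = inose_curve"
    "inose_curve = inose_F1 curve_E1 curve_E2"
proof -
  have "to_fract disc_poly = to_fract (- 27 * (s_poly^2 - 506 * s_poly + 9))"
    by (simp only: to_fract_eq_iff) (simp add: disc_poly_def s_poly_def eval_nat_numeral numeral_poly)
  also have "\<dots> = - 27 * (s^2 - 506 * s + 9)" by (simp add: to_fract_power to_fract_numeral assms var_eq)
  finally have "inose_f = - 27 * (s^2 - 506 * s + 9) / s" by (simp add: inose_f_def assms)
  also have "\<dots> = - 27 * (s - 506 + 9 / s)" using var_nz by (simp add: assms field_simps power2_eq_square)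
  finally have f: "inose_f = - 27 * (s - 506 + 9 / s)" .
  thus "WCurve 0 0 (- 27 * (s - 506 + 9 / s)) = inose_curve" by (simp add: inose_curve_def inose_f_def)
  have "inose_A curve_E1 curve_E2 = 0" by (simp add: inose_A_def curve_E1_def)
  moreover have "ec_disc curve_E1 = - 1728" "ec_disc curve_E2 = - 15552"
    by (simp_all add: ec_disc_def curve_E1_def curve_E2_def)
  moreover have "inose_B curve_E1 curve_E2 = 874368" by (simp add: inose_B_def curve_E1_def curve_E2_def)
  moreover have "1 / 64 * (const (- 1728) * var + const 874368 + const (- 15552) / var) = inose_f"
    unfolding f const_uminus const_numeral assms using var_nz by (simp add: field_simps)
  ultimately show "inose_curve = inose_F1 curve_E1 curve_E2"
    by (simp add: inose_F1_def inose_curve_def inose_f_def)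
qed

section \<open>The Mordell-Weil lattice\<close>

theorem mainTheorem3:
  fixes \<omega> :: complex and s S X Y :: ratfun and F :: "ratfun wcurve" and P P' :: "ratfun point"
  assumes "\<omega> = (- 1 + csqrt (- 3)) / 2"
    and "s = var"
    and "F = WCurve 0 0 (- 27 * (s - 506 + 9 / s))"
    and "S = 1 / 2 * (s / 3 + 3 / s)"
    and "X = (S^3 - 93 * S^2 + 963 * S + 4129) / (64 * (S - 1))"
    and "Y = 3 * s * (s + 3) * (S^4 - 140 * S^3 + 4758 * S^2 - 13100 * S + 258481)
             / (256 * (s - 3)^3)"
    and "P = Affine X Y"
    and "P' = Affine (const \<omega> * X) (- Y)"
  shows "F = inose_F1 curve_E1 curve_E2
    \<and> P \<in> ec_points F (ratfuns_over \<rat>)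
    \<and> height_matrix F [P, P'] = [[6, 3], [3, 6]]
    \<and> is_Z_basis_pair (ec_group F (ratfuns_over Qbar)) P P'
    \<and> ec_points F (ratfuns_over Qbar) = ec_points F (ratfuns_over (Q_adjoin \<omega>))"
proof -
  note ws = cube_root_of_unity_facts[OF assms(1)]
  have F: "F = inose_curve" using inose_curve_eq(1)[OF assms(2)] assms(3) by simp
  have Pg: "P = section_point generator_p generator_B generator_d" using generator_coordinates[OF assms(2,4-6)] assms(7) by simp
  have P: "on_curve inose_curve P" using section_on_curve[OF generator_triple] Pg by simp
  have hP: "naive_height P = 6" using naive_height_section[OF generator_triple] Pg by (simp add: generator_p_def)
  have P't: "P' = twist \<omega> P" using assms(7,8) by simp
  have P': "on_curve inose_curve P'" "pullback_coeff P' = - \<omega> * pullback_coeff P" unfolding P't using pullback_coeff_twist[OF ws(2) P] .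
  have sP: "pullback_coeff P \<noteq> 0" using pullback_coeff_eq_0_iff[OF P] assms(7) by simp

  have over: "P \<in> ec_points inose_curve (ratfuns_over K)" if K: "is_subfield K" for K
  proof -
    note c = subfield_setD[OF ratfuns_over_subfield[OF K]]
    have s: "s \<in> ratfuns_over K" using var_in_ratfuns_over[OF K] assms(2) by simp
    have S: "S \<in> ratfuns_over K" unfolding assms(4) by (intro c s)
    have "X \<in> ratfuns_over K" unfolding assms(5) by (intro c S)
    moreover have "Y \<in> ratfuns_over K" unfolding assms(6) by (intro c S s)
    ultimately show ?thesis using P assms(7) by (simp add: ec_points_iff)
  qed

  \<comment> \<open>Both sections and all their pairwise sums are of the form \<open>(a + b \<omega>) P\<close>, with norms 1, 3 and 4.\<close>
  have heights: "canonical_height inose_curve R = 3 * of_int (a^2 - a * b + b^2)"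
    if "on_curve inose_curve R" "pullback_coeff R = (of_int a + of_int b * \<omega>) * pullback_coeff P" for R a b
  proof -
    have "int (naive_height R) = (a^2 - a * b + b^2) * 6"
      using naive_height_eisenstein_multiple[OF ws(2,1) P that] hP by simp
    hence "real (naive_height R) = of_int ((a^2 - a * b + b^2) * 6)" by (metis of_int_of_nat_eq)
    thus ?thesis using canonical_height_eq[OF that(1)] by simp
  qed
  have "canonical_height inose_curve P = 3" using heights[OF P, of 1 0] by simp
  moreover have "canonical_height inose_curve P' = 3" using heights[OF P'(1), of 0 "-1"] P'(2) by simp
  moreover have "canonical_height inose_curve (ec_add inose_curve P P) = 12"
    using heights[OF pullback_coeff_ec_add(1)[OF P P], of 2 0] pullback_coeff_ec_add(2)[OF P P] by simp
  moreover have "canonical_height inose_curve (ec_add inose_curve P' P') = 12"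
    using heights[OF pullback_coeff_ec_add(1)[OF P'(1) P'(1)], of 0 "-2"] pullback_coeff_ec_add(2)[OF P'(1) P'(1)] P'(2) by simp
  moreover have "canonical_height inose_curve (ec_add inose_curve P P') = 9"
    using heights[OF pullback_coeff_ec_add(1)[OF P P'(1)], of 1 "-1"] pullback_coeff_ec_add(2)[OF P P'(1)] P'(2) by (simp add: algebra_simps)
  moreover have "canonical_height inose_curve (ec_add inose_curve P' P) = 9"
    using heights[OF pullback_coeff_ec_add(1)[OF P'(1) P], of 1 "-1"] pullback_coeff_ec_add(2)[OF P'(1) P] P'(2) by (simp add: algebra_simps)
  ultimately have hm: "height_matrix F [P, P'] = [[6, 3], [3, 6]]"
    by (simp add: height_matrix_def height_pairing_def F)

  let ?K = "Q_adjoin \<omega>"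
  have K: "is_subfield ?K" by (rule Q_adjoin_subfield)
  have wK: "\<omega> \<in> ?K" by (simp add: Q_adjoin_def)
  have all_over: "R \<in> ec_points inose_curve (ratfuns_over ?K)" if R: "on_curve inose_curve R" for R
  proof -
    let ?L = "ratfuns_over ?K" let ?G = "ec_group inose_curve ?L"
    have L: "subfield_set ?L" by (rule ratfuns_over_subfield[OF K])
    have car: "carrier ?G = ec_points inose_curve ?L" by (simp add: ec_group_def)
    have PG: "P \<in> carrier ?G" using over[OF K] by (simp add: car)
    have PG': "P' \<in> carrier ?G" unfolding P't car
      by (rule ec_points_twist[OF L over[OF K] ws(2) const_in_ratfuns_over[OF K wK]])
    obtain a b :: int where ab: "pullback_coeff R = (of_int a + of_int b * \<omega>) * pullback_coeff P"
      using pullback_coeff_lattice[OF assms(1) P hP R] .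
    let ?A = "P [^]\<^bsub>?G\<^esub> a" and ?B = "P' [^]\<^bsub>?G\<^esub> (- b)"
    note A = pullback_coeff_int_pow[OF L PG, of a] and B = pullback_coeff_int_pow[OF L PG', of "- b"]
    have on: "on_curve inose_curve ?A" "on_curve inose_curve ?B" using A(1) B(1) by (simp_all add: car ec_points_iff)
    have "R = ec_add inose_curve ?A ?B"
      by (rule pullback_coeff_inject) (use R pullback_coeff_ec_add[OF on] A(2) B(2) ab P'(2) in \<open>simp_all add: algebra_simps\<close>)
    moreover have "ec_add inose_curve ?A ?B \<in> ec_points inose_curve ?L"
      by (rule ec_points_add[OF L]) (use A B in \<open>simp_all add: car\<close>)
    ultimately show ?thesis by simp
  qed
  have sub: "ratfuns_over ?K \<subseteq> ratfuns_over Qbar"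
    using Q_adjoin_eisenstein_algebraic[OF ws(1)] ws(4) unfolding ratfuns_over_def by fastforce
  have eqK: "ec_points inose_curve (ratfuns_over ?K) = ec_points inose_curve UNIV"
    using all_over by (auto simp: ec_points_iff)
  \<comment> \<open>All points over \<open>\<complex>(s)\<close> are already defined over \<open>\<rat>(\<omega>)(s)\<close>, which lies in \<open>ratfuns_over Qbar\<close>.\<close>
  have eqQ: "ec_points inose_curve (ratfuns_over Qbar) = ec_points inose_curve UNIV"
  proof -
    have "ec_points inose_curve (ratfuns_over ?K) \<subseteq> ec_points inose_curve (ratfuns_over Qbar)"
      using sub by (auto simp: ec_points_def)
    thus ?thesis unfolding eqK by (auto simp: ec_points_iff)
  qed

  have "is_Z_basis_pair (ec_group inose_curve UNIV) P P'"
  proof -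
    let ?G = "ec_group inose_curve UNIV"
    have L: "subfield_set UNIV" by (simp add: subfield_set_def)
    have car: "carrier ?G = {R. on_curve inose_curve R}" "mult ?G = ec_add inose_curve"
      by (auto simp: ec_group_def ec_points_iff)
    have PG: "P \<in> carrier ?G" "P' \<in> carrier ?G" using P P' by (simp_all add: car)
    note A = pullback_coeff_int_pow[OF L PG(1)] and B = pullback_coeff_int_pow[OF L PG(2)]
    have comb: "R = (P [^]\<^bsub>?G\<^esub> a) \<otimes>\<^bsub>?G\<^esub> (P' [^]\<^bsub>?G\<^esub> b) \<longleftrightarrow> pullback_coeff R = (of_int a - of_int b * \<omega>) * pullback_coeff P"
      if R: "on_curve inose_curve R" for R and a b :: int
    proof -
      have on: "on_curve inose_curve (P [^]\<^bsub>?G\<^esub> a)" "on_curve inose_curve (P' [^]\<^bsub>?G\<^esub> b)"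
        using A(1)[of a] B(1)[of b] by (simp_all add: car)
      have "pullback_coeff ((P [^]\<^bsub>?G\<^esub> a) \<otimes>\<^bsub>?G\<^esub> (P' [^]\<^bsub>?G\<^esub> b)) = (of_int a - of_int b * \<omega>) * pullback_coeff P"
        unfolding car pullback_coeff_ec_add(2)[OF on] A(2) B(2) P'(2) by (simp add: algebra_simps)
      thus ?thesis using pullback_coeff_inject[OF R] pullback_coeff_ec_add(1)[OF on] by (auto simp: car)
    qed
    have uniq: "a = a' \<and> b = b'"
      if "(of_int a - of_int b * \<omega>) * pullback_coeff P = (of_int a' - of_int b' * \<omega>) * pullback_coeff P" for a b a' b' :: int
    proof -
      have e: "of_int a - of_int b * \<omega> = of_int a' - of_int b' * \<omega>" using that sP by simp
      from arg_cong[OF e, of Im] have "b = b'" using ws(4) by simp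
      thus ?thesis using e by simp
    qed
    have "\<exists>!c :: int \<times> int. R = (P [^]\<^bsub>?G\<^esub> fst c) \<otimes>\<^bsub>?G\<^esub> (P' [^]\<^bsub>?G\<^esub> snd c)" if R: "R \<in> carrier ?G" for R
    proof -
      have R': "on_curve inose_curve R" using R by (simp add: car)
      obtain a b :: int where ab: "pullback_coeff R = (of_int a + of_int b * \<omega>) * pullback_coeff P"
        using pullback_coeff_lattice[OF assms(1) P hP R'] .
      show ?thesis unfolding comb[OF R']
      proof (rule ex1I[of _ "(a, - b)"])
        show "pullback_coeff R = (of_int (fst (a, - b)) - of_int (snd (a, - b)) * \<omega>) * pullback_coeff P" using ab by simp
        fix c :: "int \<times> int" assume c: "pullback_coeff R = (of_int (fst c) - of_int (snd c) * \<omega>) * pullback_coeff P"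
        have "(of_int (fst c) - of_int (snd c) * \<omega>) * pullback_coeff P = (of_int a - of_int (- b) * \<omega>) * pullback_coeff P"
          unfolding c[symmetric] ab by simp
        hence "fst c = a \<and> snd c = - b" by (rule uniq)
        thus "c = (a, - b)" by (cases c) simp
      qed
    qed
    thus ?thesis unfolding is_Z_basis_pair_def using PG by blast
  qed
  moreover have "ec_group inose_curve (ratfuns_over Qbar) = ec_group inose_curve UNIV"
    by (simp add: ec_group_def eqQ)
  ultimately show ?thesis using hm over[OF rats_subfield] eqK eqQ inose_curve_eq(2)[OF assms(2)] by (simp add: F)
qed

end
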